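(* For every $n_0\in\mathbb N$ and every $c\in X_{n_0}\setminus\mathbb M$, there exists a sequence $\{c_n\}_{n=3}^\infty$ such that $c_n\in X_n$ for every $n\ge 3$, and $$\lim_{n\to\infty}c_n=c.$$
   Context: For $c\in\mathbb C$ let $f_c(z)=z^2+c$. A point $z\in\mathbb C$ is periodic of period $n$ for $f_c$ if $n$ is the smallest positive integer with $f_c^{\circ n}(z)=z$; the multiplier of its orbit is $(f_c^{\circ n})'(z)$. A parameter $c_0\in\mathbb C$ is a critical point of a period $n$ multiplier if $f_{c_0}$ has a periodic orbit of period $n$ whose multiplier, viewed as a locally analytic function of $c$ (following the orbit analytically in $c$), has vanishing derivative at $c=c_0$. $X_n\subset\mathbb C$ is the set of all critical points of period $n$ multipliers. $\mathbb M\subset\mathbb C$ is the Mandelbrot set. *)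

theory Defs
  imports "HOL-Complex_Analysis.Complex_Analysis"
begin

definition quad :: "complex \<Rightarrow> complex \<Rightarrow> complex" where
  "quad c z = z\<^sup>2 + c"

definition periodic_point :: "complex \<Rightarrow> nat \<Rightarrow> complex \<Rightarrow> bool" where
  "periodic_point c n z \<longleftrightarrow>
     n > 0 \<and> (quad c ^^ n) z = z \<and> (\<forall>k. 0 < k \<and> k < n \<longrightarrow> (quad c ^^ k) z \<noteq> z)"

definition multiplier :: "complex \<Rightarrow> nat \<Rightarrow> complex \<Rightarrow> complex" where
  "multiplier c n z = deriv (quad c ^^ n) z"

text \<open>The function \<open>w\<close> below follows a point of a periodic orbit of exact period \<open>n\<close>
  holomorphically in a neighbourhood of \<open>c\<^sub>0\<close>. At the root of a primitive hyperbolic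
  component the degenerate orbit of multiplier 1 has no such continuation, so it does not
  contribute a critical point.\<close>

definition multiplier_critical_point :: "nat \<Rightarrow> complex \<Rightarrow> bool" where
  "multiplier_critical_point n c\<^sub>0 \<longleftrightarrow>
     (\<exists>U w. open U \<and> c\<^sub>0 \<in> U \<and> w holomorphic_on U \<and>
            (\<forall>c\<in>U. periodic_point c n (w c)) \<and>
            ((\<lambda>c. multiplier c n (w c)) has_field_derivative 0) (at c\<^sub>0))"

definition X :: "nat \<Rightarrow> complex set" where
  "X n = {c. multiplier_critical_point n c}"

definition Mandelbrot :: "complex set" where
  "Mandelbrot = {c. bounded (range (\<lambda>k. (quad c ^^ k) 0))}"

end

theory Submission
  imports Defs "HOL-Real_Asymp.Real_Asymp"
begin

text \<open>Write \<open>f\<close> for \<open>quad c\<close>. The proof has two independent parts.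

  \<^emph>\<open>Accumulation.\<close> Let \<open>c\<^sub>0\<close> be a critical point of the multiplier \<open>\<rho>\<close> of an orbit of period \<open>n\<^sub>0\<close>,
  followed as \<open>w c\<close>, and let \<open>c\<^sub>0\<close> lie outside the Mandelbrot set. Since the critical value
  escapes, all inverse branches of the iterates exist on the components of some level set
  \<open>norm (f\<^sup>L z) < norm c + 2\<close>; by the Schwarz lemma the orbit is repelling, and it has homoclinic
  orbits: points arbitrarily near \<open>w c\<^sub>0\<close>, off the cycle, that hit \<open>w c\<^sub>0\<close> after \<open>l\<close> steps, with \<open>l\<close> in
  any residue class modulo \<open>n\<^sub>0\<close> (\<open>escaping_parameter_homoclinic\<close>). Composing the \<open>k\<close>-th power of the
  local inverse of \<open>f\<close>-to-the-\<open>n\<^sub>0\<close> with a local inverse along the homoclinic orbit gives a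
  contraction depending holomorphically on \<open>c\<close>. Its fixed point has period \<open>l + k n\<^sub>0\<close> and its
  multiplier \<open>R\<^sub>k\<close> satisfies \<open>B\<^sub>1 \<le> norm (R\<^sub>k / \<rho> ^ k) \<le> B\<^sub>2\<close> with constants independent of \<open>k\<close>
  and of \<open>c\<close> in a fixed disc (\<open>homoclinic_family\<close>). By Cauchy's estimate
  \<open>R\<^sub>k' / (k R\<^sub>k)\<close> converges uniformly to \<open>\<rho>' / \<rho>\<close>, which vanishes at \<open>c\<^sub>0\<close> and is not identically zero
  because a multiplier is nowhere locally constant unless it is 1
  (\<open>multiplier_not_locally_constant\<close>). Hurwitz's theorem then produces zeros of \<open>R\<^sub>k'\<close>
  near \<open>c\<^sub>0\<close> for all large \<open>k\<close> (\<open>critical_points_accumulate\<close>).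

  \<^emph>\<open>Existence.\<close> The sequence must also have members for the finitely many small \<open>n \<ge> 3\<close>, so
  \<open>X n\<close> has to be nonempty for every \<open>n \<ge> 3\<close> (\<open>X_nonempty\<close>). Suppose it is empty. On the curve of pairs
  \<open>(c, z)\<close> with \<open>z\<close> of exact period \<open>n\<close> and multiplier different from 1, the multiplier is then a local
  homeomorphism; it is proper, hence a covering of the plane minus the point 1. The map
  \<open>t \<mapsto> 1 + exp (n t)\<close> lifts to the curve, and the first coordinate \<open>C\<close> of the lift is an entire function
  with nowhere vanishing derivative; \<open>norm (C t)\<close> is of the order of \<open>exp (2 Re t)\<close> in a right half-plane
  and bounded in the left one. Such a function is
  \<open>b + a exp (2 t)\<close>. Thus the multiplier would be \<open>1 + (const (C - b)) ^ (n/2)\<close>, whose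
  expansion at infinity in powers of the square root of \<open>C\<close> has no second term. The second
  coefficient of the true expansion is proportional to the sum of the signs in the itinerary,
  which is \<open>n - 2 \<noteq> 0\<close> for the itinerary \<open>+ ... + -\<close>, with which the lift can be started.\<close>

section \<open>Multipliers, and inverse functions depending on a parameter\<close>

definition qderiv :: "complex \<Rightarrow> nat \<Rightarrow> complex \<Rightarrow> complex" where
  "qderiv c n z = (\<Prod>i<n. 2 * (quad c ^^ i) z)"

lemma quad_iter_has_field_derivative:
  "((quad c ^^ n) has_field_derivative qderiv c n z) (at z)"
proof (induction n)
  case 0
  show ?case by (simp add: qderiv_def id_def)
next
  case (Suc n)
  have "((\<lambda>z. ((quad c ^^ n) z)\<^sup>2 + c) has_field_derivative 2 * (quad c ^^ n) z * qderiv c n z) (at z)"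
    by (auto intro!: derivative_eq_intros Suc)
  moreover have "(quad c ^^ Suc n) = (\<lambda>z. ((quad c ^^ n) z)\<^sup>2 + c)"
    by (auto simp: quad_def)
  ultimately show ?case
    by (simp add: qderiv_def mult.commute)
qed

lemma multiplier_eq_qderiv: "multiplier c n z = qderiv c n z"
  unfolding multiplier_def by (rule DERIV_imp_deriv[OF quad_iter_has_field_derivative])

lemma quad_iter_add: "(quad c ^^ (m + n)) z = (quad c ^^ n) ((quad c ^^ m) z)"
  by (metis add.commute comp_apply funpow_add)

lemma qderiv_add: "qderiv c (m + n) z = qderiv c m z * qderiv c n ((quad c ^^ m) z)"
proof (induction n)
  case (Suc n)
  then show ?case by (simp add: qderiv_def quad_iter_add del: funpow.simps)
qed (simp add: qderiv_def)

lemma continuous_on_quad_iter [continuous_intros]: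
  assumes "continuous_on S a" "continuous_on S b"
  shows "continuous_on S (\<lambda>x. (quad (a x) ^^ n) (b x))"
proof (induction n)
  case (Suc n)
  then show ?case using assms by (auto simp: quad_def intro!: continuous_intros)
qed (use assms in auto)

lemma continuous_on_qderiv [continuous_intros]:
  assumes "continuous_on S a" "continuous_on S b"
  shows "continuous_on S (\<lambda>x. qderiv (a x) n (b x))"
  unfolding qderiv_def using assms by (intro continuous_intros)

lemma holomorphic_on_quad_iter [holomorphic_intros]:
  assumes "a holomorphic_on S" "b holomorphic_on S"
  shows "(\<lambda>x. (quad (a x) ^^ n) (b x)) holomorphic_on S"
proof (induction n)
  case (Suc n)
  then show ?case using assms by (auto simp: quad_def intro!: holomorphic_intros)
qed (use assms in auto)

lemma holomorphic_on_qderiv [holomorphic_intros]: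
  assumes "a holomorphic_on S" "b holomorphic_on S"
  shows "(\<lambda>x. qderiv (a x) n (b x)) holomorphic_on S"
  unfolding qderiv_def using assms by (intro holomorphic_intros)

lemma holo_imp_isCont:
  assumes "f holomorphic_on S" "open S" "x \<in> S" shows "isCont f x"
  using assms by (meson continuous_on_eq_continuous_at holomorphic_on_imp_continuous_on)

text \<open>What the contraction arguments below use of a function of two complex variables. The
  dependence on the parameter \<open>c\<close> is recorded only through substitution of holomorphic
  functions of \<open>c\<close>, which is stable under composition and under uniform limits and avoids a theory of
  holomorphic functions of two variables.\<close>

definition holo_family :: "(complex \<Rightarrow> complex \<Rightarrow> complex) \<Rightarrow> (complex \<Rightarrow> complex \<Rightarrow> complex) \<Rightarrow> bool" where
  "holo_family F F' \<longleftrightarrow>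
     (\<forall>c z. (F c has_field_derivative F' c z) (at z)) \<and>
     continuous_on UNIV (\<lambda>p. F (fst p) (snd p)) \<and>
     continuous_on UNIV (\<lambda>p. F' (fst p) (snd p)) \<and>
     (\<forall>A w. w holomorphic_on A \<longrightarrow> (\<lambda>c. F c (w c)) holomorphic_on A)"

lemma holo_family_quad_iter: "holo_family (\<lambda>c. quad c ^^ n) (\<lambda>c. qderiv c n)"
  unfolding holo_family_def
  by (auto intro!: quad_iter_has_field_derivative continuous_intros holomorphic_intros)

lemma holo_family_period: "holo_family (\<lambda>c z. (quad c ^^ n) z - z) (\<lambda>c z. qderiv c n z - 1)"
  unfolding holo_family_def
  by (auto intro!: derivative_intros quad_iter_has_field_derivative continuous_intros holomorphic_intros)

text \<open>The iterates of a constant start value are holomorphic in the parameter and converge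
  uniformly, so their limit, the fixed point, is holomorphic too.\<close>

lemma holomorphic_fixed_point:
  fixes \<Phi> :: "complex \<Rightarrow> complex \<Rightarrow> complex"
  assumes A: "open A" and r: "0 \<le> r"
    and self: "\<And>c x. c \<in> A \<Longrightarrow> x \<in> cball z r \<Longrightarrow> \<Phi> c x \<in> cball z r"
    and contr: "\<And>c x y. c \<in> A \<Longrightarrow> x \<in> cball z r \<Longrightarrow> y \<in> cball z r \<Longrightarrow> norm (\<Phi> c x - \<Phi> c y) \<le> norm (x - y) / 2"
    and hol: "\<And>w. w holomorphic_on A \<Longrightarrow> w ` A \<subseteq> cball z r \<Longrightarrow> (\<lambda>c. \<Phi> c (w c)) holomorphic_on A"
  obtains w where "w holomorphic_on A" "\<And>c. c \<in> A \<Longrightarrow> w c \<in> cball z r" "\<And>c. c \<in> A \<Longrightarrow> \<Phi> c (w c) = w c"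
proof -
  have "\<exists>x\<in>cball z r. \<Phi> c x = x" if "c \<in> A" for c
  proof -
    have "\<exists>!x\<in>cball z r. \<Phi> c x = x"
      by (rule Banach_fix[where c = "1/2"])
         (use self contr that r in \<open>auto simp: dist_norm intro: complete_eq_closed[THEN iffD2]\<close>)
    then show ?thesis by blast
  qed
  then obtain w where w: "\<And>c. c \<in> A \<Longrightarrow> w c \<in> cball z r" "\<And>c. c \<in> A \<Longrightarrow> \<Phi> c (w c) = w c"
    by metis
  define W where "W n c = (\<Phi> c ^^ n) z" for n c
  have W_in: "W n c \<in> cball z r" if "c \<in> A" for n c
    by (induction n) (use self that r in \<open>auto simp: W_def\<close>)
  have W_hol: "W n holomorphic_on A" for n
  proof (induction n)
    case 0
    show ?case by (simp add: W_def[abs_def])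
  next
    case (Suc n)
    have "(\<lambda>c. \<Phi> c (W n c)) holomorphic_on A"
      using Suc W_in by (intro hol) auto
    then show ?case by (simp add: W_def[abs_def])
  qed
  have W_lim: "norm (W n c - w c) \<le> (1/2)^n * r" if "c \<in> A" for n c
  proof (induction n)
    case 0
    show ?case using w(1)[OF that] by (simp add: W_def dist_norm)
  next
    case (Suc n)
    have "norm (W (Suc n) c - w c) = norm (\<Phi> c (W n c) - \<Phi> c (w c))"
      using w(2)[OF that] by (simp add: W_def)
    also have "\<dots> \<le> norm (W n c - w c) / 2"
      using contr[OF that W_in[OF that] w(1)[OF that]] .
    finally show ?case using Suc by simp
  qed
  have "uniform_limit A W w sequentially"
  proof (rule uniform_limitI)
    fix e :: real assume "e > 0"
    have "(\<lambda>n. (1/2)^n * r) \<longlonglongrightarrow> 0 * r"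
      by (intro tendsto_intros LIMSEQ_power_zero) auto
    then have "\<forall>\<^sub>F n in sequentially. (1/2)^n * r < e"
      using \<open>e > 0\<close> by (auto dest: order_tendstoD)
    then show "\<forall>\<^sub>F n in sequentially. \<forall>x\<in>A. dist (W n x) (w x) < e"
      by eventually_elim (auto simp: dist_norm intro: le_less_trans[OF W_lim])
  qed
  note ul = this
  have "w holomorphic_on A"
  proof (rule holomorphic_uniform_sequence[OF A W_hol])
    fix x assume "x \<in> A"
    then obtain d where "d > 0" "cball x d \<subseteq> A" using A open_contains_cball by blast
    then show "\<exists>d>0. cball x d \<subseteq> A \<and> uniform_limit (cball x d) W w sequentially"
      using uniform_limit_on_subset[OF ul] by blast
  qed
  with w that show thesis by blast
qed

definition preserves_holo :: "(complex \<Rightarrow> complex \<Rightarrow> complex) \<Rightarrow> complex set \<Rightarrow> complex set \<Rightarrow> bool" where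
  "preserves_holo h D E \<longleftrightarrow> (\<forall>A y. open A \<longrightarrow> A \<subseteq> D \<longrightarrow> y holomorphic_on A \<longrightarrow> y ` A \<subseteq> E \<longrightarrow>
     (\<lambda>c. h c (y c)) holomorphic_on A)"

lemma preserves_holoD:
  assumes "preserves_holo h D E" "open A" "A \<subseteq> D" "y holomorphic_on A" "y ` A \<subseteq> E"
  shows "(\<lambda>c. h c (y c)) holomorphic_on A"
  using assms unfolding preserves_holo_def by blast

text \<open>The inverse function theorem with parameter: with \<open>A\<close> the derivative at the base point,
  \<open>x \<mapsto> x - (F c x - y) / A\<close> is a contraction of a small disc whose fixed point solves \<open>F c x = y\<close>.
  The constant \<open>\<eta>\<close> keeps the expansion factor of \<open>F c\<close> as close to \<open>norm A\<close> as desired, so that the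
  inverse at a repelling point is a contraction.\<close>

lemma local_inverse:
  assumes F: "holo_family F F'" and nz: "F' c0 z0 \<noteq> 0" and \<eta>: "0 < \<eta>" "\<eta> < 1" and r0: "0 < r0"
  obtains r \<delta> s h where "0 < r" "r < r0" "0 < \<delta>" "0 < s"
    "\<And>c x. c \<in> ball c0 \<delta> \<Longrightarrow> x \<in> cball z0 r \<Longrightarrow> norm (F' c x - F' c0 z0) \<le> \<eta> * norm (F' c0 z0)"
    "\<And>c x x'. c \<in> ball c0 \<delta> \<Longrightarrow> x \<in> cball z0 r \<Longrightarrow> x' \<in> cball z0 r \<Longrightarrow>
        (1 - \<eta>) * norm (F' c0 z0) * norm (x - x') \<le> norm (F c x - F c x')"
    "\<And>c y. c \<in> ball c0 \<delta> \<Longrightarrow> y \<in> ball (F c0 z0) s \<Longrightarrow> h c y \<in> cball z0 r \<and> F c (h c y) = y"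
    "preserves_holo h (ball c0 \<delta>) (ball (F c0 z0) s)"
proof -
  define A where "A = F' c0 z0"
  have A: "A \<noteq> 0" using nz by (simp add: A_def)
  define \<theta> where "\<theta> = min \<eta> (1/2)"
  have \<theta>: "0 < \<theta>" "\<theta> \<le> \<eta>" "\<theta> \<le> 1/2" using \<eta> by (auto simp: \<theta>_def)
  have der: "(F c has_field_derivative F' c z) (at z)" for c z using F by (auto simp: holo_family_def)
  have cF: "isCont (\<lambda>p. F (fst p) (snd p)) p" and cF': "isCont (\<lambda>p. F' (fst p) (snd p)) p" for p
    using F by (simp_all add: holo_family_def continuous_on_eq_continuous_at del: split_paired_All)
  have "\<theta> * norm A > 0" using \<theta> A by simp
  with cF'[of "(c0,z0)"] obtain d where d: "d > 0"
    "\<And>p. dist p (c0,z0) < d \<Longrightarrow> dist (F' (fst p) (snd p)) A < \<theta> * norm A"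
    unfolding continuous_at_eps_delta A_def by fastforce
  define r where "r = min (d/2) (r0/2)"
  have r: "r > 0" "r < r0" "r \<le> d/2" using d r0 by (auto simp: r_def)
  have "r * norm A / 4 > 0" using r A by simp
  with cF[of "(c0,z0)"] obtain d' where d': "d' > 0"
    "\<And>p. dist p (c0,z0) < d' \<Longrightarrow> dist (F (fst p) (snd p)) (F c0 z0) < r * norm A / 4"
    unfolding continuous_at_eps_delta by fastforce
  define \<delta> where "\<delta> = min (d/2) d'"
  define s where "s = r * norm A / 4"
  have \<delta>: "\<delta> > 0" "\<delta> \<le> d/2" "\<delta> \<le> d'" using d d' by (auto simp: \<delta>_def)
  have s: "s > 0" using r A by (simp add: s_def)
  have close: "norm (F' c x - A) \<le> \<theta> * norm A" if "c \<in> ball c0 \<delta>" "x \<in> cball z0 r" for c x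
  proof -
    have "dist (c,x) (c0,z0) \<le> dist c c0 + dist x z0"
      by (metis dist_Pair_Pair real_sqrt_le_iff sqrt_sum_squares_le_sum zero_le_dist)
    also have "\<dots> < d" using that \<delta> r by (auto simp: dist_commute)
    finally show ?thesis using d(2)[of "(c,x)"] by (simp add: dist_norm)
  qed
  have lin: "norm ((F c x - A * x) - (F c x' - A * x')) \<le> \<theta> * norm A * norm (x - x')"
    if "c \<in> ball c0 \<delta>" "x \<in> cball z0 r" "x' \<in> cball z0 r" for c x x'
    by (rule field_differentiable_bound[OF convex_cball[of z0 r], where f' = "\<lambda>x. F' c x - A"])
       (use that close in \<open>auto intro!: derivative_eq_intros DERIV_subset[OF der]\<close>)
  have expand: "(1 - \<eta>) * norm A * norm (x - x') \<le> norm (F c x - F c x')"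
    if "c \<in> ball c0 \<delta>" "x \<in> cball z0 r" "x' \<in> cball z0 r" for c x x'
  proof -
    have "norm A * norm (x - x') = norm ((F c x - F c x') - ((F c x - A * x) - (F c x' - A * x')))"
      by (simp add: norm_mult[symmetric] algebra_simps)
    also have "\<dots> \<le> norm (F c x - F c x') + \<theta> * norm A * norm (x - x')"
      using norm_triangle_ineq4 lin[OF that] by (smt (verit))
    finally have "(1 - \<theta>) * norm A * norm (x - x') \<le> norm (F c x - F c x')" by (simp add: algebra_simps)
    moreover have "(1 - \<eta>) * norm A * norm (x - x') \<le> (1 - \<theta>) * norm A * norm (x - x')"
      using \<theta> by (intro mult_right_mono) auto
    ultimately show ?thesis by linarith
  qed
  have inj: "x = x'" if "c \<in> ball c0 \<delta>" "x \<in> cball z0 r" "x' \<in> cball z0 r" "F c x = F c x'" for c x x'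
  proof -
    have "(1 - \<eta>) * norm A * norm (x - x') \<le> 0" using expand[OF that(1-3)] that(4) by simp
    moreover have "(1 - \<eta>) * norm A > 0" using \<eta> A by simp
    ultimately have "\<not> norm (x - x') > 0" by (metis mult_pos_pos not_less)
    then show ?thesis by simp
  qed
  have solve: "\<exists>w. w holomorphic_on B \<and> (\<forall>c\<in>B. w c \<in> cball z0 r \<and> F c (w c) = y c)"
    if B: "open B" "B \<subseteq> ball c0 \<delta>" and y: "y holomorphic_on B" "y ` B \<subseteq> ball (F c0 z0) s" for B y
  proof -
    define \<Phi> where "\<Phi> c x = x - (F c x - y c) / A" for c x
    have contr: "norm (\<Phi> c x - \<Phi> c x') \<le> norm (x - x') / 2"
      if "c \<in> B" "x \<in> cball z0 r" "x' \<in> cball z0 r" for c x x'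
    proof -
      have "\<Phi> c x - \<Phi> c x' = - ((F c x - A * x) - (F c x' - A * x')) / A"
        using A by (simp add: \<Phi>_def field_simps)
      then have "norm (\<Phi> c x - \<Phi> c x') = norm ((F c x - A * x) - (F c x' - A * x')) / norm A"
        by (simp add: norm_divide norm_minus_commute)
      also have "\<dots> \<le> \<theta> * norm A * norm (x - x') / norm A"
        using lin[of c x x'] that B by (intro divide_right_mono) auto
      also have "\<dots> = \<theta> * norm (x - x')" using A by simp
      also have "\<dots> \<le> 1/2 * norm (x - x')" using \<theta> by (intro mult_right_mono) auto
      finally show ?thesis by simp
    qed
    have self: "\<Phi> c x \<in> cball z0 r" if "c \<in> B" "x \<in> cball z0 r" for c x
    proof -
      have cB: "c \<in> ball c0 \<delta>" using that B by auto
      have 1: "norm (\<Phi> c x - \<Phi> c z0) \<le> r / 2"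
        using contr[OF that, of z0] that r by (auto simp: dist_norm norm_minus_commute)
      have "dist (F c z0) (F c0 z0) < r * norm A / 4"
        using d'(2)[of "(c,z0)"] cB \<delta> by (simp add: dist_Pair_Pair dist_commute)
      moreover have "dist (y c) (F c0 z0) < r * norm A / 4"
        using y(2) that(1) by (auto simp: s_def dist_commute)
      ultimately have "norm (F c z0 - y c) \<le> r * norm A / 2"
        using dist_triangle2[of "F c z0" "y c" "F c0 z0"] by (simp add: dist_norm)
      then have "norm (F c z0 - y c) / norm A \<le> r / 2" using A by (simp add: field_simps)
      then have 2: "norm (\<Phi> c z0 - z0) \<le> r / 2" by (simp add: \<Phi>_def norm_divide norm_minus_commute)
      have "norm (\<Phi> c x - z0) \<le> r" using 1 2 norm_triangle_ineq[of "\<Phi> c x - \<Phi> c z0" "\<Phi> c z0 - z0"] by simp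
      then show ?thesis by (simp add: dist_norm norm_minus_commute)
    qed
    obtain w where "w holomorphic_on B" "\<And>c. c \<in> B \<Longrightarrow> w c \<in> cball z0 r" "\<And>c. c \<in> B \<Longrightarrow> \<Phi> c (w c) = w c"
    proof (rule holomorphic_fixed_point[of B r z0 \<Phi>])
      fix w assume "w holomorphic_on B"
      then show "(\<lambda>c. \<Phi> c (w c)) holomorphic_on B"
        unfolding \<Phi>_def using F y(1) A by (auto intro!: holomorphic_intros simp: holo_family_def)
    qed (use B r self contr in auto)
    moreover from this(3) have "F c (w c) = y c" if "c \<in> B" for c
      using that A by (auto simp: \<Phi>_def)
    ultimately show ?thesis by blast
  qed
  define h where "h c y = (SOME x. x \<in> cball z0 r \<and> F c x = y)" for c y
  have h: "h c y \<in> cball z0 r \<and> F c (h c y) = y" if "c \<in> ball c0 \<delta>" "y \<in> ball (F c0 z0) s" for c y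
  proof -
    have "(\<lambda>_. y) ` ball c0 \<delta> \<subseteq> ball (F c0 z0) s" using that(2) by auto
    then have "\<exists>w. w holomorphic_on ball c0 \<delta> \<and> (\<forall>c\<in>ball c0 \<delta>. w c \<in> cball z0 r \<and> F c (w c) = y)"
      by (intro solve[of "ball c0 \<delta>" "\<lambda>_. y"]) auto
    then obtain w where "\<forall>c\<in>ball c0 \<delta>. w c \<in> cball z0 r \<and> F c (w c) = y" by blast
    then have "\<exists>x. x \<in> cball z0 r \<and> F c x = y" using that by blast
    from someI_ex[OF this] show ?thesis by (simp add: h_def)
  qed
  have hhol: "(\<lambda>c. h c (y c)) holomorphic_on B"
    if B: "open B" "B \<subseteq> ball c0 \<delta>" and y: "y holomorphic_on B" "y ` B \<subseteq> ball (F c0 z0) s" for B y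
  proof -
    obtain w where w: "w holomorphic_on B" "\<forall>c\<in>B. w c \<in> cball z0 r \<and> F c (w c) = y c"
      using solve[OF B y] by blast
    have "w c = h c (y c)" if "c \<in> B" for c
    proof (rule inj)
      show c: "c \<in> ball c0 \<delta>" using that B by blast
      have "y c \<in> ball (F c0 z0) s" using y(2) that by blast
      from h[OF c this] show "h c (y c) \<in> cball z0 r" "F c (w c) = F c (h c (y c))" using w(2) that by auto
      show "w c \<in> cball z0 r" using w(2) that by blast
    qed
    then show ?thesis by (rule holomorphic_transform[OF w(1)])
  qed
  have hpres: "preserves_holo h (ball c0 \<delta>) (ball (F c0 z0) s)"
    unfolding preserves_holo_def by (intro allI impI hhol)
  show thesis
  proof (rule that[OF r(1,2) \<delta>(1) s _ _ h hpres])
    fix c x assume "c \<in> ball c0 \<delta>" "x \<in> cball z0 r"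
    moreover have "\<theta> * norm A \<le> \<eta> * norm A" using \<theta> by (intro mult_right_mono) auto
    ultimately show "norm (F' c x - F' c0 z0) \<le> \<eta> * norm (F' c0 z0)"
      using close[of c x] unfolding A_def by linarith
  qed (rule expand[unfolded A_def])
qed

section \<open>Continuation of periodic points in the parameter\<close>

lemma eventually_nhds_neq:
  fixes f :: "complex \<Rightarrow> complex"
  assumes "isCont f a" "f a \<noteq> b"
  shows "\<forall>\<^sub>F x in nhds a. f x \<noteq> b"
  using continuous_at_avoid[OF assms] by (auto simp: eventually_nhds_metric dist_commute)

lemma quad_iter_fixed_mult:
  assumes "(quad c ^^ m) z = z"
  shows "(quad c ^^ (m * q)) z = z" "qderiv c (m * q) z = qderiv c m z ^ q"
proof -
  have "(quad c ^^ (m * q)) z = z \<and> qderiv c (m * q) z = qderiv c m z ^ q"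
  proof (induction q)
    case (Suc q)
    then show ?case using assms by (simp add: quad_iter_add qderiv_add)
  qed (simp add: qderiv_def)
  then show "(quad c ^^ (m * q)) z = z" "qderiv c (m * q) z = qderiv c m z ^ q" by auto
qed

text \<open>The implicit function theorem for \<open>(quad c ^^ n) z = z\<close>; its derivative in \<open>z\<close> is the
  multiplier minus 1.\<close>

lemma fixed_branch:
  assumes fp: "(quad c0 ^^ n) z0 = z0" and nd: "qderiv c0 n z0 \<noteq> 1"
  obtains \<delta> r w where "0 < \<delta>" "0 < r" "w holomorphic_on ball c0 \<delta>" "w c0 = z0"
    "\<And>c. c \<in> ball c0 \<delta> \<Longrightarrow> w c \<in> ball z0 r"
    "\<And>c. c \<in> ball c0 \<delta> \<Longrightarrow> (quad c ^^ n) (w c) = w c"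
    "\<And>c z. c \<in> ball c0 \<delta> \<Longrightarrow> z \<in> ball z0 r \<Longrightarrow> (quad c ^^ n) z = z \<Longrightarrow> z = w c"
proof -
  have nd': "qderiv c0 n z0 - 1 \<noteq> 0" using nd by simp
  obtain r \<delta> s h where *: "0 < r" "r < 1" "0 < \<delta>" "0 < s"
    "\<And>c x x'. c \<in> ball c0 \<delta> \<Longrightarrow> x \<in> cball z0 r \<Longrightarrow> x' \<in> cball z0 r \<Longrightarrow>
        (1 - 1/2) * norm (qderiv c0 n z0 - 1) * norm (x - x') \<le> norm (((quad c ^^ n) x - x) - ((quad c ^^ n) x' - x'))"
    "\<And>c y. c \<in> ball c0 \<delta> \<Longrightarrow> y \<in> ball ((quad c0 ^^ n) z0 - z0) s \<Longrightarrow> h c y \<in> cball z0 r \<and> (quad c ^^ n) (h c y) - h c y = y"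
    "preserves_holo h (ball c0 \<delta>) (ball ((quad c0 ^^ n) z0 - z0) s)"
    by (rule local_inverse[of "\<lambda>c z. (quad c ^^ n) z - z" "\<lambda>c z. qderiv c n z - 1" c0 z0 "1/2" 1, OF holo_family_period nd'], simp, simp, simp, (rule that; blast))
  define w where "w c = h c 0" for c
  have w: "w c \<in> cball z0 r" "(quad c ^^ n) (w c) = w c" if "c \<in> ball c0 \<delta>" for c
    using *(6)[OF that, of 0] fp \<open>s > 0\<close> by (auto simp: w_def)
  have hol: "w holomorphic_on ball c0 \<delta>"
    using preserves_holoD[OF *(7), of "ball c0 \<delta>" "\<lambda>_. 0"] fp \<open>s > 0\<close> by (auto simp: w_def[abs_def] image_subset_iff)
  have uniq: "z = w c" if "c \<in> ball c0 \<delta>" "z \<in> cball z0 r" "(quad c ^^ n) z = z" for c z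
    using *(5)[OF that(1,2) w(1)[OF that(1)]] that(3) w(2)[OF that(1)] nd by (simp add: mult_le_0_iff)
  have w0: "w c0 = z0" using uniq[of c0 z0] fp \<open>r > 0\<close> \<open>\<delta> > 0\<close> by simp
  have "isCont w c0"
    using hol \<open>\<delta> > 0\<close> by (auto intro: holo_imp_isCont[OF _ open_ball])
  then obtain d where d: "d > 0" "\<And>c. dist c c0 < d \<Longrightarrow> dist (w c) z0 < r"
    using \<open>r > 0\<close> unfolding continuous_at_eps_delta w0 by blast
  show thesis
  proof (rule that[of "min \<delta> d" r w])
    show "w holomorphic_on ball c0 (min \<delta> d)" by (rule holomorphic_on_subset[OF hol]) auto
  qed (use *(1,3) d w0 w uniq in \<open>auto simp: dist_commute\<close>)
qed

text \<open>Nearby points on the branch keep the exact period \<open>n\<close>, since the inequations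
  \<open>(quad c ^^ k) z \<noteq> z\<close> are open conditions.\<close>

lemma periodic_branch:
  assumes per: "periodic_point c0 n z0" and nd: "qderiv c0 n z0 \<noteq> 1"
  obtains \<delta> r w where "0 < \<delta>" "0 < r" "w holomorphic_on ball c0 \<delta>" "w c0 = z0"
    "\<And>c. c \<in> ball c0 \<delta> \<Longrightarrow> w c \<in> ball z0 r"
    "\<And>c. c \<in> ball c0 \<delta> \<Longrightarrow> periodic_point c n (w c)"
    "\<And>c. c \<in> ball c0 \<delta> \<Longrightarrow> qderiv c n (w c) \<noteq> 1"
    "\<And>c z. c \<in> ball c0 \<delta> \<Longrightarrow> z \<in> ball z0 r \<Longrightarrow> (quad c ^^ n) z = z \<Longrightarrow> z = w c"
proof -
  have fp: "(quad c0 ^^ n) z0 = z0" and n: "n > 0" using per by (auto simp: periodic_point_def)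
  obtain \<delta> r w where *: "0 < \<delta>" "0 < r" "w holomorphic_on ball c0 \<delta>" "w c0 = z0"
    "\<And>c. c \<in> ball c0 \<delta> \<Longrightarrow> w c \<in> ball z0 r"
    "\<And>c. c \<in> ball c0 \<delta> \<Longrightarrow> (quad c ^^ n) (w c) = w c"
    "\<And>c z. c \<in> ball c0 \<delta> \<Longrightarrow> z \<in> ball z0 r \<Longrightarrow> (quad c ^^ n) z = z \<Longrightarrow> z = w c"
    by (rule fixed_branch[OF fp nd], (rule that; blast))
  have cont: "isCont f c0" if "f holomorphic_on ball c0 \<delta>" for f
    using that \<open>\<delta> > 0\<close> by (auto intro: holo_imp_isCont[OF _ open_ball])
  have "\<forall>\<^sub>F c in nhds c0. qderiv c n (w c) \<noteq> 1"
    by (rule eventually_nhds_neq[OF cont]) (use * nd in \<open>auto intro!: holomorphic_intros\<close>)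
  moreover have "\<forall>\<^sub>F c in nhds c0. \<forall>k\<in>{0<..<n}. (quad c ^^ k) (w c) - w c \<noteq> 0"
  proof (intro eventually_ball_finite ballI)
    fix k assume "k \<in> {0<..<n}"
    then show "\<forall>\<^sub>F c in nhds c0. (quad c ^^ k) (w c) - w c \<noteq> 0"
      by (intro eventually_nhds_neq[OF cont]) (use * per in \<open>auto intro!: holomorphic_intros simp: periodic_point_def\<close>)
  qed auto
  ultimately have "\<forall>\<^sub>F c in nhds c0. qderiv c n (w c) \<noteq> 1 \<and> (\<forall>k\<in>{0<..<n}. (quad c ^^ k) (w c) - w c \<noteq> 0)"
    by eventually_elim auto
  then obtain d where d: "d > 0"
    "\<And>c. dist c c0 < d \<Longrightarrow> qderiv c n (w c) \<noteq> 1 \<and> (\<forall>k\<in>{0<..<n}. (quad c ^^ k) (w c) - w c \<noteq> 0)"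
    unfolding eventually_nhds_metric by blast
  show thesis
  proof (rule that[of "min \<delta> d" r w])
    show "w holomorphic_on ball c0 (min \<delta> d)" by (rule holomorphic_on_subset[OF *(3)]) auto
    fix c assume "c \<in> ball c0 (min \<delta> d)"
    then show "periodic_point c n (w c)"
      using d(2)[of c] *(6)[of c] n by (auto simp: periodic_point_def dist_commute)
  qed (use * d in \<open>auto simp: dist_commute\<close>)
qed

text \<open>The exact period can drop in the limit only where the multiplier is 1. If the limit had
  a smaller period \<open>m\<close>, then \<open>m\<close> divides \<open>n\<close> and the multiplier of period \<open>m\<close> is not 1 either, so
  there is a branch of points of period \<open>m\<close> through the limit; by uniqueness of the branch for \<open>n\<close> it
  would contain the approximating points.\<close>

lemma periodic_limit:
  assumes per: "\<And>k. periodic_point (cc k) n (zz k)" and lim: "cc \<longlonglongrightarrow> c0" "zz \<longlonglongrightarrow> z0"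
    and nd: "qderiv c0 n z0 \<noteq> 1"
  shows "periodic_point c0 n z0"
proof -
  have n: "n > 0" using per by (auto simp: periodic_point_def)
  have "isCont (\<lambda>p. (quad (fst p) ^^ n) (snd p)) (c0, z0)"
    using continuous_on_quad_iter[of UNIV fst snd n] by (simp add: continuous_on_eq_continuous_at continuous_on_fst continuous_on_snd)
  from isCont_tendsto_compose[OF this tendsto_Pair[OF lim]]
  have "(\<lambda>k. (quad (cc k) ^^ n) (zz k)) \<longlonglongrightarrow> (quad c0 ^^ n) z0" by simp
  moreover have "(quad (cc k) ^^ n) (zz k) = zz k" for k using per by (auto simp: periodic_point_def)
  ultimately have fp: "(quad c0 ^^ n) z0 = z0" using lim(2) LIMSEQ_unique by auto
  define m where "m = (LEAST m. m > 0 \<and> (quad c0 ^^ m) z0 = z0)"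
  have m: "m > 0" "(quad c0 ^^ m) z0 = z0" 
    using LeastI[of "\<lambda>m. m > 0 \<and> (quad c0 ^^ m) z0 = z0" n] fp n unfolding m_def by auto
  have least: "m \<le> k" if "k > 0" "(quad c0 ^^ k) z0 = z0" for k
    unfolding m_def using that by (intro Least_le) auto
  have "(quad c0 ^^ (n mod m)) z0 = (quad c0 ^^ (m * (n div m) + n mod m)) z0"
    unfolding quad_iter_add quad_iter_fixed_mult(1)[OF m(2)] ..
  then have "(quad c0 ^^ (n mod m)) z0 = z0" using fp by simp
  then have "n mod m = 0" using least[of "n mod m"] m(1) by (meson gr0I mod_less_divisor not_less)
  then obtain q where q: "n = m * q" by (auto simp: mod_eq_0_iff_dvd)
  have ndm: "qderiv c0 m z0 \<noteq> 1" using nd quad_iter_fixed_mult(2)[OF m(2), of q] q by auto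
  obtain \<delta> r w where w: "0 < \<delta>" "0 < r" "w holomorphic_on ball c0 \<delta>" "w c0 = z0"
    "\<And>c. c \<in> ball c0 \<delta> \<Longrightarrow> w c \<in> ball z0 r"
    "\<And>c. c \<in> ball c0 \<delta> \<Longrightarrow> (quad c ^^ n) (w c) = w c"
    "\<And>c z. c \<in> ball c0 \<delta> \<Longrightarrow> z \<in> ball z0 r \<Longrightarrow> (quad c ^^ n) z = z \<Longrightarrow> z = w c"
    by (rule fixed_branch[OF fp nd], (rule that; blast))
obtain \<delta>' r' v where v: "0 < \<delta>'" "0 < r'" "v holomorphic_on ball c0 \<delta>'" "v c0 = z0"
    "\<And>c. c \<in> ball c0 \<delta>' \<Longrightarrow> v c \<in> ball z0 r'"
    "\<And>c. c \<in> ball c0 \<delta>' \<Longrightarrow> (quad c ^^ m) (v c) = v c"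
    "\<And>c z. c \<in> ball c0 \<delta>' \<Longrightarrow> z \<in> ball z0 r' \<Longrightarrow> (quad c ^^ m) z = z \<Longrightarrow> z = v c"
    by (rule fixed_branch[OF m(2) ndm], (rule that; blast))
  have cv: "isCont v c0"
    using v by (auto intro: holo_imp_isCont[OF _ open_ball])
  have "(\<lambda>k. v (cc k)) \<longlonglongrightarrow> z0" using isCont_tendsto_compose[OF cv lim(1)] v by simp
  then have "\<forall>\<^sub>F k in sequentially. dist (v (cc k)) z0 < r" using w(2) by (rule tendstoD)
  moreover have "\<forall>\<^sub>F k in sequentially. dist (zz k) z0 < r" using lim(2) w(2) by (rule tendstoD)
  moreover have "\<forall>\<^sub>F k in sequentially. dist (cc k) c0 < min \<delta> \<delta>'" using lim(1) w(1) v(1) by (intro tendstoD) auto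
  ultimately have "\<forall>\<^sub>F k in sequentially. (quad (cc k) ^^ m) (zz k) = zz k"
  proof eventually_elim
    case (elim k)
    then have cc: "cc k \<in> ball c0 \<delta>" "cc k \<in> ball c0 \<delta>'" by (auto simp: dist_commute)
    have "(quad (cc k) ^^ n) (v (cc k)) = v (cc k)"
      unfolding q by (rule quad_iter_fixed_mult(1)[OF v(6)[OF cc(2)]])
    then have "v (cc k) = w (cc k)" using w(7)[OF cc(1)] elim by (auto simp: dist_commute)
    moreover have "zz k = w (cc k)" using w(7)[OF cc(1)] elim per[of k] by (auto simp: dist_commute periodic_point_def)
    ultimately show ?case using v(6)[OF cc(2)] by simp
  qed
  then obtain k where "(quad (cc k) ^^ m) (zz k) = zz k" using eventually_happens' sequentially_bot by blast
  then have "\<not> m < n" using per[of k] m(1) by (auto simp: periodic_point_def)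
  then have "m = n" using least[OF n fp] by simp
  then show ?thesis unfolding periodic_point_def using n fp least by (metis not_less)
qed

lemma mem_X_I:
  assumes "0 < \<delta>" "w holomorphic_on ball c0 \<delta>" "\<And>c. c \<in> ball c0 \<delta> \<Longrightarrow> periodic_point c n (w c)"
    "deriv (\<lambda>c. qderiv c n (w c)) c0 = 0"
  shows "c0 \<in> X n"
proof -
  have "(\<lambda>c. qderiv c n (w c)) holomorphic_on ball c0 \<delta>" using assms by (auto intro!: holomorphic_intros)
  then have "((\<lambda>c. qderiv c n (w c)) has_field_derivative 0) (at c0)"
    using assms(1,4) by (metis centre_in_ball holomorphic_derivI open_ball)
  then show ?thesis using assms unfolding X_def multiplier_critical_point_def multiplier_eq_qderiv
    by (auto intro!: exI[of _ "ball c0 \<delta>"] exI[of _ w])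
qed

lemma periodic_orbit_fixed:
  assumes "(quad c ^^ n) z = z" shows "(quad c ^^ n) ((quad c ^^ i) z) = (quad c ^^ i) z"
  by (metis assms add.commute quad_iter_add)

text \<open>If \<open>M\<close> is the largest modulus on the orbit, then \<open>M\<^sup>2 \<le> M + norm c\<close>. The form
  \<open>norm c \<le> B (B - 1)\<close> of the hypothesis serves both the crude bound \<open>1 + norm c\<close> and the bound of order
  \<open>sqrt (norm c)\<close>.\<close>

lemma periodic_norm_le:
  assumes fp: "(quad c ^^ n) z = z" and n: "n > 0" and B: "1 \<le> B" "norm c \<le> B * (B - 1)"
  shows "norm z \<le> B"
proof -
  define M where "M = Max ((\<lambda>i. norm ((quad c ^^ i) z)) ` {..<n})"
  have le: "norm ((quad c ^^ i) z) \<le> M" if "i < n" for i unfolding M_def using that by (intro Max_ge) auto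
  have le': "norm ((quad c ^^ Suc i) z) \<le> M" if "i < n" for i
  proof (cases "Suc i = n")
    case True
    then show ?thesis using fp le[of 0] n by (metis funpow_0)
  next
    case False
    then show ?thesis using le[of "Suc i"] that by (simp del: funpow.simps)
  qed
  have "M \<in> (\<lambda>i. norm ((quad c ^^ i) z)) ` {..<n}" unfolding M_def using n by (intro Max_in) auto
  then obtain i where i: "i < n" "M = norm ((quad c ^^ i) z)" by auto
  have "((quad c ^^ i) z)\<^sup>2 = (quad c ^^ Suc i) z - c" by (simp add: quad_def)
  then have "M\<^sup>2 \<le> norm ((quad c ^^ Suc i) z) + norm c" unfolding i(2) by (metis norm_power norm_triangle_ineq4)
  then have M: "M * (M - 1) \<le> B * (B - 1)" using le'[OF i(1)] B by (simp add: power2_eq_square algebra_simps)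
  have "M \<le> B"
  proof (rule ccontr)
    assume "\<not> M \<le> B"
    then have "B * (B - 1) < M * (M - 1)" using B by (intro mult_strict_mono') auto
    then show False using M by simp
  qed
  then show ?thesis using le[of 0] n by simp
qed

lemma periodic_norm_bounds:
  assumes fp: "(quad c ^^ n) z = z" and n: "n > 0" and c: "norm c \<ge> 16"
  shows "sqrt (norm c) / 2 \<le> norm z" "norm z \<le> 2 * sqrt (norm c)"
proof -
  define u where "u = sqrt (norm c)"
  have u: "u \<ge> 4" using c real_le_rsqrt[of 4 "norm c"] by (simp add: u_def)
  have cu: "norm c = u * u" by (simp add: u_def)
  have up: "norm ((quad c ^^ i) z) \<le> 2 * u" for i
  proof (rule periodic_norm_le[OF periodic_orbit_fixed[OF fp] n])
    have "u * 1 \<le> u * u" using u by (intro mult_left_mono) auto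
    then show "norm c \<le> 2 * u * (2 * u - 1)" using u by (simp add: cu algebra_simps)
  qed (use u in auto)
  have "z\<^sup>2 = (quad c ^^ 1) z - c" by (simp add: quad_def)
  then have "(norm z)\<^sup>2 \<ge> norm c - norm ((quad c ^^ 1) z)" by (metis norm_minus_commute norm_power norm_triangle_ineq2)
  moreover have "2 * u \<le> u * u * (3/4)" using mult_right_mono[of 4 u u] u by simp
  ultimately have "(u/2)\<^sup>2 \<le> (norm z)\<^sup>2" using up[of 1] by (simp add: cu power2_eq_square)
  then have "u/2 \<le> norm z" by (rule power2_le_imp_le) simp
  then show "sqrt (norm c) / 2 \<le> norm z" "norm z \<le> 2 * sqrt (norm c)" using up[of 0] by (auto simp: u_def)
qed

text \<open>For large parameters every multiplier of period \<open>n\<close> has the order of \<open>norm c\<close> to the power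
  \<open>n/2\<close>.\<close>

lemma periodic_qderiv_bounds:
  assumes fp: "(quad c ^^ n) z = z" and n: "n > 0" and c: "norm c \<ge> 16"
  shows "sqrt (norm c) ^ n \<le> norm (qderiv c n z)" "norm (qderiv c n z) \<le> (4 * sqrt (norm c)) ^ n"
proof -
  note b = periodic_norm_bounds[OF periodic_orbit_fixed[OF fp] n c]
  have "norm (qderiv c n z) = (\<Prod>i<n. 2 * norm ((quad c ^^ i) z))"
    by (simp add: qderiv_def norm_mult prod_norm[symmetric])
  moreover have "(\<Prod>i<n. sqrt (norm c)) \<le> (\<Prod>i<n. 2 * norm ((quad c ^^ i) z))"
    using b(1) by (intro prod_mono) (auto simp: field_simps)
  moreover have "(\<Prod>i<n. 2 * norm ((quad c ^^ i) z)) \<le> (\<Prod>i<n. 4 * sqrt (norm c))"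
    using b(2) by (intro prod_mono) (auto simp: field_simps)
  ultimately show "sqrt (norm c) ^ n \<le> norm (qderiv c n z)" "norm (qderiv c n z) \<le> (4 * sqrt (norm c)) ^ n"
    by auto
qed

text \<open>The parameters near which some branch has constant multiplier \<open>\<rho>\<close> form an open set, and a
  closed one: a limit of such points again has multiplier \<open>\<rho> \<noteq> 1\<close>, lies on a unique branch, and the
  identity theorem applies on it. Being nonempty, the set would be the whole plane, while
  multipliers tend to infinity with the parameter.\<close>

lemma multiplier_not_locally_constant:
  assumes n: "n > 0" and \<rho>: "\<rho> \<noteq> 1" and d0: "d0 > 0" and w0: "w0 holomorphic_on ball c0 d0"
    and const: "\<And>c. c \<in> ball c0 d0 \<Longrightarrow> (quad c ^^ n) (w0 c) = w0 c \<and> qderiv c n (w0 c) = \<rho>"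
  shows False
proof -
  define good where "good c d w \<longleftrightarrow> d > 0 \<and> w holomorphic_on ball c d \<and>
      (\<forall>c'\<in>ball c d. (quad c' ^^ n) (w c') = w c' \<and> qderiv c' n (w c') = \<rho>)" for c d and w :: "complex \<Rightarrow> complex"
  define B where "B = {c. \<exists>d w. good c d w}"
  have "open B"
    unfolding open_contains_ball
  proof (intro ballI)
    fix c assume "c \<in> B"
    then obtain d w where g: "good c d w" by (auto simp: B_def)
    have "c' \<in> B" if c': "c' \<in> ball c d" for c'
    proof -
      have sub: "ball c' (d - dist c c') \<subseteq> ball c d"
      proof
        fix x assume "x \<in> ball c' (d - dist c c')"
        then show "x \<in> ball c d" using dist_triangle[of c x c'] by simp
      qed
      have "good c' (d - dist c c') w"
        using g sub c' unfolding good_def by (meson diff_gt_0_iff_gt holomorphic_on_subset mem_ball subsetD)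
      then show ?thesis unfolding B_def by blast
    qed
    then show "\<exists>e>0. ball c e \<subseteq> B" using g unfolding good_def by blast
  qed
  moreover have "closed B"
    unfolding closed_sequential_limits
  proof (intro allI impI, elim conjE)
    fix cc c1 assume cB: "\<forall>k. cc k \<in> B" and lim: "cc \<longlonglongrightarrow> c1"
    have "\<forall>k. \<exists>d w. good (cc k) d w" using cB by (simp add: B_def)
    then obtain dd ww where g: "\<And>k. good (cc k) (dd k) (ww k)" by metis
    define zz where "zz k = ww k (cc k)" for k
    have zz: "(quad (cc k) ^^ n) (zz k) = zz k" "qderiv (cc k) n (zz k) = \<rho>" for k
      using g[of k] by (auto simp: good_def zz_def)
    obtain K where K: "K > 0" "\<And>k. norm (cc k) \<le> K"
      using convergent_imp_bounded[OF lim] by (auto simp: bounded_pos)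
    have "norm (zz k) \<le> 1 + K" for k
    proof (rule periodic_norm_le[OF zz(1) n])
      have "K \<le> (1 + K) * K" using K(1) by (simp add: algebra_simps)
      then show "norm (cc k) \<le> (1 + K) * (1 + K - 1)" using K(2)[of k] by simp
    qed (use K in auto)
    then have "bounded (range zz)" by (auto simp: bounded_iff)
    then obtain z1 f where f: "strict_mono (f :: nat \<Rightarrow> nat)" "(zz \<circ> f) \<longlonglongrightarrow> z1"
      using bounded_imp_convergent_subsequence by blast
    have limf: "(cc \<circ> f) \<longlonglongrightarrow> c1" using lim f(1) by (rule LIMSEQ_subseq_LIMSEQ)
    note limp = tendsto_Pair[OF limf f(2)]
    have "isCont (\<lambda>p. (quad (fst p) ^^ n) (snd p)) (c1, z1)" "isCont (\<lambda>p. qderiv (fst p) n (snd p)) (c1, z1)"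
      using continuous_on_quad_iter[of UNIV fst snd n] continuous_on_qderiv[of UNIV fst snd n]
      by (simp_all add: continuous_on_eq_continuous_at continuous_on_fst continuous_on_snd)
    note this[THEN isCont_tendsto_compose, OF limp]
    then have l: "(\<lambda>k. (zz \<circ> f) k) \<longlonglongrightarrow> (quad c1 ^^ n) z1" "(\<lambda>k. \<rho>) \<longlonglongrightarrow> qderiv c1 n z1"
      using zz by (simp_all add: o_def)
    have fp: "(quad c1 ^^ n) z1 = z1" using l(1) f(2) LIMSEQ_unique by blast
    have "qderiv c1 n z1 = \<rho>" using l(2) LIMSEQ_unique tendsto_const by blast
    then have nd: "qderiv c1 n z1 \<noteq> 1" using \<rho> by simp
    obtain \<delta> r w where w: "0 < \<delta>" "0 < r" "w holomorphic_on ball c1 \<delta>" "w c1 = z1"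
    "\<And>c. c \<in> ball c1 \<delta> \<Longrightarrow> w c \<in> ball z1 r"
    "\<And>c. c \<in> ball c1 \<delta> \<Longrightarrow> (quad c ^^ n) (w c) = w c"
    "\<And>c z. c \<in> ball c1 \<delta> \<Longrightarrow> z \<in> ball z1 r \<Longrightarrow> (quad c ^^ n) z = z \<Longrightarrow> z = w c"
    by (rule fixed_branch[OF fp nd], (rule that; blast))
    have "\<forall>\<^sub>F k in sequentially. dist ((zz \<circ> f) k) z1 < r" using f(2) w(2) by (rule tendstoD)
    moreover have "\<forall>\<^sub>F k in sequentially. dist ((cc \<circ> f) k) c1 < \<delta>" using limf w(1) by (rule tendstoD)
    ultimately have "\<forall>\<^sub>F k in sequentially. dist (zz (f k)) z1 < r \<and> dist (cc (f k)) c1 < \<delta>"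
      by eventually_elim simp
    then obtain k where k: "dist (zz (f k)) z1 < r" "dist (cc (f k)) c1 < \<delta>"
      using eventually_happens'[OF sequentially_bot] by blast
    define c2 d2 w2 where "c2 = cc (f k)" and "d2 = dd (f k)" and "w2 = ww (f k)"
    have g2: "d2 > 0" "w2 holomorphic_on ball c2 d2"
      "\<And>c. c \<in> ball c2 d2 \<Longrightarrow> (quad c ^^ n) (w2 c) = w2 c" "\<And>c. c \<in> ball c2 d2 \<Longrightarrow> qderiv c n (w2 c) = \<rho>"
      using g[of "f k"] by (auto simp: good_def c2_def d2_def w2_def)
    have "isCont w2 c2"
      using g2(1,2) by (auto intro: holo_imp_isCont[OF _ open_ball])
    then have "(w2 \<longlongrightarrow> w2 c2) (nhds c2)" by (simp add: isCont_def tendsto_at_iff_tendsto_nhds)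
    from tendsto_dist[OF this tendsto_const[of z1]] k(1)
    have "\<forall>\<^sub>F c in nhds c2. dist (w2 c) z1 < r"
      unfolding zz_def c2_def[symmetric] w2_def[symmetric] by (rule order_tendstoD(2))
    then obtain e where e: "e > 0" "\<And>c. dist c c2 < e \<Longrightarrow> dist (w2 c) z1 < r"
      unfolding eventually_nhds_metric by blast
    define S where "S = ball c2 (min e d2) \<inter> ball c1 \<delta>"
    have S: "open S" "c2 \<in> S" "S \<subseteq> ball c1 \<delta>" using e g2(1) k(2) by (auto simp: S_def c2_def dist_commute)
    have eq: "qderiv c n (w c) = \<rho>" if "c \<in> S" for c
    proof -
      have c: "c \<in> ball c2 d2" "dist c c2 < e" "c \<in> ball c1 \<delta>" using that by (auto simp: S_def dist_commute)
      have "w2 c = w c" using w(7)[OF c(3) _ g2(3)[OF c(1)]] e(2)[OF c(2)] by (simp add: dist_commute)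
      then show ?thesis using g2(4)[OF c(1)] by simp
    qed
    have eq': "qderiv c n (w c) = \<rho>" if "c \<in> ball c1 \<delta>" for c
      by (rule analytic_continuation_open[OF S(1) open_ball _ connected_ball S(3) _ _ eq that])
         (use S(2) w(3) in \<open>auto intro!: holomorphic_intros\<close>)
    have "good c1 \<delta> w" unfolding good_def using w(1,3,6) eq' by simp
    then show "c1 \<in> B" unfolding B_def by blast
  qed
  moreover have "c0 \<in> B" unfolding B_def good_def using d0 w0 const by blast
  ultimately have "B = UNIV" using clopen[of B] by auto
  define c where "c = complex_of_real ((norm \<rho> + 5)^2)"
  obtain d w where "good c d w" using \<open>B = UNIV\<close> unfolding B_def by blast
  then have fp: "(quad c ^^ n) (w c) = w c" and q: "qderiv c n (w c) = \<rho>" by (simp_all add: good_def)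
  have nc: "norm c = (norm \<rho> + 5)\<^sup>2" unfolding c_def norm_of_real by simp
  have sq: "sqrt (norm c) = norm \<rho> + 5" unfolding nc by simp
  have "16 \<le> (norm \<rho> + 5)^2" using power_mono[of 4 "norm \<rho> + 5" 2] by simp
  then have c16: "norm c \<ge> 16" unfolding nc .
  have "norm \<rho> + 5 \<le> (norm \<rho> + 5) ^ n" using n by (intro self_le_power) auto
  then show False using periodic_qderiv_bounds(1)[OF fp n c16] q sq by simp
qed

section \<open>Long periodic orbits near a homoclinic orbit\<close>

text \<open>The Lipschitz constant is uniform in the parameter: Cauchy's inequality bounds the
  derivative by the maximum on a compact set of pairs.\<close>

lemma qderiv_locally_Lipschitz:
  obtains B where "B > 0"
    "\<And>c x x'. c \<in> cball c0 d \<Longrightarrow> x \<in> cball z0 r \<Longrightarrow> x' \<in> cball z0 r \<Longrightarrow>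
      norm (qderiv c n x - qderiv c n x') \<le> B * norm (x - x')"
proof -
  have "compact ((\<lambda>p. qderiv (fst p) n (snd p)) ` (cball c0 d \<times> cball z0 (r + 1)))"
    by (intro compact_continuous_image compact_Times compact_cball continuous_intros continuous_on_fst continuous_on_snd continuous_on_id)
  from compact_imp_bounded[OF this, unfolded bounded_pos]
  obtain B where B: "B > 0" "\<And>p. p \<in> cball c0 d \<times> cball z0 (r + 1) \<Longrightarrow> norm (qderiv (fst p) n (snd p)) \<le> B"
    by blast
  have hol: "(\<lambda>x. qderiv c n x) holomorphic_on S" for c S by (intro holomorphic_intros)
  have der: "norm (deriv (\<lambda>x. qderiv c n x) x) \<le> B" if "c \<in> cball c0 d" "x \<in> cball z0 r" for c x
  proof -
    have "norm ((deriv ^^ 1) (\<lambda>x. qderiv c n x) x) \<le> fact 1 * B / 1 ^ 1"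
    proof (rule Cauchy_inequality)
      show "(\<lambda>x. qderiv c n x) holomorphic_on ball x 1" by (rule hol)
      show "continuous_on (cball x 1) (\<lambda>x. qderiv c n x)" by (rule holomorphic_on_imp_continuous_on[OF hol])
      fix y assume "norm (x - y) = 1"
      then have "y \<in> cball z0 (r + 1)" using that(2) dist_triangle[of z0 y x] by (simp add: dist_norm)
      then show "norm (qderiv c n y) \<le> B" using B(2)[of "(c, y)"] that(1) by simp
    qed simp
    then show ?thesis by simp
  qed
  show thesis
  proof (rule that[OF B(1)])
    fix c x x' assume c: "c \<in> cball c0 d" "x \<in> cball z0 r" "x' \<in> cball z0 r"
    show "norm (qderiv c n x - qderiv c n x') \<le> B * norm (x - x')"
    proof (rule field_differentiable_bound[OF convex_cball, where f' = "deriv (\<lambda>x. qderiv c n x)"])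
      fix y assume "y \<in> cball z0 r"
      then show "norm (deriv (\<lambda>x. qderiv c n x) y) \<le> B" using der c(1) by blast
      have "((\<lambda>x. qderiv c n x) has_field_derivative deriv (\<lambda>x. qderiv c n x) y) (at y)"
        by (rule holomorphic_derivI[OF hol open_UNIV]) simp
      then show "((\<lambda>x. qderiv c n x) has_field_derivative deriv (\<lambda>x. qderiv c n x) y) (at y within cball z0 r)"
        by (rule DERIV_subset) simp
    qed (use c in auto)
  qed
qed

text \<open>The inverse \<open>h\<close> of the \<open>n\<close>-th iterate at the repelling point is a contraction fixing \<open>w c\<close>,
  with constants that do not depend on \<open>c\<close>. The last estimate says that derivatives along an inverse
  orbit approach the multiplier geometrically; the bound \<open>2/3\<close> keeps the quotients away
  from zero.\<close>

lemma repelling_local_inverse: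
  assumes d0: "\<delta>0 > 0" and w: "w holomorphic_on ball c0 \<delta>0"
    and fp: "\<And>c. c \<in> ball c0 \<delta>0 \<Longrightarrow> (quad c ^^ n) (w c) = w c"
    and rep: "norm (qderiv c0 n (w c0)) > 1"
  obtains r \<delta> \<mu> L h where "0 < r" "0 < \<delta>" "\<delta> \<le> \<delta>0" "0 < \<mu>" "\<mu> < 1" "0 < L"
    "\<And>c. c \<in> ball c0 \<delta> \<Longrightarrow> w c \<in> ball (w c0) (r/4)"
    "\<And>c. c \<in> ball c0 \<delta> \<Longrightarrow> qderiv c n (w c) \<noteq> 0"
    "\<And>c y. c \<in> ball c0 \<delta> \<Longrightarrow> y \<in> ball (w c0) r \<Longrightarrow> (quad c ^^ n) (h c y) = y"
    "\<And>c y y'. c \<in> ball c0 \<delta> \<Longrightarrow> y \<in> ball (w c0) r \<Longrightarrow> y' \<in> ball (w c0) r \<Longrightarrow> norm (h c y - h c y') \<le> \<mu> * norm (y - y')"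
    "\<And>c. c \<in> ball c0 \<delta> \<Longrightarrow> h c (w c) = w c"
    "preserves_holo h (ball c0 \<delta>) (ball (w c0) r)"
    "\<And>c y. c \<in> ball c0 \<delta> \<Longrightarrow> y \<in> ball (w c0) r \<Longrightarrow>
        norm (qderiv c n (h c y) / qderiv c n (w c) - 1) \<le> min (2/3) (L * norm (h c y - w c))"
proof -
  define A where "A = norm (qderiv c0 n (w c0))"
  have A: "A > 1" using rep by (simp add: A_def)
  define \<eta> where "\<eta> = min (1/4) ((1 - 1/A) / 2)"
  have \<eta>: "0 < \<eta>" "\<eta> \<le> 1/4" "\<eta> < 1" "(1 - \<eta>) * A > 1"
  proof -
    show "0 < \<eta>" "\<eta> \<le> 1/4" "\<eta> < 1" using A by (auto simp: \<eta>_def)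
    have "\<eta> < 1 - 1/A"
      using A by (auto simp: \<eta>_def min_def field_simps)
    then have "1/A < 1 - \<eta>" by linarith
    then show "(1 - \<eta>) * A > 1" using A by (simp add: field_simps)
  qed
  have nz: "qderiv c0 n (w c0) \<noteq> 0" using rep by auto
  obtain r1 \<delta>1 s h where *: "0 < r1" "r1 < 1" "0 < \<delta>1" "0 < s"
    "\<And>c x. c \<in> ball c0 \<delta>1 \<Longrightarrow> x \<in> cball (w c0) r1 \<Longrightarrow> norm (qderiv c n x - qderiv c0 n (w c0)) \<le> \<eta> * norm (qderiv c0 n (w c0))"
    "\<And>c x x'. c \<in> ball c0 \<delta>1 \<Longrightarrow> x \<in> cball (w c0) r1 \<Longrightarrow> x' \<in> cball (w c0) r1 \<Longrightarrow>
        (1 - \<eta>) * norm (qderiv c0 n (w c0)) * norm (x - x') \<le> norm ((quad c ^^ n) x - (quad c ^^ n) x')"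
    "\<And>c y. c \<in> ball c0 \<delta>1 \<Longrightarrow> y \<in> ball ((quad c0 ^^ n) (w c0)) s \<Longrightarrow> h c y \<in> cball (w c0) r1 \<and> (quad c ^^ n) (h c y) = y"
    "preserves_holo h (ball c0 \<delta>1) (ball ((quad c0 ^^ n) (w c0)) s)"
    by (rule local_inverse[of "\<lambda>c. quad c ^^ n" "\<lambda>c. qderiv c n" c0 "w c0" \<eta> 1, OF holo_family_quad_iter nz \<eta>(1,3) zero_less_one], (rule that; blast))
  note *(7,8)[unfolded fp[of c0, OF centre_in_ball[THEN iffD2, OF d0]]]
  note h = this(1) and hh = this(2)
  have "isCont w c0" by (rule holo_imp_isCont[OF w open_ball]) (use d0 in simp)
  then obtain d where d: "d > 0" "\<And>c. dist c c0 < d \<Longrightarrow> dist (w c) (w c0) < min (s/4) r1"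
    using *(1,4) unfolding continuous_at_eps_delta by (metis divide_pos_pos min_less_iff_conj zero_less_numeral)
  define \<delta> where "\<delta> = min (min \<delta>0 \<delta>1) d"
  have \<delta>: "0 < \<delta>" "\<delta> \<le> \<delta>0" "\<delta> \<le> \<delta>1" "\<delta> \<le> d" using d0 *(3) d(1) by (auto simp: \<delta>_def)
  have in1: "c \<in> ball c0 \<delta>1" "c \<in> ball c0 \<delta>0" "dist c c0 < d" if "c \<in> ball c0 \<delta>" for c
    using that \<delta> by (auto simp: dist_commute)
  have wr: "w c \<in> cball (w c0) r1" "w c \<in> ball (w c0) (s/4)" if "c \<in> ball c0 \<delta>" for c
    using d(2)[OF in1(3)[OF that]] by (auto simp: dist_commute)
  define \<mu> where "\<mu> = 1 / ((1 - \<eta>) * A)"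
  have \<mu>: "0 < \<mu>" "\<mu> < 1" using \<eta>(4) by (auto simp: \<mu>_def)
  obtain B where B: "B > 0" "\<And>c x x'. c \<in> cball c0 \<delta>1 \<Longrightarrow> x \<in> cball (w c0) r1 \<Longrightarrow> x' \<in> cball (w c0) r1 \<Longrightarrow>
      norm (qderiv c n x - qderiv c n x') \<le> B * norm (x - x')"
    by (rule qderiv_locally_Lipschitz[of c0 \<delta>1 "w c0" r1 n], (rule that; blast))
  have qlow: "(1 - \<eta>) * A \<le> norm (qderiv c n (w c))" if "c \<in> ball c0 \<delta>" for c
    using *(5)[OF in1(1)[OF that] wr(1)[OF that]] norm_triangle_ineq2[of "qderiv c0 n (w c0)" "qderiv c n (w c)"]
    by (simp add: A_def norm_minus_commute algebra_simps)
  have lip: "norm (h c y - h c y') \<le> \<mu> * norm (y - y')"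
    if c: "c \<in> ball c0 \<delta>" and y: "y \<in> ball (w c0) s" "y' \<in> ball (w c0) s" for c y y'
  proof -
    have "(1 - \<eta>) * A * norm (h c y - h c y') \<le> norm (y - y')"
      using *(6)[OF in1(1)[OF c], of "h c y" "h c y'"] h[OF in1(1)[OF c] y(1)] h[OF in1(1)[OF c] y(2)] by (simp add: A_def)
    then show ?thesis unfolding \<mu>_def using \<eta>(4) by (subst mult.commute, simp add: pos_le_divide_eq mult.commute)
  qed
  have hw: "h c (w c) = w c" if c: "c \<in> ball c0 \<delta>" for c
  proof -
    have ws: "w c \<in> ball (w c0) s" using wr(2)[OF c] *(4) by auto
    have "(1 - \<eta>) * A * norm (h c (w c) - w c) \<le> norm ((quad c ^^ n) (h c (w c)) - (quad c ^^ n) (w c))"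
      unfolding A_def by (rule *(6)[OF in1(1)[OF c] _ wr(1)[OF c]]) (use h[OF in1(1)[OF c] ws] in blast)
    also have "\<dots> = 0" using h[OF in1(1)[OF c] ws] fp[OF in1(2)[OF c]] by simp
    finally have "\<not> norm (h c (w c) - w c) > 0" using \<eta>(4) by (metis mult_pos_pos not_less order_less_trans zero_less_one)
    then show ?thesis by simp
  qed
  have ratio: "norm (qderiv c n (h c y) / qderiv c n (w c) - 1) \<le> min (2/3) (B / ((1 - \<eta>) * A) * norm (h c y - w c))"
    if c: "c \<in> ball c0 \<delta>" and y: "y \<in> ball (w c0) s" for c y
  proof -
    define q where "q = qderiv c n (w c)"
    have hr: "h c y \<in> cball (w c0) r1" using h[OF in1(1)[OF c] y] by blast
    have ql: "(1 - \<eta>) * A \<le> norm q" unfolding q_def by (rule qlow[OF c])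
    have q0: "norm q > 0" using ql \<eta>(4) by linarith
    have "qderiv c n (h c y) / q - 1 = (qderiv c n (h c y) - q) / q" using q0 by (simp add: field_simps)
    then have eq: "norm (qderiv c n (h c y) / q - 1) = norm (qderiv c n (h c y) - q) / norm q" by (simp add: norm_divide)
    have "norm (qderiv c n (h c y) - q) \<le> B * norm (h c y - w c)"
      unfolding q_def by (rule B(2)[OF _ hr wr(1)[OF c]]) (use in1(1)[OF c] in simp)
    then have 1: "norm (qderiv c n (h c y) - q) / norm q \<le> B * norm (h c y - w c) / ((1 - \<eta>) * A)"
      using ql \<eta>(4) B(1) by (intro frac_le) auto
    have "norm (qderiv c n (h c y) - q) \<le> \<eta> * A + \<eta> * A"
      unfolding q_def A_def using *(5)[OF in1(1)[OF c] hr] *(5)[OF in1(1)[OF c] wr(1)[OF c]]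
      by (smt (verit) norm_triangle_ineq4 diff_diff_eq2 diff_add_cancel add_diff_cancel_left' diff_diff_add)
    then have "norm (qderiv c n (h c y) - q) / norm q \<le> (\<eta> * A + \<eta> * A) / ((1 - \<eta>) * A)"
      using ql \<eta> A by (intro frac_le) auto
    also have "\<dots> = 2 * \<eta> / (1 - \<eta>)" using A \<eta>(3) by (simp add: field_simps)
    also have "\<dots> \<le> 2/3" using \<eta> by (simp add: field_simps)
    finally show ?thesis using 1 eq unfolding q_def by simp
  qed
  show thesis
  proof (rule that[of s \<delta> \<mu> "B / ((1 - \<eta>) * A)" h, OF *(4) \<delta>(1,2) \<mu> _ _ _ _ _ hw _ ratio])
    show "B / ((1 - \<eta>) * A) > 0" using B(1) \<eta>(4) by (intro divide_pos_pos) auto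
    show "qderiv c n (w c) \<noteq> 0" if "c \<in> ball c0 \<delta>" for c using qlow[OF that] \<eta>(4) by auto
    show "(quad c ^^ n) (h c y) = y" if "c \<in> ball c0 \<delta>" "y \<in> ball (w c0) s" for c y using h[OF in1(1)[OF that(1)] that(2)] by blast
    have "ball c0 \<delta> \<subseteq> ball c0 \<delta>1" using in1(1) by blast
    then show "preserves_holo h (ball c0 \<delta>) (ball (w c0) s)"
      using hh unfolding preserves_holo_def by (meson subset_trans)
  qed (use wr(2) lip in blast)+
qed

lemma funpow_contraction_to_fixed_point:
  fixes h :: "complex \<Rightarrow> complex"
  assumes lip: "\<And>y y'. y \<in> ball w0 r \<Longrightarrow> y' \<in> ball w0 r \<Longrightarrow> norm (h y - h y') \<le> \<mu> * norm (y - y')"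
    and fixed: "h w = w" and w: "w \<in> ball w0 (r/4)" and \<mu>: "0 < \<mu>" "\<mu> < 1"
    and y: "y \<in> ball w0 (r/4)"
  shows "norm ((h ^^ i) y - w) \<le> \<mu> ^ i * (r/2)" "(h ^^ i) y \<in> ball w0 r"
proof -
  have r: "r > 0" using y by (metis ball_eq_empty divide_le_0_iff emptyE not_less zero_le_numeral)
  have wr: "w \<in> ball w0 r" using w r by auto
  have y2: "norm (y - w) \<le> r/2"
    using dist_triangle[of y w w0] y w by (simp add: dist_norm norm_minus_commute)
  have in_ball: "x \<in> ball w0 r" if "norm (x - w) \<le> r/2" for x
    using that w dist_triangle[of w0 x w] r by (simp add: dist_norm norm_minus_commute)
  have 1: "norm ((h ^^ i) y - w) \<le> \<mu> ^ i * (r/2)" for i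
  proof (induction i)
    case (Suc i)
    have le1: "\<mu> ^ i * (r/2) \<le> 1 * (r/2)" using \<mu> r by (intro mult_right_mono power_le_one) auto
    then have "(h ^^ i) y \<in> ball w0 r" using Suc by (intro in_ball) simp
    then have "norm (h ((h ^^ i) y) - h w) \<le> \<mu> * norm ((h ^^ i) y - w)" by (rule lip[OF _ wr])
    also have "\<dots> \<le> \<mu> * (\<mu> ^ i * (r/2))" using Suc \<mu> by (intro mult_left_mono) auto
    finally show ?case by (simp add: fixed mult.assoc)
  qed (use y2 in simp)
  show "norm ((h ^^ i) y - w) \<le> \<mu> ^ i * (r/2)" by (rule 1)
  have "\<mu> ^ i * (r/2) \<le> 1 * (r/2)" using \<mu> r by (intro mult_right_mono power_le_one) auto
  then show "(h ^^ i) y \<in> ball w0 r" using 1[of i] by (intro in_ball) simp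
qed

lemma funpow_contraction_Lipschitz:
  fixes h :: "complex \<Rightarrow> complex"
  assumes lip: "\<And>y y'. y \<in> ball w0 r \<Longrightarrow> y' \<in> ball w0 r \<Longrightarrow> norm (h y - h y') \<le> \<mu> * norm (y - y')"
    and fixed: "h w = w" and w: "w \<in> ball w0 (r/4)" and \<mu>: "0 < \<mu>" "\<mu> < 1"
    and y: "y \<in> ball w0 (r/4)" "y' \<in> ball w0 (r/4)"
  shows "norm ((h ^^ i) y - (h ^^ i) y') \<le> \<mu> ^ i * norm (y - y')"
proof (induction i)
  case (Suc i)
  have in_ball: "(h ^^ i) x \<in> ball w0 r" if "x \<in> ball w0 (r/4)" for x
    by (rule funpow_contraction_to_fixed_point(2)[of w0 r h \<mu> w, OF _ fixed w \<mu> that]) (rule lip)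
  have "norm (h ((h ^^ i) y) - h ((h ^^ i) y')) \<le> \<mu> * norm ((h ^^ i) y - (h ^^ i) y')"
    by (rule lip[OF in_ball[OF y(1)] in_ball[OF y(2)]])
  also have "\<dots> \<le> \<mu> * (\<mu> ^ i * norm (y - y'))" using Suc \<mu> by (intro mult_left_mono) auto
  finally show ?case by (simp add: mult.assoc)
qed simp

text \<open>Suppose the orbit of \<open>\<zeta>\<close> first makes an excursion of length \<open>l\<close> and then shadows the cycle for
  \<open>k n0\<close> steps, staying away from \<open>\<zeta>\<close> except possibly in the last \<open>k1 n0\<close> of them. A proper period would have a
  multiple between \<open>k1 n0\<close> and \<open>k n0\<close>, which would bring the orbit back to \<open>\<zeta>\<close> in the middle of
  the shadowing.\<close>

lemma shadowing_not_short_period: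
  assumes n0: "n0 > 0" and \<zeta>: "(quad c ^^ (l + k * n0)) \<zeta> = \<zeta>"
    and away: "\<And>a b. k1 \<le> a \<Longrightarrow> a \<le> k \<Longrightarrow> b < n0 \<Longrightarrow> (quad c ^^ (l + (k - a) * n0 + b)) \<zeta> \<noteq> \<zeta>"
    and k1: "k1 > 0" and k: "l \<le> k * n0" "k1 * (k1 * n0) \<le> k"
    and m: "0 < m" "m < l + k * n0"
  shows "(quad c ^^ m) \<zeta> \<noteq> \<zeta>"
proof
  assume eq: "(quad c ^^ m) \<zeta> = \<zeta>"
  define n where "n = l + k * n0"
  have shift: "(quad c ^^ (n - M)) \<zeta> = \<zeta>" if "(quad c ^^ M) \<zeta> = \<zeta>" "M \<le> n" for M
  proof -
    have "(quad c ^^ (M + (n - M))) \<zeta> = \<zeta>" using \<zeta> that(2) by (simp add: n_def)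
    then show ?thesis unfolding quad_iter_add that(1) .
  qed
  \<comment> \<open>With \<open>m\<close> also \<open>n - m\<close> is a period, and one of them is at most \<open>n/2\<close>.\<close>
  have "\<exists>m'. 0 < m' \<and> 2 * m' \<le> n \<and> (quad c ^^ m') \<zeta> = \<zeta>"
  proof (cases "2 * m \<le> n")
    case False
    have "(quad c ^^ (n - m)) \<zeta> = \<zeta>" by (rule shift[OF eq]) (use m in \<open>simp add: n_def\<close>)
    moreover have "0 < n - m" "2 * (n - m) \<le> n" using False m by (auto simp: n_def)
    ultimately show ?thesis by blast
  qed (use eq m in blast)
  then obtain m' where m': "0 < m'" "2 * m' \<le> n" "(quad c ^^ m') \<zeta> = \<zeta>" by blast
  have "\<exists>M. k1 * n0 \<le> M \<and> M \<le> k * n0 \<and> (quad c ^^ M) \<zeta> = \<zeta>"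
  proof (cases "k1 * n0 \<le> m'")
    case True
    have "m' \<le> k * n0" using m'(2) k(1) by (simp add: n_def)
    then show ?thesis using True m'(3) by blast
  next
    case False
    have "k1 * n0 \<le> m' * (k1 * n0)" using m'(1) by simp
    moreover have "m' * (k1 * n0) \<le> (k1 * n0) * (k1 * n0)" using False by (intro mult_le_mono1) simp
    moreover have "(k1 * n0) * (k1 * n0) = k1 * (k1 * n0) * n0" by (simp only: mult_ac)
    moreover have "k1 * (k1 * n0) * n0 \<le> k * n0" using k(2) by (intro mult_le_mono1)
    ultimately show ?thesis using quad_iter_fixed_mult(1)[OF m'(3), of "k1 * n0"] by (intro exI[of _ "m' * (k1 * n0)"]) linarith
  qed
  then obtain M where M: "k1 * n0 \<le> M" "M \<le> k * n0" "(quad c ^^ M) \<zeta> = \<zeta>" by blast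
  define a where "a = (M + (n0 - 1)) div n0"
  \<comment> \<open>\<open>a\<close> is \<open>M / n0\<close> rounded up, so that \<open>M = a n0 - b\<close> with \<open>b < n0\<close>.\<close>
  define b where "b = a * n0 - M"
  have "a * n0 + (M + (n0 - 1)) mod n0 = M + (n0 - 1)" unfolding a_def by (rule div_mult_mod_eq)
  moreover have "(M + (n0 - 1)) mod n0 < n0" using n0 by simp
  ultimately have a1: "M \<le> a * n0" "a * n0 < M + n0" using n0 by linarith+
  have b: "b < n0" "M + b = a * n0" using a1 by (auto simp: b_def)
  have ak: "a \<le> k"
  proof (rule ccontr)
    assume "\<not> a \<le> k"
    then have "(k + 1) * n0 \<le> a * n0" by (intro mult_le_mono1) simp
    then show False using a1 M(2) by (simp add: algebra_simps)
  qed
  have "k1 * n0 \<le> a * n0" using a1 M(1) by linarith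
  then have k1a: "k1 \<le> a" using n0 by simp
  have "n - M = l + (k - a) * n0 + b" using b(2) mult_le_mono1[OF ak, of n0] unfolding n_def diff_mult_distrib by linarith
  moreover have "(quad c ^^ (n - M)) \<zeta> = \<zeta>" by (rule shift[OF M(3)]) (use M(2) in \<open>simp add: n_def\<close>)
  ultimately show False using away[OF k1a ak b(1)] by simp
qed

text \<open>A product whose factors approach 1 geometrically is bounded above and below independently
  of its length; for the lower bound, \<open>1 - e \<ge> 1 / (1 + 3 e) \<ge> exp (- 3 e)\<close> for \<open>0 \<le> e \<le> 2/3\<close>.\<close>

lemma prod_near_one_bounds:
  fixes q :: "nat \<Rightarrow> complex"
  assumes q: "\<And>i. i < k \<Longrightarrow> norm (q i - 1) \<le> min (2/3) (E * \<mu> ^ i)" and \<mu>: "0 < \<mu>" "\<mu> < 1" and E: "E \<ge> 0"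
  shows "norm (\<Prod>i<k. q i) \<le> exp (E / (1 - \<mu>))" "exp (- (3 * E / (1 - \<mu>))) \<le> norm (\<Prod>i<k. q i)"
proof -
  have geo: "(\<Sum>i<k. E * \<mu> ^ i) \<le> E / (1 - \<mu>)"
  proof -
    have "(\<Sum>i<k. \<mu> ^ i) = (1 - \<mu> ^ k) / (1 - \<mu>)" using \<mu> by (simp add: sum_gp_strict)
    also have "\<dots> \<le> 1 / (1 - \<mu>)" using \<mu> by (intro divide_right_mono) auto
    finally show ?thesis using mult_left_mono[OF _ E] by (fastforce simp: sum_distrib_left[symmetric])
  qed
  have u: "norm (q i) \<le> exp (E * \<mu> ^ i)" if "i < k" for i
  proof -
    have "norm (q i) \<le> 1 + norm (q i - 1)" using norm_triangle_ineq[of 1 "q i - 1"] by simp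
    also have "\<dots> \<le> 1 + E * \<mu> ^ i" using q[OF that] by simp
    also have "\<dots> \<le> exp (E * \<mu> ^ i)" by (rule exp_ge_add_one_self)
    finally show ?thesis .
  qed
  have "norm (\<Prod>i<k. q i) \<le> (\<Prod>i<k. exp (E * \<mu> ^ i))"
    unfolding prod_norm[symmetric] using u by (intro prod_mono) auto
  also have "\<dots> = exp (\<Sum>i<k. E * \<mu> ^ i)" by (simp add: exp_sum)
  also have "\<dots> \<le> exp (E / (1 - \<mu>))" using geo by simp
  finally show "norm (\<Prod>i<k. q i) \<le> exp (E / (1 - \<mu>))" .
  have l: "exp (- (3 * (E * \<mu> ^ i))) \<le> norm (q i)" if "i < k" for i
  proof -
    define e where "e = norm (q i - 1)"
    have e: "0 \<le> e" "e \<le> 2/3" "e \<le> E * \<mu> ^ i" using q[OF that] by (auto simp: e_def)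
    have "1 - e \<le> norm (q i)" using norm_triangle_ineq2[of 1 "1 - q i"] by (simp add: e_def norm_minus_commute)
    moreover have "1 \<le> (1 + 3 * e) * (1 - e)" using mult_nonneg_nonneg[of e "2 - 3 * e"] e by (simp add: algebra_simps)
    then have "1 / (1 + 3 * e) \<le> 1 - e" using e by (simp add: field_simps)
    moreover have "exp (- (3 * e)) \<le> 1 / (1 + 3 * e)"
      using exp_ge_add_one_self[of "3 * e"] e by (simp add: exp_minus field_simps)
    moreover have "exp (- (3 * (E * \<mu> ^ i))) \<le> exp (- (3 * e))" using e by simp
    ultimately show ?thesis by linarith
  qed
  have "exp (- (3 * E / (1 - \<mu>))) \<le> exp (- (3 * (\<Sum>i<k. E * \<mu> ^ i)))" using geo by simp
  also have "\<dots> = (\<Prod>i<k. exp (- (3 * (E * \<mu> ^ i))))" by (simp add: exp_sum[symmetric] sum_distrib_left sum_negf)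
  also have "\<dots> \<le> norm (\<Prod>i<k. q i)" unfolding prod_norm[symmetric] using l by (intro prod_mono) auto
  finally show "exp (- (3 * E / (1 - \<mu>))) \<le> norm (\<Prod>i<k. q i)" .
qed

text \<open>Near a homoclinic orbit there are periodic orbits that spend almost all their time near
  the given cycle. If \<open>g\<close> is the inverse of the \<open>l\<close>-th iterate sending \<open>w c0\<close> to the homoclinic point \<open>p\<close> and
  \<open>h\<close> the local inverse at the cycle, then \<open>g \<circ> h\<^sup>k\<close> maps a small disc at \<open>p\<close> into itself and
  contracts it; \<open>\<zeta> k\<close> is its fixed point.\<close>

lemma homoclinic_family:
  assumes n0: "n0 > 0" and d0: "\<delta>0 > 0" and w: "w holomorphic_on ball c0 \<delta>0"
    and fp: "\<And>c. c \<in> ball c0 \<delta>0 \<Longrightarrow> (quad c ^^ n0) (w c) = w c"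
    and rep: "norm (qderiv c0 n0 (w c0)) > 1"
    and hom: "\<And>r. r > 0 \<Longrightarrow> \<exists>l p. l mod n0 = s \<and> dist p (w c0) < r \<and> (quad c0 ^^ l) p = w c0 \<and>
        qderiv c0 l p \<noteq> 0 \<and> (\<forall>b. p \<noteq> (quad c0 ^^ b) (w c0))"
  obtains l \<delta> K B1 B2 \<zeta> where "l mod n0 = s" "0 < \<delta>" "\<delta> \<le> \<delta>0" "0 < B1"
    "\<And>c. c \<in> ball c0 \<delta> \<Longrightarrow> qderiv c n0 (w c) \<noteq> 0"
    "\<And>k. k \<ge> K \<Longrightarrow> \<zeta> k holomorphic_on ball c0 \<delta>"
    "\<And>k c. k \<ge> K \<Longrightarrow> c \<in> ball c0 \<delta> \<Longrightarrow> periodic_point c (l + k * n0) (\<zeta> k c)"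
    "\<And>k c. k \<ge> K \<Longrightarrow> c \<in> ball c0 \<delta> \<Longrightarrow> B1 \<le> norm (qderiv c (l + k * n0) (\<zeta> k c) / qderiv c n0 (w c) ^ k)"
    "\<And>k c. k \<ge> K \<Longrightarrow> c \<in> ball c0 \<delta> \<Longrightarrow> norm (qderiv c (l + k * n0) (\<zeta> k c) / qderiv c n0 (w c) ^ k) \<le> B2"
proof -
  define w0 where "w0 = w c0"
  obtain r \<delta>1 \<mu> L h where R: "0 < r" "0 < \<delta>1" "\<delta>1 \<le> \<delta>0" "0 < \<mu>" "\<mu> < 1" "0 < L"
    "\<And>c. c \<in> ball c0 \<delta>1 \<Longrightarrow> w c \<in> ball (w c0) (r/4)"
    "\<And>c. c \<in> ball c0 \<delta>1 \<Longrightarrow> qderiv c n0 (w c) \<noteq> 0"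
    "\<And>c y. c \<in> ball c0 \<delta>1 \<Longrightarrow> y \<in> ball (w c0) r \<Longrightarrow> (quad c ^^ n0) (h c y) = y"
    "\<And>c y y'. c \<in> ball c0 \<delta>1 \<Longrightarrow> y \<in> ball (w c0) r \<Longrightarrow> y' \<in> ball (w c0) r \<Longrightarrow> norm (h c y - h c y') \<le> \<mu> * norm (y - y')"
    "\<And>c. c \<in> ball c0 \<delta>1 \<Longrightarrow> h c (w c) = w c"
    "preserves_holo h (ball c0 \<delta>1) (ball (w c0) r)"
    "\<And>c y. c \<in> ball c0 \<delta>1 \<Longrightarrow> y \<in> ball (w c0) r \<Longrightarrow>
        norm (qderiv c n0 (h c y) / qderiv c n0 (w c) - 1) \<le> min (2/3) (L * norm (h c y - w c))"
    apply (rule repelling_local_inverse[OF d0 w fp rep], assumption)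
    subgoal premises prems for r \<delta> \<mu> L h by (rule that[of r \<delta> \<mu> L h]; fact prems)
    done
  note R = R[folded w0_def]
  have "r/8 > 0" using R(1) by simp
  from hom[OF this] obtain l p where p: "l mod n0 = s" "dist p w0 < r/8" "(quad c0 ^^ l) p = w0"
    "qderiv c0 l p \<noteq> 0" "\<And>b. p \<noteq> (quad c0 ^^ b) w0"
    unfolding w0_def by blast
  define d where "d = Min ((\<lambda>b. dist p ((quad c0 ^^ b) w0)) ` {..<n0})"
  have d: "d > 0" unfolding d_def using n0 p(5) by (subst Min_gr_iff) auto
  have d_le: "d \<le> dist p ((quad c0 ^^ b) w0)" if "b < n0" for b
    unfolding d_def using that by (intro Min_le) auto
  \<comment> \<open>\<open>d\<close> is the distance from \<open>p\<close> to the cycle; the disc at \<open>p\<close> is kept away from the cycle and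
    inside the domain of \<open>h\<close>.\<close>
  define r0 where "r0 = min (r/8) (d/2)"
  have r0: "r0 > 0" "r0 \<le> r/8" "r0 \<le> d/2" using R(1) d by (auto simp: r0_def)
  define A2 where "A2 = norm (qderiv c0 l p)"
  have A2: "A2 > 0" using p(4) by (simp add: A2_def)
  obtain r2 \<delta>2 s2 g where G: "0 < r2" "r2 < r0" "0 < \<delta>2" "0 < s2"
    "\<And>c x. c \<in> ball c0 \<delta>2 \<Longrightarrow> x \<in> cball p r2 \<Longrightarrow> norm (qderiv c l x - qderiv c0 l p) \<le> 1/2 * norm (qderiv c0 l p)"
    "\<And>c x x'. c \<in> ball c0 \<delta>2 \<Longrightarrow> x \<in> cball p r2 \<Longrightarrow> x' \<in> cball p r2 \<Longrightarrow>
        (1 - 1/2) * norm (qderiv c0 l p) * norm (x - x') \<le> norm ((quad c ^^ l) x - (quad c ^^ l) x')"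
    "\<And>c y. c \<in> ball c0 \<delta>2 \<Longrightarrow> y \<in> ball ((quad c0 ^^ l) p) s2 \<Longrightarrow> g c y \<in> cball p r2 \<and> (quad c ^^ l) (g c y) = y"
    "preserves_holo g (ball c0 \<delta>2) (ball ((quad c0 ^^ l) p) s2)"
    apply (rule local_inverse[of "\<lambda>c. quad c ^^ l" "\<lambda>c. qderiv c l" c0 p "1/2" r0, OF holo_family_quad_iter p(4) _ _ r0(1)])
      apply simp
     apply simp
    subgoal premises prems for r \<delta> s h by (rule that[of r \<delta> s h]; fact prems)
    done
  note G = G[folded A2_def, unfolded p(3)]
  have sub: "x \<in> ball w0 (r/4)" if "x \<in> cball p r2" for x
    using that p(2) G(2) r0(2) dist_triangle[of w0 x p] by (simp add: dist_commute)
  have "\<forall>\<^sub>F q in nhds (c0, w0). \<forall>b\<in>{..<n0}. dist ((quad (fst q) ^^ b) (snd q)) ((quad c0 ^^ b) w0) < d/2"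
  proof (intro eventually_ball_finite ballI)
    fix b
    define F where "F q = (quad (fst q) ^^ b) (snd q)" for q
    have "continuous_on UNIV F"
      unfolding F_def[abs_def] by (intro continuous_intros continuous_on_fst continuous_on_snd continuous_on_id)
    then have "isCont F (c0, w0)" unfolding continuous_on_eq_continuous_at[OF open_UNIV] by blast
    then have "(F \<longlongrightarrow> F (c0, w0)) (nhds (c0, w0))"
      using tendsto_at_iff_tendsto_nhds[of F "(c0, w0)"] by (simp only: isCont_def)
    then have "\<forall>\<^sub>F q in nhds (c0, w0). dist (F q) (F (c0, w0)) < d/2" using d by (intro tendstoD) auto
    then show "\<forall>\<^sub>F q in nhds (c0, w0). dist ((quad (fst q) ^^ b) (snd q)) ((quad c0 ^^ b) w0) < d/2"
      by (simp add: F_def)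
  qed simp
  then obtain e where e: "e > 0" "\<And>q b. dist q (c0, w0) < e \<Longrightarrow> b < n0 \<Longrightarrow> dist ((quad (fst q) ^^ b) (snd q)) ((quad c0 ^^ b) w0) < d/2"
    unfolding eventually_nhds_metric by blast
  define \<epsilon> where "\<epsilon> = e/2"
  have \<epsilon>: "\<epsilon> > 0" using e by (simp add: \<epsilon>_def)
  have close: "dist ((quad c ^^ b) x) ((quad c0 ^^ b) w0) < d/2" if "dist c c0 < \<epsilon>" "dist x w0 < \<epsilon>" "b < n0" for c x b
  proof -
    have "dist (c,x) (c0,w0) \<le> dist c c0 + dist x w0"
      by (metis dist_Pair_Pair real_sqrt_le_iff sqrt_sum_squares_le_sum zero_le_dist)
    then show ?thesis using e(2)[of "(c,x)" b] that by (simp add: \<epsilon>_def)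
  qed
  have "isCont w c0" by (rule holo_imp_isCont[OF w open_ball]) (use d0 in simp)
  moreover have "min (s2/2) (\<epsilon>/2) > 0" using G(4) \<epsilon> by simp
  ultimately obtain \<delta>w where \<delta>w: "\<delta>w > 0" "\<And>c. dist c c0 < \<delta>w \<Longrightarrow> dist (w c) w0 < min (s2/2) (\<epsilon>/2)"
    unfolding continuous_at_eps_delta w0_def by blast
  have "\<forall>\<^sub>F k in sequentially. \<mu> ^ k * (r/2) < min (s2/2) (\<epsilon>/2) \<and> 2 / A2 * \<mu> ^ k < 1/2"
  proof (intro eventually_conj)
    have mu0: "(\<lambda>k. \<mu> ^ k) \<longlonglongrightarrow> 0" using R(4,5) by (intro LIMSEQ_power_zero) auto
    have "(\<lambda>k. \<mu> ^ k * (r/2)) \<longlonglongrightarrow> 0 * (r/2)" by (intro tendsto_intros mu0)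
    then have "(\<lambda>k. \<mu> ^ k * (r/2)) \<longlonglongrightarrow> 0" by (simp only: mult_zero_left)
    then show "\<forall>\<^sub>F k in sequentially. \<mu> ^ k * (r/2) < min (s2/2) (\<epsilon>/2)"
      by (rule order_tendstoD(2)) (rule \<open>min (s2/2) (\<epsilon>/2) > 0\<close>)
    have "(\<lambda>k. 2 / A2 * \<mu> ^ k) \<longlonglongrightarrow> 2 / A2 * 0" by (intro tendsto_intros mu0)
    then have "(\<lambda>k. 2 / A2 * \<mu> ^ k) \<longlonglongrightarrow> 0" by (simp only: mult_zero_right)
    then show "\<forall>\<^sub>F k in sequentially. 2 / A2 * \<mu> ^ k < 1/2" by (rule order_tendstoD(2)) simp
  qed
  then obtain k0 where k0: "\<And>k. k \<ge> k0 \<Longrightarrow> \<mu> ^ k * (r/2) < min (s2/2) (\<epsilon>/2)" "\<And>k. k \<ge> k0 \<Longrightarrow> 2 / A2 * \<mu> ^ k < 1/2"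
    unfolding eventually_sequentially by blast
  define \<delta> where "\<delta> = min (min \<delta>1 \<delta>2) (min \<delta>w \<epsilon>)"
  have \<delta>: "0 < \<delta>" "\<delta> \<le> \<delta>1" "\<delta> \<le> \<delta>2" "\<delta> \<le> \<delta>w" "\<delta> \<le> \<epsilon>" using R(2) G(3) \<delta>w(1) \<epsilon> by (auto simp: \<delta>_def)
  have inn: "c \<in> ball c0 \<delta>1" "c \<in> ball c0 \<delta>2" "dist c c0 < \<delta>w" "dist c c0 < \<epsilon>" if "c \<in> ball c0 \<delta>" for c
    using that \<delta> by (auto simp: dist_commute)
  have F1: "norm ((h c ^^ i) x - w c) \<le> \<mu> ^ i * (r/2)" "(h c ^^ i) x \<in> ball w0 r"
    if c: "c \<in> ball c0 \<delta>" and x: "x \<in> cball p r2" for c x i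
    using funpow_contraction_to_fixed_point[of w0 r "h c" \<mu> "w c" x i]
      R(10)[OF inn(1)[OF c]] R(11)[OF inn(1)[OF c]] R(7)[OF inn(1)[OF c]] R(4,5) sub[OF x] by blast+
  have F2: "dist ((h c ^^ i) x) w0 < min s2 \<epsilon>"
    if c: "c \<in> ball c0 \<delta>" and x: "x \<in> cball p r2" and i: "i \<ge> k0" for c x i
    using F1(1)[OF c x, of i] k0(1)[OF i] \<delta>w(2)[OF inn(3)[OF c]] dist_triangle[of "(h c ^^ i) x" w0 "w c"]
    by (simp add: dist_norm)
  have F3: "(\<lambda>c. (h c ^^ i) (v c)) holomorphic_on ball c0 \<delta>"
    if v: "v holomorphic_on ball c0 \<delta>" "v ` ball c0 \<delta> \<subseteq> cball p r2" for v i
  proof (induction i)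
    case (Suc i)
    have "(\<lambda>c. h c ((h c ^^ i) (v c))) holomorphic_on ball c0 \<delta>"
    proof (rule preserves_holoD[OF R(12) open_ball _ Suc])
      show "ball c0 \<delta> \<subseteq> ball c0 \<delta>1" using inn(1) by blast
      show "(\<lambda>c. (h c ^^ i) (v c)) ` ball c0 \<delta> \<subseteq> ball w0 r" using F1(2) v(2) by blast
    qed
    then show ?case by simp
  qed (use v in simp)
  have "\<exists>z. k \<ge> k0 \<longrightarrow> z holomorphic_on ball c0 \<delta> \<and> (\<forall>c\<in>ball c0 \<delta>. z c \<in> cball p r2 \<and> g c ((h c ^^ k) (z c)) = z c)" for k
  proof (cases "k \<ge> k0")
    case k: True
    have hs2: "(h c ^^ k) x \<in> ball w0 s2" if "c \<in> ball c0 \<delta>" "x \<in> cball p r2" for c x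
      using F2[OF that k] by (simp add: dist_commute)
    obtain z where z: "z holomorphic_on ball c0 \<delta>" "\<And>c. c \<in> ball c0 \<delta> \<Longrightarrow> z c \<in> cball p r2"
      "\<And>c. c \<in> ball c0 \<delta> \<Longrightarrow> g c ((h c ^^ k) (z c)) = z c"
    proof (rule holomorphic_fixed_point[of "ball c0 \<delta>" r2 p "\<lambda>c x. g c ((h c ^^ k) x)"])
      show "g c ((h c ^^ k) x) \<in> cball p r2" if "c \<in> ball c0 \<delta>" "x \<in> cball p r2" for c x
        using G(7)[OF inn(2)[OF that(1)] hs2[OF that]] by blast
      show "norm (g c ((h c ^^ k) x) - g c ((h c ^^ k) y)) \<le> norm (x - y) / 2"
        if c: "c \<in> ball c0 \<delta>" and x: "x \<in> cball p r2" and y: "y \<in> cball p r2" for c x y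
      proof -
        note gx = G(7)[OF inn(2)[OF c] hs2[OF c x]] and gy = G(7)[OF inn(2)[OF c] hs2[OF c y]]
        have "(1 - 1/2) * A2 * norm (g c ((h c ^^ k) x) - g c ((h c ^^ k) y)) \<le> norm ((h c ^^ k) x - (h c ^^ k) y)"
          using G(6)[OF inn(2)[OF c], of "g c ((h c ^^ k) x)" "g c ((h c ^^ k) y)"] gx gy by simp
        then have "norm (g c ((h c ^^ k) x) - g c ((h c ^^ k) y)) \<le> 2 / A2 * norm ((h c ^^ k) x - (h c ^^ k) y)"
          using A2 by (simp add: field_simps)
        also have "\<dots> \<le> 2 / A2 * (\<mu> ^ k * norm (x - y))"
        proof (intro mult_left_mono)
          show "norm ((h c ^^ k) x - (h c ^^ k) y) \<le> \<mu> ^ k * norm (x - y)"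
            by (rule funpow_contraction_Lipschitz[of w0 r "h c" \<mu> "w c"])
               (use R(10)[OF inn(1)[OF c]] R(11)[OF inn(1)[OF c]] R(7)[OF inn(1)[OF c]] R(4,5) sub[OF x] sub[OF y] in blast)+
        qed (use A2 in simp)
        also have "\<dots> = (2 / A2 * \<mu> ^ k) * norm (x - y)" by simp
        also have "\<dots> \<le> 1/2 * norm (x - y)" using k0(2)[OF k] by (intro mult_right_mono) auto
        finally show ?thesis by simp
      qed
      show "(\<lambda>c. g c ((h c ^^ k) (v c))) holomorphic_on ball c0 \<delta>"
        if v: "v holomorphic_on ball c0 \<delta>" "v ` ball c0 \<delta> \<subseteq> cball p r2" for v
      proof (rule preserves_holoD[OF G(8) open_ball _ F3[OF v]])
        show "ball c0 \<delta> \<subseteq> ball c0 \<delta>2" using inn(2) by blast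
        show "(\<lambda>c. (h c ^^ k) (v c)) ` ball c0 \<delta> \<subseteq> ball w0 s2" using hs2 v(2) by blast
      qed
    next
      show "open (ball c0 \<delta>)" "0 \<le> r2" using G(1) by simp_all
    qed (rule that; blast)
    then show ?thesis by blast
  qed simp
  then obtain \<zeta> where \<zeta>: "\<And>k. k \<ge> k0 \<Longrightarrow> \<zeta> k holomorphic_on ball c0 \<delta>"
    "\<And>k c. k \<ge> k0 \<Longrightarrow> c \<in> ball c0 \<delta> \<Longrightarrow> \<zeta> k c \<in> cball p r2"
    "\<And>k c. k \<ge> k0 \<Longrightarrow> c \<in> ball c0 \<delta> \<Longrightarrow> g c ((h c ^^ k) (\<zeta> k c)) = \<zeta> k c"
    by metis
  define k1 where "k1 = k0 + 1"
  \<comment> \<open>Large enough for \<open>shadowing_not_short_period\<close> and for \<open>k \<ge> k0\<close>.\<close>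
  define K where "K = l + k1 * (k1 * n0) + k1"
  show thesis
  proof (rule that[of l \<delta> "A2 / 2 * exp (- (3 * (L * (r/2)) / (1 - \<mu>)))" K \<zeta> "3 / 2 * A2 * exp (L * (r/2) / (1 - \<mu>))", OF p(1) \<delta>(1)])
    show "\<delta> \<le> \<delta>0" using \<delta>(2) R(3) by linarith
    show "0 < A2 / 2 * exp (- (3 * (L * (r/2)) / (1 - \<mu>)))" using A2 by simp
    show "qderiv c n0 (w c) \<noteq> 0" if "c \<in> ball c0 \<delta>" for c by (rule R(8)[OF inn(1)[OF that]])
    show "\<zeta> k holomorphic_on ball c0 \<delta>" if "k \<ge> K" for k using that by (intro \<zeta>(1)) (simp add: K_def k1_def)
  next
    fix k c assume k: "k \<ge> K" and c: "c \<in> ball c0 \<delta>"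
    have kk0: "k \<ge> k0" using k by (simp add: K_def k1_def)
    define Z where "Z = \<zeta> k c"
    define Y where "Y i = (h c ^^ i) Z" for i
    have Z: "Z \<in> cball p r2" "g c (Y k) = Z" using \<zeta>(2,3)[OF kk0 c] by (simp_all add: Z_def Y_def)
    have Yr: "Y i \<in> ball w0 r" for i unfolding Y_def by (rule F1(2)[OF c Z(1)])
    have Ys: "Y k \<in> ball w0 s2" using F2[OF c Z(1) kk0] by (simp add: Y_def dist_commute)
    have O1: "(quad c ^^ l) Z = Y k" using G(7)[OF inn(2)[OF c] Ys] Z(2) by simp
    have O2: "(quad c ^^ n0) (Y (Suc i)) = Y i" for i using R(9)[OF inn(1)[OF c] Yr[of i]] by (simp add: Y_def)
    have O3: "(quad c ^^ (j * n0)) (Y (i + j)) = Y i" for i j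
    proof (induction j)
      case (Suc j)
      have "(quad c ^^ (Suc j * n0)) (Y (i + Suc j)) = (quad c ^^ (j * n0)) ((quad c ^^ n0) (Y (Suc (i + j))))"
        by (simp add: quad_iter_add)
      then show ?case using O2[of "i + j"] Suc by simp
    qed simp
    have O4: "(quad c ^^ (l + (k - a) * n0 + b)) Z = (quad c ^^ b) (Y a)" if "a \<le> k" for a b
      using O1 O3[of "k - a" a] that by (simp add: quad_iter_add)
    have per: "(quad c ^^ (l + k * n0)) Z = Z" using O4[of 0 0] by (simp add: Y_def)
    have away: "(quad c ^^ (l + (k - a) * n0 + b)) Z \<noteq> Z" if a: "k1 \<le> a" "a \<le> k" and b: "b < n0" for a b
    proof
      assume "(quad c ^^ (l + (k - a) * n0 + b)) Z = Z"
      then have eq: "(quad c ^^ b) (Y a) = Z" using O4[OF a(2)] by simp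
      have "dist (Y a) w0 < \<epsilon>" using F2[OF c Z(1), of a] a(1) by (simp add: Y_def k1_def)
      then have "dist Z ((quad c0 ^^ b) w0) < d/2" using close[OF inn(4)[OF c] _ b, of "Y a"] eq by simp
      moreover have "dist p Z < d/2" using Z(1) G(2) r0(3) by simp
      ultimately show False using d_le[OF b] dist_triangle[of p "(quad c0 ^^ b) w0" Z] by linarith
    qed
    have "(quad c ^^ m) Z \<noteq> Z" if m: "0 < m" "m < l + k * n0" for m
    proof (rule shadowing_not_short_period[OF n0 per away _ _ _ m])
      show "k1 > 0" by (simp add: k1_def)
      have "K \<le> K * n0" using n0 by simp
      also have "\<dots> \<le> k * n0" using k by (intro mult_le_mono1)
      finally show "l \<le> k * n0" by (simp add: K_def)
      show "k1 * (k1 * n0) \<le> k" using k by (simp add: K_def)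
    qed
    moreover have "l + k * n0 > 0" using n0 k by (simp add: K_def k1_def)
    ultimately show "periodic_point c (l + k * n0) (\<zeta> k c)"
      using per unfolding periodic_point_def Z_def[symmetric] by blast
    define \<rho> where "\<rho> = qderiv c n0 (w c)"
    have M1: "qderiv c (j * n0) (Y j) = (\<Prod>i<j. qderiv c n0 (Y (Suc i)))" for j
    proof (induction j)
      case (Suc j)
      have "qderiv c (Suc j * n0) (Y (Suc j)) = qderiv c n0 (Y (Suc j)) * qderiv c (j * n0) (Y j)"
        using O2[of j] by (simp add: qderiv_add)
      then show ?case using Suc by simp
    qed (simp add: qderiv_def)
    have "qderiv c (l + k * n0) Z = qderiv c l Z * (\<Prod>i<k. qderiv c n0 (Y (Suc i)))"
      by (simp add: qderiv_add O1 M1)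
    then have M2: "qderiv c (l + k * n0) (\<zeta> k c) / \<rho> ^ k = qderiv c l Z * (\<Prod>i<k. qderiv c n0 (Y (Suc i)) / \<rho>)"
      by (simp add: Z_def prod_dividef)
    have M3: "norm (qderiv c n0 (Y (Suc i)) / \<rho> - 1) \<le> min (2/3) (L * (r/2) * \<mu> ^ i)" for i
    proof -
      have "L * norm (Y (Suc i) - w c) \<le> L * (\<mu> ^ Suc i * (r/2))"
        unfolding Y_def by (intro mult_left_mono F1(1)[OF c Z(1)]) (use R(6) in simp)
      also have "\<dots> \<le> L * (\<mu> ^ i * (r/2))"
        using R(1,4,5,6) by (intro mult_left_mono mult_right_mono power_decreasing) auto
      finally have "L * norm (Y (Suc i) - w c) \<le> L * (r/2) * \<mu> ^ i" by (simp add: mult_ac)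
      then show ?thesis using R(13)[OF inn(1)[OF c] Yr[of i]] by (simp add: Y_def \<rho>_def)
    qed
    have LE: "0 \<le> L * (r/2)" using R(1,6) by simp
    note P = prod_near_one_bounds[of k "\<lambda>i. qderiv c n0 (Y (Suc i)) / \<rho>", OF M3 R(4,5) LE]
    have q1: "norm (qderiv c l Z - qderiv c0 l p) \<le> 1/2 * A2" by (rule G(5)[OF inn(2)[OF c] Z(1)])
    have q2: "A2 / 2 \<le> norm (qderiv c l Z)" "norm (qderiv c l Z) \<le> 3 / 2 * A2"
      using q1 norm_triangle_ineq2[of "qderiv c0 l p" "qderiv c l Z"] norm_triangle_ineq2[of "qderiv c l Z" "qderiv c0 l p"]
      by (simp_all add: A2_def norm_minus_commute)
    show "A2 / 2 * exp (- (3 * (L * (r/2)) / (1 - \<mu>))) \<le> norm (qderiv c (l + k * n0) (\<zeta> k c) / qderiv c n0 (w c) ^ k)"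
      unfolding \<rho>_def[symmetric] M2 norm_mult by (intro mult_mono q2 P) auto
    show "norm (qderiv c (l + k * n0) (\<zeta> k c) / qderiv c n0 (w c) ^ k) \<le> 3 / 2 * A2 * exp (L * (r/2) / (1 - \<mu>))"
      unfolding \<rho>_def[symmetric] M2 norm_mult by (intro mult_mono q2 P) (use A2 in auto)
  qed
qed

section \<open>Convergence of logarithmic derivatives of multipliers\<close>

text \<open>If \<open>R = \<phi> \<rho> ^ k\<close>, then \<open>R' / (k R) - \<rho>' / \<rho> = \<phi>' / (k \<phi>)\<close>, and Cauchy's inequality bounds
  \<open>\<phi>'\<close>.\<close>

lemma logarithmic_derivative_bound:
  assumes \<delta>: "\<delta> > 0" and R: "R holomorphic_on ball c0 \<delta>" and \<rho>: "\<rho> holomorphic_on ball c0 \<delta>"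
    and nz: "\<And>c. c \<in> ball c0 \<delta> \<Longrightarrow> \<rho> c \<noteq> 0" and B1: "0 < B1" and k: "k > 0"
    and low: "\<And>c. c \<in> ball c0 \<delta> \<Longrightarrow> B1 \<le> norm (R c / \<rho> c ^ k)"
    and up: "\<And>c. c \<in> ball c0 \<delta> \<Longrightarrow> norm (R c / \<rho> c ^ k) \<le> B2"
    and c: "c \<in> ball c0 (\<delta>/2)"
  shows "norm (deriv R c / (of_nat k * R c) - deriv \<rho> c / \<rho> c) \<le> 4 * B2 / (\<delta> * B1) / real k"
proof -
  define \<phi> where "\<phi> c = R c / \<rho> c ^ k" for c
  have \<phi>: "\<phi> holomorphic_on ball c0 \<delta>" unfolding \<phi>_def[abs_def] by (intro holomorphic_intros R \<rho>) (use nz in auto)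
  have sub: "cball c (\<delta>/4) \<subseteq> ball c0 \<delta>"
  proof
    fix x assume "x \<in> cball c (\<delta>/4)"
    then show "x \<in> ball c0 \<delta>" using c \<delta> dist_triangle[of c0 x c] by simp
  qed
  have cd: "c \<in> ball c0 \<delta>" using c \<delta> by simp
  have "norm ((deriv ^^ 1) \<phi> c) \<le> fact 1 * B2 / (\<delta>/4) ^ 1"
  proof (rule Cauchy_inequality)
    show "\<phi> holomorphic_on ball c (\<delta>/4)" by (rule holomorphic_on_subset[OF \<phi>]) (use sub ball_subset_cball in blast)
    show "continuous_on (cball c (\<delta>/4)) \<phi>" by (rule holomorphic_on_imp_continuous_on[OF holomorphic_on_subset[OF \<phi> sub]])
    fix x assume "norm (c - x) = \<delta>/4"
    then have "x \<in> cball c (\<delta>/4)" by (simp add: dist_norm)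
    then show "norm (\<phi> x) \<le> B2" unfolding \<phi>_def using up sub by blast
  qed (use \<delta> in simp)
  then have d\<phi>: "norm (deriv \<phi> c) \<le> 4 * B2 / \<delta>" by (simp add: field_simps)
  have D\<phi>: "(\<phi> has_field_derivative deriv \<phi> c) (at c)" by (rule holomorphic_derivI[OF \<phi> open_ball cd])
  have D\<rho>: "(\<rho> has_field_derivative deriv \<rho> c) (at c)" by (rule holomorphic_derivI[OF \<rho> open_ball cd])
  have "((\<lambda>c. \<phi> c * \<rho> c ^ k) has_field_derivative deriv \<phi> c * \<rho> c ^ k + (of_nat k * (deriv \<rho> c * \<rho> c ^ (k - 1))) * \<phi> c) (at c)"
    using DERIV_mult'[OF D\<phi> DERIV_power[OF D\<rho>, of k]] by (simp add: algebra_simps)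
  then have "(R has_field_derivative deriv \<phi> c * \<rho> c ^ k + (of_nat k * (deriv \<rho> c * \<rho> c ^ (k - 1))) * \<phi> c) (at c)"
    by (rule has_field_derivative_transform_within_open[OF _ open_ball cd]) (simp add: \<phi>_def nz)
  then have dR: "deriv R c = deriv \<phi> c * \<rho> c ^ k + (of_nat k * (deriv \<rho> c * \<rho> c ^ (k - 1))) * \<phi> c"
    by (rule DERIV_imp_deriv)
  have \<phi>0: "B1 \<le> norm (\<phi> c)" unfolding \<phi>_def by (rule low[OF cd])
  then have \<phi>n: "\<phi> c \<noteq> 0" using B1 by auto
  have Rc: "R c = \<phi> c * \<rho> c ^ k" by (simp add: \<phi>_def nz[OF cd])
  have pk: "\<rho> c ^ k = \<rho> c * \<rho> c ^ (k - 1)" using k by (simp add: power_eq_if)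
  have "deriv R c / (of_nat k * R c) - deriv \<rho> c / \<rho> c = deriv \<phi> c / (of_nat k * \<phi> c)"
    unfolding dR Rc pk using \<phi>n nz[OF cd] k by (simp add: field_simps)
  then have "norm (deriv R c / (of_nat k * R c) - deriv \<rho> c / \<rho> c) = norm (deriv \<phi> c) / (real k * norm (\<phi> c))"
    by (simp add: norm_divide norm_mult)
  also have "\<dots> \<le> (4 * B2 / \<delta>) / (real k * B1)"
    using d\<phi> \<phi>0 B1 k order_trans[OF norm_ge_zero d\<phi>] by (intro frac_le mult_left_mono mult_pos_pos) auto
  finally show ?thesis by (simp add: mult_ac)
qed

text \<open>The zero of \<open>\<rho>' / \<rho>\<close> at \<open>c0\<close> is inherited by the functions that converge to it, by
  Hurwitz's theorem. The lengths produced by one homoclinic orbit fill one residue class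
  modulo \<open>n0\<close>.\<close>

lemma critical_points_accumulate:
  assumes n0: "n0 > 0" and d0: "\<delta>0 > 0" and w: "w holomorphic_on ball c0 \<delta>0"
    and fp: "\<And>c. c \<in> ball c0 \<delta>0 \<Longrightarrow> (quad c ^^ n0) (w c) = w c"
    and crit: "deriv (\<lambda>c. qderiv c n0 (w c)) c0 = 0"
    and rep: "norm (qderiv c0 n0 (w c0)) > 1"
    and hom: "\<And>r. r > 0 \<Longrightarrow> \<exists>l p. l mod n0 = s \<and> dist p (w c0) < r \<and> (quad c0 ^^ l) p = w c0 \<and>
        qderiv c0 l p \<noteq> 0 \<and> (\<forall>b. p \<noteq> (quad c0 ^^ b) (w c0))"
    and \<epsilon>: "\<epsilon> > 0"
  shows "\<exists>N. \<forall>n\<ge>N. n mod n0 = s \<longrightarrow> X n \<inter> ball c0 \<epsilon> \<noteq> {}"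
proof -
  obtain l \<delta> K B1 B2 \<zeta> where F: "l mod n0 = s" "0 < \<delta>" "\<delta> \<le> \<delta>0" "0 < B1"
    "\<And>c. c \<in> ball c0 \<delta> \<Longrightarrow> qderiv c n0 (w c) \<noteq> 0"
    "\<And>k. k \<ge> K \<Longrightarrow> \<zeta> k holomorphic_on ball c0 \<delta>"
    "\<And>k c. k \<ge> K \<Longrightarrow> c \<in> ball c0 \<delta> \<Longrightarrow> periodic_point c (l + k * n0) (\<zeta> k c)"
    "\<And>k c. k \<ge> K \<Longrightarrow> c \<in> ball c0 \<delta> \<Longrightarrow> B1 \<le> norm (qderiv c (l + k * n0) (\<zeta> k c) / qderiv c n0 (w c) ^ k)"
    "\<And>k c. k \<ge> K \<Longrightarrow> c \<in> ball c0 \<delta> \<Longrightarrow> norm (qderiv c (l + k * n0) (\<zeta> k c) / qderiv c n0 (w c) ^ k) \<le> B2"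
    apply (rule homoclinic_family[OF n0 d0 w fp rep hom], assumption, assumption)
    subgoal premises prems for l \<delta> K B1 B2 \<zeta> by (rule that[of l \<delta> B1 K \<zeta> B2]; fact prems)
    done
  define \<rho> where "\<rho> c = qderiv c n0 (w c)" for c
  define R where "R k c = qderiv c (l + k * n0) (\<zeta> k c)" for k c
  have wd: "w holomorphic_on ball c0 \<delta>" by (rule holomorphic_on_subset[OF w]) (use F(3) in auto)
  have \<rho>: "\<rho> holomorphic_on ball c0 \<delta>" unfolding \<rho>_def[abs_def] by (intro holomorphic_intros wd)
  have Rhol: "R k holomorphic_on ball c0 \<delta>" if "k \<ge> K" for k
    unfolding R_def[abs_def] by (intro holomorphic_intros F(6)[OF that])
  have \<rho>nz: "\<rho> c \<noteq> 0" if "c \<in> ball c0 \<delta>" for c unfolding \<rho>_def by (rule F(5)[OF that])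
  have Rnz: "R k c \<noteq> 0" if "k \<ge> K" "c \<in> ball c0 \<delta>" for k c
    using F(8)[OF that] F(4) by (auto simp: R_def)
  define \<epsilon>' where "\<epsilon>' = min \<epsilon> (\<delta>/2)"
  have \<epsilon>': "\<epsilon>' > 0" "\<epsilon>' \<le> \<epsilon>" "\<epsilon>' \<le> \<delta>/2" using \<epsilon> F(2) by (auto simp: \<epsilon>'_def)
  define S where "S = ball c0 \<epsilon>'"
  have S: "S \<subseteq> ball c0 \<delta>" "S \<subseteq> ball c0 (\<delta>/2)" "S \<subseteq> ball c0 \<epsilon>" using \<epsilon>' F(2) by (auto simp: S_def)
  define \<psi> where "\<psi> c = deriv \<rho> c / \<rho> c" for c
  have \<psi>: "\<psi> holomorphic_on S" unfolding \<psi>_def[abs_def]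
    by (intro holomorphic_on_divide holomorphic_deriv holomorphic_on_subset[OF \<rho>]) (use S \<rho>nz in \<open>auto simp: S_def\<close>)
  have \<psi>0: "\<psi> c0 = 0" using crit by (simp add: \<psi>_def \<rho>_def[abs_def])
  have nonconst: "\<not> \<psi> constant_on S"
  proof
    assume "\<psi> constant_on S"
    then have z: "\<psi> c = 0" if "c \<in> S" for c
      using that \<psi>0 \<epsilon>'(1) unfolding constant_on_def S_def by (metis centre_in_ball)
    have "\<exists>K. \<forall>c\<in>S. \<rho> c = K"
    proof (rule has_field_derivative_zero_constant)
      show "convex S" by (simp add: S_def)
      fix c assume c: "c \<in> S"
      have "(\<rho> has_field_derivative deriv \<rho> c) (at c)"
        by (rule holomorphic_derivI[OF \<rho> open_ball]) (use S c in blast)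
      moreover have "deriv \<rho> c = 0" using z[OF c] \<rho>nz[of c] S c by (auto simp: \<psi>_def)
      ultimately have "(\<rho> has_field_derivative 0) (at c)" by simp
      then show "(\<rho> has_field_derivative 0) (at c within S)" by (rule has_field_derivative_at_within)
    qed
    then obtain K where K: "\<And>c. c \<in> S \<Longrightarrow> \<rho> c = K" by blast
    have "K = \<rho> c0" using K[of c0] \<epsilon>'(1) by (simp add: S_def)
    then have "K \<noteq> 1" using rep by (auto simp: \<rho>_def)
    show False
    proof (rule multiplier_not_locally_constant[OF n0 \<open>K \<noteq> 1\<close> \<epsilon>'(1)])
      show "w holomorphic_on ball c0 \<epsilon>'" using holomorphic_on_subset[OF wd S(1)] by (simp add: S_def)
      show "(quad c ^^ n0) (w c) = w c \<and> qderiv c n0 (w c) = K" if "c \<in> ball c0 \<epsilon>'" for c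
      proof
        have "c \<in> S" using that by (simp add: S_def)
        then show "qderiv c n0 (w c) = K" using K by (simp add: \<rho>_def)
        have "c \<in> ball c0 \<delta>0" using \<open>c \<in> S\<close> S(1) F(3) by auto
        then show "(quad c ^^ n0) (w c) = w c" by (rule fp)
      qed
    qed
  qed
  have "\<exists>k2. \<forall>k\<ge>k2. X (l + k * n0) \<inter> ball c0 \<epsilon> \<noteq> {}"
  proof (rule ccontr)
    assume "\<nexists>k2. \<forall>k\<ge>k2. X (l + k * n0) \<inter> ball c0 \<epsilon> \<noteq> {}"
    \<comment> \<open>Otherwise infinitely many of the functions \<open>R' / (k R)\<close> have no zero near \<open>c0\<close>.\<close>
    then have "\<exists>k\<ge>K + Suc m. X (l + k * n0) \<inter> ball c0 \<epsilon> = {}" for m by blast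
    then obtain \<kappa> where \<kappa>: "\<And>m. \<kappa> m \<ge> K + Suc m" "\<And>m. X (l + \<kappa> m * n0) \<inter> ball c0 \<epsilon> = {}" by metis
    have \<kappa>K: "\<kappa> m \<ge> K" "\<kappa> m > 0" for m using \<kappa>(1)[of m] by auto
    define G where "G m c = deriv (R (\<kappa> m)) c / (of_nat (\<kappa> m) * R (\<kappa> m) c)" for m c
    have "\<psi> c0 \<noteq> 0"
    proof (rule Hurwitz_no_zeros[of S G \<psi>])
      show "open S" "connected S" "c0 \<in> S" using \<epsilon>' by (simp_all add: S_def)
      show "\<psi> holomorphic_on S" by (rule \<psi>)
      show "\<not> \<psi> constant_on S" by (rule nonconst)
      show "G m holomorphic_on S" for m unfolding G_def[abs_def]
      proof (intro holomorphic_on_divide holomorphic_on_mult holomorphic_on_const holomorphic_deriv)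
        show "R (\<kappa> m) holomorphic_on S" "R (\<kappa> m) holomorphic_on S" using holomorphic_on_subset[OF Rhol[OF \<kappa>K(1)] S(1)] by auto
        show "of_nat (\<kappa> m) * R (\<kappa> m) c \<noteq> 0" if "c \<in> S" for c
          using Rnz[OF \<kappa>K(1)] \<kappa>K(2)[of m] S(1) that by auto
      qed (simp add: S_def)
      show "G m c \<noteq> 0" if c: "c \<in> S" for m c
      proof
        assume "G m c = 0"
        moreover have cd: "c \<in> ball c0 \<delta>" using c S(1) by blast
        ultimately have d: "deriv (R (\<kappa> m)) c = 0" using Rnz[OF \<kappa>K(1) cd, of m] \<kappa>K(2)[of m] by (simp add: G_def)
        have sub: "ball c (\<delta> - dist c0 c) \<subseteq> ball c0 \<delta>"
        proof
          fix x assume "x \<in> ball c (\<delta> - dist c0 c)"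
          then show "x \<in> ball c0 \<delta>" using dist_triangle[of c0 x c] by simp
        qed
        have "c \<in> X (l + \<kappa> m * n0)"
        proof (rule mem_X_I)
          show "0 < \<delta> - dist c0 c" using cd by simp
          show "\<zeta> (\<kappa> m) holomorphic_on ball c (\<delta> - dist c0 c)" by (rule holomorphic_on_subset[OF F(6)[OF \<kappa>K(1)] sub])
          show "periodic_point c' (l + \<kappa> m * n0) (\<zeta> (\<kappa> m) c')" if "c' \<in> ball c (\<delta> - dist c0 c)" for c'
            by (rule F(7)[OF \<kappa>K(1)]) (use that sub in blast)
          show "deriv (\<lambda>c. qderiv c (l + \<kappa> m * n0) (\<zeta> (\<kappa> m) c)) c = 0" using d by (simp add: R_def[abs_def])
        qed
        then show False using \<kappa>(2)[of m] c S(3) by blast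
      qed
      show "uniform_limit C G \<psi> sequentially" if C: "compact C" "C \<subseteq> S" for C
      proof (rule uniform_limitI)
        fix e :: real assume e: "e > 0"
        define Q where "Q = 4 * B2 / (\<delta> * B1)"
        have "(\<lambda>m. \<bar>Q\<bar> * inverse (real (Suc m))) \<longlonglongrightarrow> \<bar>Q\<bar> * 0" by (intro tendsto_intros LIMSEQ_inverse_real_of_nat)
        then have "(\<lambda>m. \<bar>Q\<bar> * inverse (real (Suc m))) \<longlonglongrightarrow> 0" by (simp only: mult_zero_right)
        then have "\<forall>\<^sub>F m in sequentially. \<bar>Q\<bar> * inverse (real (Suc m)) < e" using e by (rule order_tendstoD(2))
        then show "\<forall>\<^sub>F m in sequentially. \<forall>c\<in>C. dist (G m c) (\<psi> c) < e"
        proof eventually_elim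
          case (elim m)
          show ?case
          proof
            fix c assume "c \<in> C"
            then have c: "c \<in> ball c0 (\<delta>/2)" using C(2) S(2) by blast
            have "norm (G m c - \<psi> c) \<le> Q / real (\<kappa> m)"
              unfolding G_def \<psi>_def Q_def
            proof (rule logarithmic_derivative_bound[OF F(2) Rhol[OF \<kappa>K(1)] \<rho> \<rho>nz F(4) \<kappa>K(2) _ _ c])
              show "B1 \<le> norm (R (\<kappa> m) c / \<rho> c ^ \<kappa> m)" if "c \<in> ball c0 \<delta>" for c
                using F(8)[OF \<kappa>K(1) that] by (simp add: R_def \<rho>_def)
              show "norm (R (\<kappa> m) c / \<rho> c ^ \<kappa> m) \<le> B2" if "c \<in> ball c0 \<delta>" for c
                using F(9)[OF \<kappa>K(1) that] by (simp add: R_def \<rho>_def)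
            qed
            also have "\<dots> \<le> \<bar>Q\<bar> / real (Suc m)"
              using \<kappa>(1)[of m] by (intro frac_le) auto
            also have "\<dots> = \<bar>Q\<bar> * inverse (real (Suc m))" by (simp add: divide_inverse)
            finally show "dist (G m c) (\<psi> c) < e" using elim by (simp add: dist_norm)
          qed
        qed
      qed
    qed
    then show False using \<psi>0 by simp
  qed
  then obtain k2 where k2: "\<And>k. k \<ge> k2 \<Longrightarrow> X (l + k * n0) \<inter> ball c0 \<epsilon> \<noteq> {}" by blast
  show ?thesis
  proof (intro exI allI impI)
    fix n assume n: "l + k2 * n0 \<le> n" "n mod n0 = s"
    have "n0 dvd n - l" using n F(1) by (subst mod_eq_dvd_iff_nat[symmetric]) auto
    then obtain k where k: "n - l = n0 * k" by (auto elim: dvdE)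
    then have nk: "n = l + k * n0" using n(1) by (simp add: mult.commute)
    then have "k2 * n0 \<le> k * n0" using n(1) by simp
    then have "k2 \<le> k" using n0 by simp
    then show "X n \<inter> ball c0 \<epsilon> \<noteq> {}" unfolding nk by (rule k2)
  qed
qed

section \<open>Periodic and homoclinic points for escaping parameters\<close>

text \<open>Conjugated to the unit disc by a Riemann map sending \<open>z\<close> to 0, the map sends the disc into
  a disc of radius \<open>s < 1\<close>, because its image lies in a compact subset. The Schwarz lemma applied to the
  conjugate divided by \<open>s\<close> gives contraction by the factor \<open>s\<close>.\<close>

lemma holomorphic_self_map_attracts:
  fixes h :: "complex \<Rightarrow> complex"
  assumes U: "open U" "simply_connected U" "U \<noteq> UNIV" and z: "z \<in> U"
    and h: "h holomorphic_on U" "h ` U \<subseteq> T" and T: "compact T" "T \<subseteq> U" and hz: "h z = z"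
  shows "norm (deriv h z) < 1" "\<And>q. q \<in> U \<Longrightarrow> (\<lambda>j. (h ^^ j) q) \<longlonglongrightarrow> z"
proof -
  obtain F G where FG: "F holomorphic_on U" "G holomorphic_on ball 0 1"
    "\<And>x. x \<in> U \<Longrightarrow> F x \<in> ball 0 1" "\<And>x. x \<in> U \<Longrightarrow> G (F x) = x"
    "\<And>x. x \<in> ball 0 1 \<Longrightarrow> G x \<in> U" "\<And>x. x \<in> ball 0 1 \<Longrightarrow> F (G x) = x"
    using simply_connected_eq_biholomorphic_to_disc[OF U(1)] U(2,3) z by blast
  obtain f g where fg: "f (F z) = 0" "f holomorphic_on ball 0 1" "f ` ball 0 1 \<subseteq> ball 0 1"
    "g holomorphic_on ball 0 1" "g ` ball 0 1 \<subseteq> ball 0 1"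
    "\<And>x. x \<in> ball 0 1 \<Longrightarrow> f (g x) = x" "\<And>x. x \<in> ball 0 1 \<Longrightarrow> g (f x) = x"
    using ball_biholomorphism_exists[OF FG(3)[OF z]] by blast
  define \<phi> \<psi> where "\<phi> x = f (F x)" and "\<psi> x = G (g x)" for x
  have \<phi>D: "\<phi> x \<in> ball 0 1" "\<psi> (\<phi> x) = x" if "x \<in> U" for x
    using fg(3) FG(3)[OF that] fg(7)[OF FG(3)[OF that]] FG(4)[OF that] unfolding \<phi>_def \<psi>_def
    by (blast, simp)
  have \<psi>D: "\<psi> x \<in> U" if "x \<in> ball 0 1" for x
    using fg(5) FG(5) that unfolding \<psi>_def by blast
  have \<phi>: "\<phi> holomorphic_on U"
    using holomorphic_on_compose_gen[OF FG(1) fg(2)] FG(3) unfolding \<phi>_def[abs_def] o_def by blast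
  have \<psi>: "\<psi> holomorphic_on ball 0 1"
    using holomorphic_on_compose_gen[OF fg(4) FG(2)] fg(5) unfolding \<psi>_def[abs_def] o_def by blast
  have \<phi>z: "\<phi> z = 0" using fg(1) by (simp add: \<phi>_def)
  have \<psi>0: "\<psi> 0 = z" using \<phi>D(2)[OF z] \<phi>z by simp
  define H where "H x = \<phi> (h (\<psi> x))" for x
  have hU: "h x \<in> U" if "x \<in> U" for x using h(2) T(2) that by blast
  have Hhol: "H holomorphic_on ball 0 1"
  proof -
    have 1: "(\<lambda>x. h (\<psi> x)) holomorphic_on ball 0 1"
      using holomorphic_on_compose_gen[OF \<psi> h(1)] \<psi>D unfolding o_def by blast
    show ?thesis using holomorphic_on_compose_gen[OF 1 \<phi>] \<psi>D hU unfolding o_def H_def[abs_def] by blast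
  qed
  have H0: "H 0 = 0" by (simp add: H_def \<psi>0 hz \<phi>z)
  have H\<phi>: "H (\<phi> x) = \<phi> (h x)" if "x \<in> U" for x using \<phi>D(2)[OF that] by (simp add: H_def)
  have zT: "z \<in> T" using h(2) hz z by (metis image_subset_iff)
  have "continuous_on T (\<lambda>x. norm (\<phi> x))"
    by (intro continuous_intros holomorphic_on_imp_continuous_on holomorphic_on_subset[OF \<phi> T(2)])
  then obtain x0 where x0: "x0 \<in> T" "\<And>x. x \<in> T \<Longrightarrow> norm (\<phi> x) \<le> norm (\<phi> x0)"
    using continuous_attains_sup[OF T(1)] zT by blast
  \<comment> \<open>Strictly larger than the maximum of \<open>norm \<phi>\<close> on \<open>T\<close>, since the Schwarz lemma asks for a strict
    bound.\<close>
  define s where "s = (1 + norm (\<phi> x0)) / 2"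
  have x01: "norm (\<phi> x0) < 1" using \<phi>D(1)[of x0] x0(1) T(2) by auto
  have s: "0 < s" "s < 1" "norm (\<phi> x0) < s" using x01 by (simp_all add: s_def add_pos_nonneg)
  define K where "K x = H x / complex_of_real s" for x
  have K: "K holomorphic_on ball 0 1" unfolding K_def[abs_def] using s(1) by (intro holomorphic_intros Hhol) auto
  have K0: "K 0 = 0" by (simp add: K_def H0)
  have K1: "norm (K x) < 1" if "norm x < 1" for x
  proof -
    have "\<psi> x \<in> U" by (rule \<psi>D) (use that in simp)
    then have "norm (H x) \<le> norm (\<phi> x0)" unfolding H_def using h(2) by (intro x0(2)) blast
    then show ?thesis using s by (simp add: K_def norm_divide)
  qed
  have Hs: "norm (H x) \<le> s * norm x" if "norm x < 1" for x
    using Schwarz_Lemma(1)[OF K K0 K1 that] s(1) by (simp add: K_def norm_divide field_simps)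
  have "norm (deriv K 0) \<le> 1" by (rule Schwarz_Lemma(2)[OF K K0 K1, of 0]) auto
  moreover have HD: "(H has_field_derivative deriv H 0) (at 0)"
    by (rule holomorphic_derivI[OF Hhol open_ball]) simp
  have "deriv K 0 = deriv H 0 / complex_of_real s"
    unfolding K_def[abs_def] by (rule DERIV_imp_deriv[OF DERIV_cdivide[OF HD]])
  ultimately have dH: "norm (deriv H 0) \<le> s" using s(1) by (simp add: norm_divide)
  have D\<phi>: "(\<phi> has_field_derivative deriv \<phi> z) (at z)" by (rule holomorphic_derivI[OF \<phi> U(1) z])
  have D\<psi>: "(\<psi> has_field_derivative deriv \<psi> 0) (at 0)" by (rule holomorphic_derivI[OF \<psi> open_ball]) simp
  have "((\<lambda>x. \<psi> (\<phi> x)) has_field_derivative deriv \<psi> 0 * deriv \<phi> z) (at z)"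
    by (rule DERIV_chain2[of \<psi>]) (use D\<psi> D\<phi> \<phi>z in auto)
  then have "((\<lambda>x. x) has_field_derivative deriv \<psi> 0 * deriv \<phi> z) (at z)"
    by (rule has_field_derivative_transform_within_open[OF _ U(1) z]) (rule \<phi>D(2))
  then have one: "deriv \<psi> 0 * deriv \<phi> z = 1" using DERIV_unique[OF DERIV_ident] by metis
  have "((\<lambda>x. H (\<phi> x)) has_field_derivative deriv H 0 * deriv \<phi> z) (at z)"
    by (rule DERIV_chain2[of H]) (use HD D\<phi> \<phi>z in auto)
  then have "((\<lambda>x. \<psi> (H (\<phi> x))) has_field_derivative deriv \<psi> 0 * (deriv H 0 * deriv \<phi> z)) (at z)"
    by (intro DERIV_chain2[of \<psi>]) (use D\<psi> \<phi>z H0 in auto)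
  then have "(h has_field_derivative deriv \<psi> 0 * (deriv H 0 * deriv \<phi> z)) (at z)"
    by (rule has_field_derivative_transform_within_open[OF _ U(1) z]) (simp add: H\<phi> \<phi>D(2) hU)
  then have "deriv h z = deriv \<psi> 0 * (deriv H 0 * deriv \<phi> z)" by (rule DERIV_imp_deriv)
  also have "\<dots> = deriv H 0 * (deriv \<psi> 0 * deriv \<phi> z)" by (simp only: mult_ac)
  finally have "deriv h z = deriv H 0" unfolding one by simp
  then show "norm (deriv h z) < 1" using dH s(2) by simp
  fix q assume q: "q \<in> U"
  have it: "(h ^^ j) q \<in> U" for j by (induction j) (use q hU in auto)
  have bd: "norm (\<phi> ((h ^^ j) q)) \<le> s ^ j" for j
  proof (induction j)
    case 0
    then show ?case using \<phi>D(1)[OF q] by simp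
  next
    case (Suc j)
    have "norm (\<phi> ((h ^^ Suc j) q)) = norm (H (\<phi> ((h ^^ j) q)))" using H\<phi>[OF it[of j]] by simp
    also have "\<dots> \<le> s * norm (\<phi> ((h ^^ j) q))" using \<phi>D(1)[OF it[of j]] by (intro Hs) simp
    also have "\<dots> \<le> s * s ^ j" using Suc s(1) by (intro mult_left_mono) auto
    finally show ?case by simp
  qed
  have sj: "(\<lambda>j. s ^ j) \<longlonglongrightarrow> 0" using s by (intro LIMSEQ_power_zero) auto
  have "(\<lambda>j. \<phi> ((h ^^ j) q)) \<longlonglongrightarrow> 0"
    by (rule Lim_null_comparison[OF always_eventually sj]) (use bd in blast)
  moreover have "isCont \<psi> 0" using D\<psi> by (rule DERIV_isCont)
  ultimately have "(\<lambda>j. \<psi> (\<phi> ((h ^^ j) q))) \<longlonglongrightarrow> \<psi> 0" using isCont_tendsto_compose by blast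
  then show "(\<lambda>j. (h ^^ j) q) \<longlonglongrightarrow> z" unfolding \<psi>0 by (simp add: \<phi>D(2)[OF it])
qed

lemma holomorphic_quad_iter: "(quad c ^^ L) holomorphic_on A"
  using holomorphic_on_quad_iter[of "\<lambda>_. c" A "\<lambda>x. x" L] by simp

lemma continuous_quad_iter: "continuous_on A (quad c ^^ L)"
  by (rule holomorphic_on_imp_continuous_on[OF holomorphic_quad_iter])

text \<open>Outside the disc of radius \<open>norm c + 2\<close> the map at least doubles the modulus.\<close>

lemma quad_iter_escape:
  assumes "norm x \<ge> norm c + 2"
  shows "norm ((quad c ^^ k) x) \<ge> 2 ^ k * norm x"
proof (induction k)
  case (Suc k)
  define y where "y = (quad c ^^ k) x"
  have "1 * norm x \<le> 2 ^ k * norm x" by (intro mult_right_mono) auto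
  then have y: "norm y \<ge> norm c + 2" using Suc assms by (simp add: y_def)
  have "(norm c + 2) * norm y \<le> norm y * norm y" using y by (intro mult_right_mono) auto
  moreover have "norm c * 1 \<le> norm c * norm y" using y norm_ge_zero[of c] by (intro mult_left_mono) linarith+
  moreover have "norm (quad c y) \<ge> norm y * norm y - norm c"
    using norm_triangle_ineq2[of "y\<^sup>2" "- c"] by (simp add: quad_def norm_mult power2_eq_square)
  ultimately have "norm (quad c y) \<ge> 2 * norm y" by (simp add: distrib_right)
  then show ?case using Suc by (simp add: y_def)
qed simp

lemma quad_iter_stays_large:
  assumes "norm ((quad c ^^ L) x) \<ge> norm c + 2" "L \<le> M"
  shows "norm ((quad c ^^ M) x) \<ge> norm c + 2"
proof -
  have "1 * norm ((quad c ^^ L) x) \<le> 2 ^ (M - L) * norm ((quad c ^^ L) x)" by (intro mult_right_mono) auto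
  also have "\<dots> \<le> norm ((quad c ^^ (M - L)) ((quad c ^^ L) x))" by (rule quad_iter_escape[OF assms(1)])
  also have "(quad c ^^ (M - L)) ((quad c ^^ L) x) = (quad c ^^ M) x"
    using assms(2) by (metis le_add_diff_inverse quad_iter_add)
  finally show ?thesis using assms(1) by simp
qed

text \<open>A sublevel set of the escape rate: \<open>quad c\<close> maps \<open>level c (Suc L)\<close> onto \<open>level c L\<close>, and the
  Mandelbrot set consists of the parameters that lie in all their own level sets.\<close>

definition level :: "complex \<Rightarrow> nat \<Rightarrow> complex set" where
  "level c L = {x. norm ((quad c ^^ L) x) < norm c + 2}"

lemma open_level: "open (level c L)"
  unfolding level_def by (intro open_Collect_less continuous_intros)

lemma level_subset_ball: "level c L \<subseteq> ball 0 (norm c + 2)"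
proof
  fix x assume x: "x \<in> level c L"
  have "norm x < norm c + 2"
  proof (rule ccontr)
    assume "\<not> norm x < norm c + 2"
    then have "norm ((quad c ^^ L) x) \<ge> norm c + 2" using quad_iter_stays_large[of c 0 x L] by simp
    then show False using x by (simp add: level_def)
  qed
  then show "x \<in> ball 0 (norm c + 2)" by simp
qed

text \<open>The non-strict inequality is what makes the closure of a deeper level set lie inside
  \<open>level c L\<close>.\<close>

lemma in_level_if_le:
  assumes "norm ((quad c ^^ M) x) \<le> norm c + 2" "L < M"
  shows "x \<in> level c L"
proof (rule ccontr)
  assume "x \<notin> level c L"
  then have "norm ((quad c ^^ L) x) \<ge> norm c + 2" by (simp add: level_def)
  then have "norm ((quad c ^^ (M - 1)) x) \<ge> norm c + 2"
    by (rule quad_iter_stays_large) (use assms(2) in simp)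
  from quad_iter_escape[OF this, of 1] have "norm ((quad c ^^ (M - 1 + 1)) x) \<ge> 2 * norm ((quad c ^^ (M - 1)) x)"
    by (simp add: quad_iter_add)
  then have "norm ((quad c ^^ M) x) \<ge> 2 * (norm c + 2)"
    using \<open>norm ((quad c ^^ (M - 1)) x) \<ge> norm c + 2\<close> assms(2) by simp
  then show False using assms(1) norm_ge_zero[of c] by (simp add: distrib_left)
qed

lemma periodic_in_level:
  assumes fp: "(quad c ^^ n) z = z" and n: "n > 0"
  shows "z \<in> level c L"
proof (rule ccontr)
  assume "z \<notin> level c L"
  then have l: "norm ((quad c ^^ L) z) \<ge> norm c + 2" by (simp add: level_def)
  have "2 ^ n * norm ((quad c ^^ L) z) \<le> norm ((quad c ^^ n) ((quad c ^^ L) z))" by (rule quad_iter_escape[OF l])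
  also have "\<dots> = norm ((quad c ^^ L) z)" by (simp add: periodic_orbit_fixed[OF fp])
  finally have "2 ^ n * norm ((quad c ^^ L) z) \<le> norm ((quad c ^^ L) z)" .
  moreover have "(2::real) \<le> 2 ^ n" using n by (intro self_le_power) auto
  then have "2 * norm ((quad c ^^ L) z) \<le> 2 ^ n * norm ((quad c ^^ L) z)" by (intro mult_right_mono) auto
  ultimately show False using l norm_ge_zero[of c] by linarith
qed

lemma critical_value_escapes:
  assumes "c \<notin> Mandelbrot"
  obtains L where "c \<notin> level c L"
proof -
  have "\<not> bounded (range (\<lambda>k. (quad c ^^ k) 0))" using assms by (simp add: Mandelbrot_def)
  then obtain k where k: "norm ((quad c ^^ k) 0) > norm c + 2" unfolding bounded_iff by (auto simp: not_le)
  have "k \<noteq> 0"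
  proof
    assume "k = 0"
    then show False using k norm_ge_zero[of c] by simp
  qed
  then obtain L where "k = Suc L" using not0_implies_Suc by blast
  then have "(quad c ^^ k) 0 = (quad c ^^ L) c" by (simp add: funpow_swap1 quad_def)
  then show thesis using k by (intro that[of L]) (simp add: level_def)
qed

text \<open>By the maximum principle the inside of a loop in a level set stays in the level set.\<close>

lemma simply_connected_level_component:
  "simply_connected (connected_component_set (level c L) v)" (is "simply_connected ?U")
proof -
  have opU: "open ?U" by (intro open_connected_component open_level)
  show ?thesis
    unfolding simply_connected_eq_winding_number_zero[OF opU]
  proof (intro conjI allI impI)
    fix \<gamma> x assume \<gamma>: "path \<gamma> \<and> path_image \<gamma> \<subseteq> ?U \<and> pathfinish \<gamma> = pathstart \<gamma> \<and> x \<notin> ?U"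
    define S where "S = path_image \<gamma>"
    have S: "compact S" "connected S" "S \<noteq> {}" "S \<subseteq> ?U"
      using \<gamma> by (auto simp: S_def compact_path_image connected_path_image)
    have cl: "closed S" using S(1) by (rule compact_imp_closed)
    have SL: "S \<subseteq> level c L" using S(4) connected_component_subset by blast
    have "continuous_on S (\<lambda>x. norm ((quad c ^^ L) x))" by (intro continuous_intros)
    then obtain y where y: "y \<in> S" "\<And>x. x \<in> S \<Longrightarrow> norm ((quad c ^^ L) x) \<le> norm ((quad c ^^ L) y)"
      using continuous_attains_sup[OF S(1,3)] by blast
    have "inside S \<subseteq> level c L"
    proof
      fix \<xi> assume "\<xi> \<in> inside S"
      have "norm ((quad c ^^ L) \<xi>) \<le> norm ((quad c ^^ L) y)"
      proof (rule maximum_modulus_frontier[of "quad c ^^ L" "inside S"])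
        show "(quad c ^^ L) holomorphic_on interior (inside S)" by (rule holomorphic_quad_iter)
        show "continuous_on (closure (inside S)) (quad c ^^ L)" by (rule continuous_quad_iter)
        show "bounded (inside S)" by (rule bounded_inside[OF compact_imp_bounded[OF S(1)]])
        show "norm ((quad c ^^ L) x) \<le> norm ((quad c ^^ L) y)" if "x \<in> frontier (inside S)" for x
          using frontier_inside_subset[OF cl] that by (intro y(2)) blast
      qed fact
      also have "\<dots> < norm c + 2" using y(1) SL by (auto simp: level_def)
      finally show "\<xi> \<in> level c L" by (simp add: level_def)
    qed
    then have "S \<union> inside S \<subseteq> level c L" using SL by blast
    moreover have "connected (S \<union> inside S)" by (rule connected_with_inside[OF cl S(2)])
    moreover have "y \<in> S \<union> inside S" using y(1) by blast
    ultimately have "S \<union> inside S \<subseteq> connected_component_set (level c L) y"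
      by (intro connected_component_maximal)
    moreover have "connected_component_set (level c L) y = ?U"
      using y(1) S(4) by (metis connected_component_eq subsetD)
    ultimately have "inside S \<subseteq> ?U" by blast
    then have "x \<in> outside S" using \<gamma> S(4) inside_Un_outside[of S] by blast
    then show "winding_number \<gamma> x = 0" using \<gamma> by (intro winding_number_zero_in_outside) (auto simp: S_def)
  qed simp
qed

text \<open>Where the critical value is absent, \<open>x - c\<close> has a holomorphic square root on the simply
  connected component; its sign is chosen to match \<open>y\<close>.\<close>

lemma inverse_branch:
  assumes c: "c \<notin> level c L" and y: "quad c y \<in> level c L"
  obtains g where "g holomorphic_on connected_component_set (level c L) (quad c y)" "g (quad c y) = y"
    "\<And>x. x \<in> connected_component_set (level c L) (quad c y) \<Longrightarrow> quad c (g x) = x"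
    "g ` connected_component_set (level c L) (quad c y) \<subseteq> connected_component_set (level c L) y"
proof -
  define V where "V = connected_component_set (level c L) (quad c y)"
  have V: "open V" "simply_connected V" "connected V" "V \<subseteq> level c L" "quad c y \<in> V"
    using y by (simp_all add: V_def open_connected_component open_level simply_connected_level_component
        connected_component_subset connected_component_refl)
  obtain b where b: "b holomorphic_on V" "\<And>x. x \<in> V \<Longrightarrow> x - c = b x ^ 2"
  proof (rule simply_connected_imp_holomorphic_sqrt[of "\<lambda>x. x - c" V])
    show "(\<lambda>x. x - c) holomorphic_on V" by (intro holomorphic_intros)
    show "locally path_connected V" by (rule open_imp_locally_path_connected[OF V(1)])
    show "x - c \<noteq> 0" if "x \<in> V" for x using that V(4) c by auto
  qed (use V(2) that in auto)
  have "(b (quad c y))\<^sup>2 = y\<^sup>2" using b(2)[OF V(5)] by (simp add: quad_def)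
  then have "b (quad c y) = y \<or> b (quad c y) = - y" by (simp add: power2_eq_iff)
  then have "\<exists>\<sigma>. \<sigma>\<^sup>2 = 1 \<and> \<sigma> * b (quad c y) = y"
  proof
    assume "b (quad c y) = y"
    then show ?thesis by (intro exI[of _ 1]) simp
  next
    assume "b (quad c y) = - y"
    then show ?thesis by (intro exI[of _ "-1"]) simp
  qed
  then obtain \<sigma> where \<sigma>: "\<sigma>\<^sup>2 = 1" "\<sigma> * b (quad c y) = y" by blast
  define g where "g x = \<sigma> * b x" for x
  have g: "g holomorphic_on V" unfolding g_def[abs_def] by (intro holomorphic_intros b(1))
  have gy: "g (quad c y) = y" using \<sigma>(2) by (simp add: g_def)
  have qg: "quad c (g x) = x" if "x \<in> V" for x
  proof -
    have "(g x)\<^sup>2 = x - c" using b(2)[OF that] \<sigma>(1) by (simp add: g_def power_mult_distrib)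
    then show ?thesis by (simp add: quad_def)
  qed
  have "g ` V \<subseteq> level c L"
  proof
    fix u assume "u \<in> g ` V"
    then obtain x where x: "x \<in> V" "u = g x" by blast
    have "(quad c ^^ Suc L) u = (quad c ^^ L) x" using qg[OF x(1)] x(2) by (simp add: funpow_swap1)
    moreover have "norm ((quad c ^^ L) x) < norm c + 2" using x(1) V(4) by (auto simp: level_def)
    ultimately show "u \<in> level c L" by (intro in_level_if_le[of "Suc L" c]) auto
  qed
  moreover have "connected (g ` V)"
    by (rule connected_continuous_image[OF holomorphic_on_imp_continuous_on[OF g] V(3)])
  moreover have "y \<in> g ` V" using V(5) gy by (metis image_eqI)
  ultimately have "g ` V \<subseteq> connected_component_set (level c L) y" by (intro connected_component_maximal)
  then show thesis using that[of g] g gy qg by (simp add: V_def)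
qed

lemma iterated_inverse_branch:
  assumes c: "c \<notin> level c L" and z: "(quad c ^^ l) y \<in> level c L"
  shows "\<exists>g. g holomorphic_on connected_component_set (level c L) ((quad c ^^ l) y) \<and> g ((quad c ^^ l) y) = y \<and>
    (\<forall>x\<in>connected_component_set (level c L) ((quad c ^^ l) y). (quad c ^^ l) (g x) = x) \<and>
    g ` connected_component_set (level c L) ((quad c ^^ l) y) \<subseteq> connected_component_set (level c L) y"
  using z
proof (induction l arbitrary: y)
  case 0
  show ?case by (rule exI[of _ "\<lambda>x. x"]) auto
next
  case (Suc l)
  define U where "U = connected_component_set (level c L) ((quad c ^^ Suc l) y)"
  have sw: "(quad c ^^ Suc l) x = (quad c ^^ l) (quad c x)" for x by (simp add: funpow_swap1)
  have "norm ((quad c ^^ L) ((quad c ^^ l) (quad c y))) < norm c + 2"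
    using Suc.prems unfolding sw by (simp add: level_def)
  then have "norm ((quad c ^^ (l + L)) (quad c y)) \<le> norm c + 2" by (simp add: quad_iter_add)
  then have qy: "quad c y \<in> level c L"
  proof (cases "l = 0")
    case True
    then show ?thesis using Suc.prems by simp
  next
    case False
    then show ?thesis using \<open>norm ((quad c ^^ (l + L)) (quad c y)) \<le> norm c + 2\<close> by (intro in_level_if_le[of "l + L" c]) auto
  qed
  have "(quad c ^^ l) (quad c y) \<in> level c L" using Suc.prems unfolding sw .
  from Suc.IH[OF this] obtain g1 where g1: "g1 holomorphic_on U" "g1 ((quad c ^^ Suc l) y) = quad c y"
    "\<And>x. x \<in> U \<Longrightarrow> (quad c ^^ l) (g1 x) = x" "g1 ` U \<subseteq> connected_component_set (level c L) (quad c y)"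
    unfolding U_def sw by blast
  obtain g2 where g2: "g2 holomorphic_on connected_component_set (level c L) (quad c y)" "g2 (quad c y) = y"
    "\<And>x. x \<in> connected_component_set (level c L) (quad c y) \<Longrightarrow> quad c (g2 x) = x"
    "g2 ` connected_component_set (level c L) (quad c y) \<subseteq> connected_component_set (level c L) y"
    by (rule inverse_branch[OF c qy], (rule that; blast))
  have "(\<lambda>x. g2 (g1 x)) holomorphic_on U"
    using holomorphic_on_compose_gen[OF g1(1) g2(1) g1(4)] by (simp add: o_def)
  moreover have "g2 (g1 ((quad c ^^ Suc l) y)) = y" using g1(2) g2(2) by simp
  moreover have "\<forall>x\<in>U. (quad c ^^ Suc l) (g2 (g1 x)) = x"
  proof
    fix x assume x: "x \<in> U"
    then have "g1 x \<in> connected_component_set (level c L) (quad c y)" using g1(4) by blast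
    then have "quad c (g2 (g1 x)) = g1 x" by (rule g2(3))
    then show "(quad c ^^ Suc l) (g2 (g1 x)) = x" unfolding sw using g1(3)[OF x] by simp
  qed
  moreover have "(\<lambda>x. g2 (g1 x)) ` U \<subseteq> connected_component_set (level c L) y" using g1(4) g2(4) by blast
  ultimately show ?case unfolding U_def[symmetric] by blast
qed

text \<open>The iterate maps the component properly to the disc, so its image is open and closed
  there.\<close>

lemma level_component_onto_ball:
  assumes v: "v \<in> level c L" and nz: "qderiv c L v \<noteq> 0"
  shows "ball 0 (norm c + 2) \<subseteq> (quad c ^^ L) ` connected_component_set (level c L) v"
proof -
  define U where "U = connected_component_set (level c L) v"
  define B where "B = ball (0::complex) (norm c + 2)"
  have U: "open U" "connected U" "U \<subseteq> level c L" "v \<in> U"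
    using v by (simp_all add: U_def open_connected_component open_level connected_component_subset connected_component_refl)
  have nc: "\<not> (quad c ^^ L) constant_on U"
  proof
    assume "(quad c ^^ L) constant_on U"
    then obtain a where "\<And>x. x \<in> U \<Longrightarrow> (quad c ^^ L) x = a" by (auto simp: constant_on_def)
    then have "((quad c ^^ L) has_field_derivative 0) (at v)"
      by (intro has_field_derivative_transform_within_open[OF DERIV_const U(1,4)]) simp
    then show False using nz DERIV_unique[OF quad_iter_has_field_derivative] by metis
  qed
  have UB: "(quad c ^^ L) ` U \<subseteq> B" using U(3) by (auto simp: level_def B_def)
  have op: "open ((quad c ^^ L) ` U)"
    by (rule open_mapping_thm[OF holomorphic_quad_iter U(1,2,1) _ nc]) simp
  have "bounded U" using U(3) level_subset_ball bounded_ball bounded_subset by (metis subset_trans)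
  then have cpt: "compact ((quad c ^^ L) ` closure U)"
    by (intro compact_continuous_image continuous_quad_iter) (simp add: compact_closure)
  obtain T where T: "closed T" "U = level c L \<inter> T"
    using closedin_connected_component[of "level c L" v] unfolding U_def[symmetric] closedin_closed by blast
  have clU: "closure U \<subseteq> T" by (rule closure_minimal) (use T in auto)
  have "(quad c ^^ L) ` U = B \<inter> (quad c ^^ L) ` closure U"
  proof
    show "(quad c ^^ L) ` U \<subseteq> B \<inter> (quad c ^^ L) ` closure U" using UB closure_subset by blast
    show "B \<inter> (quad c ^^ L) ` closure U \<subseteq> (quad c ^^ L) ` U"
    proof
      fix u assume u: "u \<in> B \<inter> (quad c ^^ L) ` closure U"
      then obtain x where x: "x \<in> closure U" "u = (quad c ^^ L) x" by blast
      have "x \<in> level c L" using u x(2) by (simp add: level_def B_def)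
      then have "x \<in> U" using x(1) clU T(2) by blast
      then show "u \<in> (quad c ^^ L) ` U" using x(2) by blast
    qed
  qed
  then have "closedin (top_of_set B) ((quad c ^^ L) ` U)"
    using compact_imp_closed[OF cpt] by (auto simp: closedin_closed)
  moreover have "openin (top_of_set B) ((quad c ^^ L) ` U)" using op UB by (meson open_subset)
  moreover have "connected B" by (simp add: B_def)
  ultimately have "(quad c ^^ L) ` U = {} \<or> (quad c ^^ L) ` U = B" unfolding connected_clopen by blast
  then have "(quad c ^^ L) ` U = B" using U(4) by blast
  then show ?thesis by (simp add: U_def B_def)
qed

lemma quad_iter_surj: "\<exists>y. (quad c ^^ m) y = x"
proof (induction m arbitrary: x)
  case (Suc m)
  obtain y where y: "(quad c ^^ m) y = csqrt (x - c)" using Suc by blast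
  then have "(quad c ^^ Suc m) y = x" by (simp add: quad_def)
  then show ?case by blast
qed (rule exI[of _ x for x], simp)

text \<open>The inverse branch \<open>h\<close> of the \<open>n\<close>-th iterate fixing \<open>z\<close> maps the component \<open>U\<close> of \<open>z\<close> into a compact
  part of itself; hence \<open>z\<close> attracts all of \<open>U\<close> under \<open>h\<close>, and it is repelling for \<open>quad c\<close>. A homoclinic
  point is obtained by pulling \<open>z\<close> back, first off the cycle to \<open>- f\<^sup>n\<^sup>-\<^sup>1 z\<close>, then along any backward orbit,
  then into \<open>U\<close>, since \<open>U\<close> is mapped onto the whole disc, and finally towards \<open>z\<close> by powers of \<open>h\<close>.
  Derivatives along these orbits do not vanish because the orbit of the critical point escapes.\<close>

lemma escaping_parameter_homoclinic:
  assumes c: "c \<notin> Mandelbrot" and per: "periodic_point c n z"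
  shows "norm (qderiv c n z) > 1"
    and "\<And>s r. s < n \<Longrightarrow> r > 0 \<Longrightarrow> \<exists>l p. l mod n = s \<and> dist p z < r \<and> (quad c ^^ l) p = z \<and>
        qderiv c l p \<noteq> 0 \<and> (\<forall>b. p \<noteq> (quad c ^^ b) z)"
proof -
  have n: "n > 0" and fp: "(quad c ^^ n) z = z" using per by (auto simp: periodic_point_def)
  obtain L where L: "c \<notin> level c L" using critical_value_escapes[OF c] by blast
  define U where "U = connected_component_set (level c L) z"
  have zL: "z \<in> level c M" for M by (rule periodic_in_level[OF fp n])
  have U: "open U" "simply_connected U" "connected U" "U \<subseteq> level c L" "z \<in> U"
    using zL[of L] by (simp_all add: U_def open_connected_component open_level simply_connected_level_component
        connected_component_subset connected_component_refl)
  have bU: "bounded U" using U(4) level_subset_ball bounded_ball bounded_subset by (metis subset_trans)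
  have UU: "U \<noteq> UNIV" using bU not_bounded_UNIV by auto
  have never0: "(quad c ^^ k) 0 \<noteq> z" for k
  proof
    assume k: "(quad c ^^ k) 0 = z"
    have "(quad c ^^ Suc L) 0 = (quad c ^^ L) c" by (simp add: funpow_swap1 quad_def)
    then have "norm ((quad c ^^ Suc L) 0) \<ge> norm c + 2" using L by (simp add: level_def)
    moreover have "Suc L \<le> k + n * Suc L" using mult_le_mono1[of 1 n "Suc L"] n by simp
    ultimately have "norm ((quad c ^^ (k + n * Suc L)) 0) \<ge> norm c + 2" by (rule quad_iter_stays_large)
    then have "norm z \<ge> norm c + 2" unfolding quad_iter_add k quad_iter_fixed_mult(1)[OF fp] .
    then show False using zL[of 0] by (simp add: level_def)
  qed
  have nz: "qderiv c l p \<noteq> 0" if "(quad c ^^ l) p = z" for l p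
  proof
    assume "qderiv c l p = 0"
    then obtain i where i: "i < l" "(quad c ^^ i) p = 0" by (auto simp: qderiv_def)
    have "(quad c ^^ (i + (l - i))) p = z" using that i(1) by simp
    then have "(quad c ^^ (l - i)) 0 = z" unfolding quad_iter_add i(2) .
    then show False using never0 by blast
  qed
  obtain h where h: "h holomorphic_on U" "h z = z" "\<And>x. x \<in> U \<Longrightarrow> (quad c ^^ n) (h x) = x" "h ` U \<subseteq> U"
    using iterated_inverse_branch[OF L, of n z] zL[of L] unfolding fp U_def by blast
  define T where "T = closure (h ` U)"
  have hS: "norm ((quad c ^^ Suc L) (h x)) \<le> norm c + 2" if x: "x \<in> U" for x
  proof (rule ccontr)
    assume "\<not> norm ((quad c ^^ Suc L) (h x)) \<le> norm c + 2"
    then have "norm ((quad c ^^ Suc L) (h x)) \<ge> norm c + 2" by linarith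
    then have "norm ((quad c ^^ (n + L)) (h x)) \<ge> norm c + 2" by (rule quad_iter_stays_large) (use n in simp)
    then have "norm ((quad c ^^ L) x) \<ge> norm c + 2" unfolding quad_iter_add h(3)[OF x] .
    then show False using x U(4) by (auto simp: level_def)
  qed
  have TL: "T \<subseteq> level c L"
  proof -
    have "closed {x. norm ((quad c ^^ Suc L) x) \<le> norm c + 2}"
      by (intro closed_Collect_le continuous_intros)
    moreover have "h ` U \<subseteq> {x. norm ((quad c ^^ Suc L) x) \<le> norm c + 2}" using hS by blast
    ultimately have "T \<subseteq> {x. norm ((quad c ^^ Suc L) x) \<le> norm c + 2}" unfolding T_def by (rule closure_minimal[rotated])
    then show ?thesis using in_level_if_le[of "Suc L" c _ L] by blast
  qed
  have hUT: "h ` U \<subseteq> T" unfolding T_def by (rule closure_subset)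
  have "connected T" unfolding T_def
    by (intro connected_imp_connected_closure connected_continuous_image[OF holomorphic_on_imp_continuous_on[OF h(1)] U(3)])
  moreover have "z \<in> T" using hUT U(5) h(2) by (metis image_subset_iff)
  ultimately have TU: "T \<subseteq> U" unfolding U_def using TL by (intro connected_component_maximal)
  have cT: "compact T" unfolding T_def compact_closure using bU h(4) bounded_subset by blast
  note attr = holomorphic_self_map_attracts[OF U(1,2) UU U(5) h(1) hUT cT TU h(2)]
  have Dh: "(h has_field_derivative deriv h z) (at z)" by (rule holomorphic_derivI[OF h(1) U(1,5)])
  have "((\<lambda>x. (quad c ^^ n) (h x)) has_field_derivative qderiv c n z * deriv h z) (at z)"
  proof (rule DERIV_chain2[of "quad c ^^ n"])
    show "((quad c ^^ n) has_field_derivative qderiv c n z) (at (h z))"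
      unfolding h(2) by (rule quad_iter_has_field_derivative)
  qed (rule Dh)
  then have "((\<lambda>x. x) has_field_derivative qderiv c n z * deriv h z) (at z)"
    by (rule has_field_derivative_transform_within_open[OF _ U(1,5)]) (rule h(3))
  then have one: "qderiv c n z * deriv h z = 1" using DERIV_unique[OF DERIV_ident] by metis
  show "norm (qderiv c n z) > 1"
  proof (rule ccontr)
    assume "\<not> norm (qderiv c n z) > 1"
    then have "norm (qderiv c n z) * norm (deriv h z) \<le> 1 * norm (deriv h z)" by (intro mult_right_mono) auto
    also have "\<dots> < 1" using attr(1) by simp
    finally show False using one by (metis less_irrefl norm_mult norm_one)
  qed
  fix s :: nat and r :: real assume s: "s < n" and r: "r > 0"
  \<comment> \<open>The number of pull-backs before entering \<open>U\<close>; it makes the total length congruent to \<open>s\<close>.\<close>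
  define m where "m = s + n * Suc L - L"
  have "Suc L \<le> n * Suc L" using n by (cases n) auto
  then have m: "m > 0" "L + m = s + n * Suc L" unfolding m_def by linarith+
  define y1 where "y1 = - (quad c ^^ (n - 1)) z"
  have "quad c y1 = quad c ((quad c ^^ (n - 1)) z)" by (simp add: y1_def quad_def)
  also have "\<dots> = (quad c ^^ Suc (n - 1)) z" by simp
  also have "\<dots> = z" using fp n by (simp del: funpow.simps)
  finally have qy1: "quad c y1 = z" .
  have y1: "y1 \<noteq> (quad c ^^ b) z" for b
  proof
    assume eq: "y1 = (quad c ^^ b) z"
    define b' where "b' = b mod n"
    have b': "b' < n" using n by (simp add: b'_def)
    have "(quad c ^^ b) z = (quad c ^^ (n * (b div n) + b')) z" by (simp add: b'_def)
    then have eq': "y1 = (quad c ^^ b') z" unfolding eq quad_iter_add quad_iter_fixed_mult(1)[OF fp] .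
    have "(quad c ^^ Suc b') z = z" using qy1 eq' by simp
    then have "\<not> Suc b' < n" using per unfolding periodic_point_def by blast
    then have "b' = n - 1" using b' by simp
    then have "(quad c ^^ (n - 1)) z = 0" using eq' by (simp add: y1_def)
    moreover have "(quad c ^^ Suc (n - 1)) z = z" using fp n by (simp del: funpow.simps)
    ultimately have "(quad c ^^ 1) 0 = z" by simp
    then show False using never0 by blast
  qed
  obtain y where y: "(quad c ^^ (m - 1)) y = y1" using quad_iter_surj by blast
  have "(quad c ^^ Suc (m - 1)) y = z" using y qy1 by simp
  then have ym: "(quad c ^^ m) y = z" using m(1) by (simp del: funpow.simps)
  have ycyc: "y \<noteq> (quad c ^^ b) z" for b
  proof
    assume "y = (quad c ^^ b) z"
    then have "y1 = (quad c ^^ (b + (m - 1))) z" using y by (simp add: quad_iter_add)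
    then show False using y1 by blast
  qed
  have "y \<in> level c 0" by (rule in_level_if_le[of m c]) (use ym zL[of 0] m(1) in \<open>auto simp: level_def\<close>)
  then have "y \<in> ball 0 (norm c + 2)" by (simp add: level_def)
  moreover have "qderiv c L z \<noteq> 0"
  proof -
    have "Suc L \<le> n * Suc L" using n by (cases n) auto
    then have "L + (n * Suc L - L) = n * Suc L" by linarith
    moreover have "qderiv c (n * Suc L) z \<noteq> 0" by (rule nz[OF quad_iter_fixed_mult(1)[OF fp]])
    ultimately show ?thesis using qderiv_add[of c L "n * Suc L - L" z] by auto
  qed
  ultimately obtain q where q: "q \<in> U" "(quad c ^^ L) q = y"
    using level_component_onto_ball[OF zL[of L]] unfolding U_def by blast
  have qcyc: "q \<noteq> (quad c ^^ b) z" for b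
  proof
    assume "q = (quad c ^^ b) z"
    then have "y = (quad c ^^ (b + L)) z" using q(2) by (simp add: quad_iter_add)
    then show False using ycyc by blast
  qed
  have "\<forall>\<^sub>F j in sequentially. dist ((h ^^ j) q) z < r" using attr(2)[OF q(1)] r by (rule tendstoD)
  then obtain j where j: "dist ((h ^^ j) q) z < r" using eventually_happens'[OF sequentially_bot] by blast
  have it: "(h ^^ j) q \<in> U \<and> (quad c ^^ (n * j)) ((h ^^ j) q) = q" for j
  proof (induction j)
    case (Suc j)
    have "(quad c ^^ (n * Suc j)) ((h ^^ Suc j) q) = (quad c ^^ (n * j)) ((quad c ^^ n) (h ((h ^^ j) q)))"
      by (simp add: quad_iter_add)
    also have "\<dots> = q" using Suc h(3) by simp
    finally show ?case using Suc h(4) by auto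
  qed (use q in simp)
  define p where "p = (h ^^ j) q"
  have pq: "(quad c ^^ (n * j)) p = q" using it[of j] by (simp add: p_def)
  have pz: "(quad c ^^ (n * j + L + m)) p = z" by (simp add: quad_iter_add pq q(2) ym)
  show "\<exists>l p. l mod n = s \<and> dist p z < r \<and> (quad c ^^ l) p = z \<and> qderiv c l p \<noteq> 0 \<and> (\<forall>b. p \<noteq> (quad c ^^ b) z)"
  proof (intro exI conjI allI)
    have "n * j + L + m = s + n * (j + Suc L)" using m(2) by (simp add: distrib_left)
    then show "(n * j + L + m) mod n = s" using s by (simp only: mod_mult_self2 mod_less)
    show "dist p z < r" using j by (simp add: p_def)
    show "(quad c ^^ (n * j + L + m)) p = z" by (rule pz)
    show "qderiv c (n * j + L + m) p \<noteq> 0" by (rule nz[OF pz])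
    show "p \<noteq> (quad c ^^ b) z" for b
    proof
      assume "p = (quad c ^^ b) z"
      then have "q = (quad c ^^ (b + n * j)) z" using pq by (simp add: quad_iter_add)
      then show False using qcyc by blast
    qed
  qed
qed

section \<open>Lifting through the multiplier map\<close>

text \<open>Properness is used in the form that a sequence whose images converge has a convergent
  subsequence. It makes the fibre over \<open>y\<close> finite, and it forces the points over a small neighbourhood
  of \<open>y\<close> to lie in the disjoint charts chosen around the points of the fibre. Surjectivity comes from
  connectedness of the base.\<close>

lemma proper_local_homeo_covering:
  fixes p :: "'a::metric_space \<Rightarrow> 'b::metric_space"
  assumes cont: "continuous_on Z p" and im: "p ` Z \<subseteq> S" and S: "connected S" and ne: "Z \<noteq> {}"
    and loc: "\<And>x. x \<in> Z \<Longrightarrow> \<exists>N q. x \<in> N \<and> openin (top_of_set Z) N \<and> openin (top_of_set S) (p ` N) \<and> homeomorphism N (p ` N) p q"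
    and proper: "\<And>f y. (\<And>k. f k \<in> Z) \<Longrightarrow> (\<lambda>k. p (f k)) \<longlonglongrightarrow> y \<Longrightarrow> y \<in> S \<Longrightarrow>
        \<exists>x\<in>Z. \<exists>r::nat\<Rightarrow>nat. strict_mono r \<and> (f \<circ> r) \<longlonglongrightarrow> x"
  shows "covering_space Z p S"
proof -
  define P where "P x N q \<longleftrightarrow> x \<in> N \<and> openin (top_of_set Z) N \<and> openin (top_of_set S) (p ` N) \<and> homeomorphism N (p ` N) p q" for x N q
  have "\<forall>x\<in>Z. \<exists>N q. P x N q" using loc unfolding P_def by blast
  then obtain N q where "\<And>x. x \<in> Z \<Longrightarrow> P x (N x) (q x)" by metis
  then have N: "\<And>x. x \<in> Z \<Longrightarrow> x \<in> N x" "\<And>x. x \<in> Z \<Longrightarrow> openin (top_of_set Z) (N x)"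
     "\<And>x. x \<in> Z \<Longrightarrow> openin (top_of_set S) (p ` N x)" "\<And>x. x \<in> Z \<Longrightarrow> homeomorphism (N x) (p ` N x) p (q x)"
    unfolding P_def by simp_all
  have p_lim: "(\<lambda>k. p (f k)) \<longlonglongrightarrow> p x" if "\<And>k. f k \<in> Z" "f \<longlonglongrightarrow> x" "x \<in> Z" for f :: "nat \<Rightarrow> 'a" and x
    using continuous_on_tendsto_compose[OF cont that(2,3)] that(1) by simp
  have proper': "\<exists>x\<in>Z. p x = y \<and> (\<exists>r::nat\<Rightarrow>nat. strict_mono r \<and> (f \<circ> r) \<longlonglongrightarrow> x)"
    if f: "\<And>k. f k \<in> Z" "(\<lambda>k. p (f k)) \<longlonglongrightarrow> y" "y \<in> S" for f y
  proof -
    obtain x r where x: "x \<in> Z" "strict_mono (r::nat\<Rightarrow>nat)" "(f \<circ> r) \<longlonglongrightarrow> x" using proper[OF f] by blast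
    have "(\<lambda>k. p ((f \<circ> r) k)) \<longlonglongrightarrow> p x" by (rule p_lim[OF _ x(3,1)]) (use f(1) in simp)
    moreover have "(\<lambda>k. p ((f \<circ> r) k)) \<longlonglongrightarrow> y" using LIMSEQ_subseq_LIMSEQ[OF f(2) x(2)] by (simp add: o_def)
    ultimately have "p x = y" by (rule LIMSEQ_unique)
    then show ?thesis using x by blast
  qed
  have near: "\<forall>\<^sub>F k in sequentially. f k \<in> U"
    if "openin (top_of_set Z) U" "\<And>k. f k \<in> Z" "f \<longlonglongrightarrow> x" "x \<in> U" for f :: "nat \<Rightarrow> 'a" and x U
  proof -
    from that(1)[unfolded openin_open] obtain V where V: "open V" "U = Z \<inter> V" by (elim exE conjE)
    have "\<forall>\<^sub>F k in sequentially. f k \<in> V" using topological_tendstoD[OF that(3) V(1)] V(2) that(4) by blast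
    then show ?thesis by eventually_elim (use V(2) that(2) in blast)
  qed
  have surj: "p ` Z = S"
  proof -
    have "p ` Z = (\<Union>x\<in>Z. p ` N x)"
    proof
      have "N x \<subseteq> Z" if "x \<in> Z" for x using openin_imp_subset[OF N(2)[OF that]] .
      then show "(\<Union>x\<in>Z. p ` N x) \<subseteq> p ` Z" by blast
    next
      show "p ` Z \<subseteq> (\<Union>x\<in>Z. p ` N x)" using N(1) by blast
    qed
    moreover have "openin (top_of_set S) (\<Union>x\<in>Z. p ` N x)" using N(3) by (intro openin_Union) auto
    ultimately have "openin (top_of_set S) (p ` Z)" by simp
    moreover have "closedin (top_of_set S) (p ` Z)"
      unfolding closedin_limpt
    proof (intro conjI allI impI im)
      fix y assume y: "y islimpt p ` Z \<and> y \<in> S"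
      then obtain g where g: "\<And>k. g k \<in> p ` Z - {y}" "g \<longlonglongrightarrow> y" unfolding islimpt_sequential by blast
      have "\<exists>x\<in>Z. p x = g k" for k using g(1)[of k] by auto
      then obtain f where f: "\<And>k. f k \<in> Z" "\<And>k. p (f k) = g k" by metis
      have "\<exists>x\<in>Z. p x = y \<and> (\<exists>r::nat\<Rightarrow>nat. strict_mono r \<and> (f \<circ> r) \<longlonglongrightarrow> x)"
        by (rule proper'[OF f(1)]) (use g(2) f(2) y in simp_all)
      then show "y \<in> p ` Z" by blast
    qed
    ultimately have "p ` Z = {} \<or> p ` Z = S" using S[unfolded connected_clopen, rule_format, of "p ` Z"] by simp
    then show ?thesis using ne by simp
  qed
  show ?thesis
  proof (rule covering_spaceI[OF cont surj])
    fix y assume y: "y \<in> S"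
    define F where "F = {x \<in> Z. p x = y}"
    have "finite F"
    proof (rule ccontr)
      assume "infinite F"
      then obtain f :: "nat \<Rightarrow> 'a" where f: "inj f" "range f \<subseteq> F" using infinite_countable_subset by blast
      have fZ: "f k \<in> Z" "p (f k) = y" for k using f(2) by (auto simp: F_def)
      then obtain x r where x: "x \<in> Z" "strict_mono (r::nat\<Rightarrow>nat)" "(f \<circ> r) \<longlonglongrightarrow> x"
        using proper[of f y] y by auto
      have "\<forall>\<^sub>F k in sequentially. (f \<circ> r) k \<in> N x" by (rule near[OF N(2) _ x(3)]) (use x fZ N(1) in auto)
      then obtain K where K: "\<And>k. k \<ge> K \<Longrightarrow> f (r k) \<in> N x" by (auto simp: eventually_sequentially)
      have "q x (p (f (r k))) = f (r k)" if "k \<ge> K" for k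
        using homeomorphism_apply1[OF N(4)[OF x(1)] K[OF that]] .
      from this[of K] this[of "Suc K"] have "f (r K) = f (r (Suc K))" using fZ(2) by simp
      then have "r K = r (Suc K)" using f(1) by (simp add: inj_eq)
      moreover have "r K < r (Suc K)" using x(2) by (simp add: strict_mono_Suc_iff)
      ultimately show False by simp
    qed
    obtain e where e: "e > 0" "\<And>x x'. x \<in> F \<Longrightarrow> x' \<in> F \<Longrightarrow> x \<noteq> x' \<Longrightarrow> e \<le> dist x x'"
    proof -
      define Dd where "Dd = (\<lambda>(x,x'). dist x x') ` {(x,x'). x \<in> F \<and> x' \<in> F \<and> x \<noteq> x'}"
      have "finite {(x,x'). x \<in> F \<and> x' \<in> F \<and> x \<noteq> x'}"
        by (rule finite_subset[of _ "F \<times> F"]) (use \<open>finite F\<close> in auto)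
      then have fD: "finite (insert 1 Dd)" by (simp add: Dd_def)
      have "Min (insert 1 Dd) > 0" using fD by (subst Min_gr_iff) (auto simp: Dd_def)
      moreover have "Min (insert 1 Dd) \<le> dist x x'" if "x \<in> F" "x' \<in> F" "x \<noteq> x'" for x x'
        by (rule Min_le[OF fD]) (use that in \<open>auto simp: Dd_def\<close>)
      ultimately show ?thesis using that by blast
    qed
    \<comment> \<open>\<open>e\<close> is a lower bound for the distances in the fibre, so these charts are disjoint.\<close>
    define M where "M x = N x \<inter> ball x (e/2)" for x
    have FZ: "x \<in> Z" if "x \<in> F" for x using that by (simp add: F_def)
    have M: "x \<in> M x" "openin (top_of_set Z) (M x)" "openin (top_of_set S) (p ` M x)" "M x \<subseteq> N x" if "x \<in> F" for x
    proof -
      show "x \<in> M x" "M x \<subseteq> N x" using N(1)[OF FZ[OF that]] e(1) by (auto simp: M_def)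
      show "openin (top_of_set Z) (M x)" unfolding M_def using N(2)[OF FZ[OF that]] by (intro openin_Int_open) auto
      have "openin (top_of_set (N x)) (M x)" unfolding M_def by (intro openin_Int_open) auto
      then have "openin (top_of_set (p ` N x)) (p ` M x)"
        using homeomorphism_imp_open_map[OF N(4)[OF FZ[OF that]]] by blast
      then show "openin (top_of_set S) (p ` M x)" using N(3)[OF FZ[OF that]] openin_trans by blast
    qed
    have "\<exists>d>0. \<forall>z\<in>Z. dist (p z) y < d \<longrightarrow> (\<exists>x\<in>F. z \<in> M x)"
    proof (rule ccontr)
      assume *: "\<not> ?thesis"
      have "\<exists>z. z \<in> Z \<and> dist (p z) y < inverse (real (Suc k)) \<and> (\<forall>x\<in>F. z \<notin> M x)" for k
      proof -
        have "inverse (real (Suc k)) > 0" by simp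
        then show ?thesis using * by blast
      qed
      then obtain f where f: "\<And>k. f k \<in> Z" "\<And>k. dist (p (f k)) y < inverse (real (Suc k))" "\<And>k x. x \<in> F \<Longrightarrow> f k \<notin> M x"
        by metis
      have "(\<lambda>k. dist (p (f k)) y) \<longlonglongrightarrow> 0"
        by (rule tendsto_sandwich[OF _ _ tendsto_const LIMSEQ_inverse_real_of_nat]) (use f(2) in \<open>auto intro!: always_eventually less_imp_le\<close>)
      then have "(\<lambda>k. p (f k)) \<longlonglongrightarrow> y" by (rule tendsto_dist_iff[THEN iffD2])
      then obtain x r where x: "x \<in> Z" "p x = y" "strict_mono (r::nat\<Rightarrow>nat)" "(f \<circ> r) \<longlonglongrightarrow> x"
        using proper'[of f y, OF f(1) _ y] by blast
      have xF: "x \<in> F" using x by (simp add: F_def)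
      have "\<forall>\<^sub>F k in sequentially. (f \<circ> r) k \<in> M x" by (rule near[OF M(2)[OF xF] _ x(4) M(1)[OF xF]]) (use f in auto)
      then obtain k where "f (r k) \<in> M x" using eventually_happens'[OF sequentially_bot] by auto
      then show False using f(3)[OF xF] by blast
    qed
    then obtain d where d: "d > 0" "\<And>z. z \<in> Z \<Longrightarrow> dist (p z) y < d \<Longrightarrow> \<exists>x\<in>F. z \<in> M x" by blast
    define T where "T = \<Inter> (insert (S \<inter> ball y d) ((\<lambda>x. p ` M x) ` F))"
    have T: "openin (top_of_set S) T" unfolding T_def
      using \<open>finite F\<close> M(3) by (intro openin_Inter) (auto intro: openin_open_Int)
    have yT: "y \<in> T" using y d(1) M(1) by (auto simp: T_def F_def)
    have TM: "T \<subseteq> p ` M x" if "x \<in> F" for x using that by (auto simp: T_def)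
    have TS: "T \<subseteq> S \<inter> ball y d" by (auto simp: T_def)
    define v where "v = (\<lambda>x. M x \<inter> p -` T) ` F"
    have v1: "\<Union> v = Z \<inter> p -` T"
    proof
      have "M x \<subseteq> Z" if "x \<in> F" for x using openin_imp_subset[OF M(2)[OF that]] .
      then show "\<Union> v \<subseteq> Z \<inter> p -` T" unfolding v_def by blast
      show "Z \<inter> p -` T \<subseteq> \<Union> v"
      proof
        fix z assume z: "z \<in> Z \<inter> p -` T"
        then have "dist (p z) y < d" using TS by (auto simp: dist_commute)
        then obtain x where "x \<in> F" "z \<in> M x" using d(2) z by blast
        then show "z \<in> \<Union> v" using z unfolding v_def by blast
      qed
    qed
    have v2: "openin (top_of_set Z) u" if "u \<in> v" for u
    proof -
      obtain x where x: "x \<in> F" "u = M x \<inter> p -` T" using \<open>u \<in> v\<close> by (auto simp: v_def)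
      have "openin (top_of_set Z) (Z \<inter> p -` T)"
        by (rule continuous_openin_preimage[OF cont _ T]) (use im in auto)
      moreover have "u = M x \<inter> (Z \<inter> p -` T)" using x openin_imp_subset[OF M(2)[OF x(1)]] by blast
      ultimately show ?thesis using M(2)[OF x(1)] by auto
    qed
    have v3: "pairwise disjnt v"
    proof -
      have "disjnt (M x) (M x')" if "x \<in> F" "x' \<in> F" "x \<noteq> x'" for x x'
      proof -
        have False if "z \<in> M x" "z \<in> M x'" for z
        proof -
          have "dist x z < e/2" "dist x' z < e/2" using that by (auto simp: M_def)
          then have "dist x x' < e" using dist_triangle2[of x x' z] by linarith
          then show False using e(2)[OF \<open>x \<in> F\<close> \<open>x' \<in> F\<close> \<open>x \<noteq> x'\<close>] by linarith
        qed
        then show ?thesis by (auto simp: disjnt_def)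
      qed
      then show ?thesis unfolding v_def pairwise_def disjnt_def by blast
    qed
    have v4: "\<exists>q'. homeomorphism u T p q'" if "u \<in> v" for u
    proof -
      obtain x where x: "x \<in> F" "u = M x \<inter> p -` T" using \<open>u \<in> v\<close> by (auto simp: v_def)
      have "p ` u = T" using TM[OF x(1)] x(2) by blast
      moreover have "u \<subseteq> N x" using M(4) x by blast
      ultimately have "homeomorphism u T p (q x)"
        using homeomorphism_of_subsets[OF N(4)[OF FZ[OF x(1)]]] by blast
      then show ?thesis by blast
    qed
    show "\<exists>T. y \<in> T \<and> openin (top_of_set S) T \<and> (\<exists>v. \<Union> v = Z \<inter> p -` T \<and>
        (\<forall>u\<in>v. openin (top_of_set Z) u) \<and> pairwise disjnt v \<and> (\<forall>u\<in>v. \<exists>q. homeomorphism u T p q))"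
      by (intro exI[of _ T] exI[of _ v] conjI ballI yT T v1 v2 v3 v4)
  qed
qed

text \<open>The special case of Hadamard factorisation for order one without zeros. The upper bound on
  the real part of the logarithm becomes a linear bound on its modulus by the argument of Borel
  and Caratheodory: \<open>\<mu> / (2 M - \<mu>)\<close> maps a disc into the unit disc, and Schwarz's lemma applies.\<close>

lemma zero_free_exponential:
  fixes f :: "complex \<Rightarrow> complex"
  assumes hol: "f holomorphic_on UNIV" and nz: "\<And>t. f t \<noteq> 0"
    and bd: "\<And>t. norm (f t) \<le> exp (A + B * norm t)" and B: "B \<ge> 0"
  obtains \<alpha> \<beta> where "\<And>t. f t = exp (\<alpha> + \<beta> * t)"
proof -
  obtain \<kappa> where \<kappa>: "\<kappa> holomorphic_on UNIV" "\<And>t. f t = exp (\<kappa> t)"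
    by (rule contractible_imp_holomorphic_log[OF hol contractible_UNIV nz]) simp
  define \<mu> where "\<mu> t = \<kappa> t - \<kappa> 0" for t
  have \<mu>: "\<mu> holomorphic_on UNIV" "\<mu> 0 = 0" unfolding \<mu>_def[abs_def] by (auto intro!: holomorphic_intros \<kappa>)
  define A' where "A' = \<bar>A\<bar> + norm (\<kappa> 0)"
  have Re_le: "Re (\<mu> t) \<le> A' + B * norm t" for t
  proof -
    have "exp (Re (\<kappa> t)) \<le> exp (A + B * norm t)" using bd[of t] \<kappa>(2) by simp
    then have "Re (\<kappa> t) \<le> A + B * norm t" by simp
    moreover have "- Re (\<kappa> 0) \<le> norm (\<kappa> 0)" using abs_Re_le_cmod[of "\<kappa> 0"] by linarith
    ultimately show ?thesis by (simp add: \<mu>_def A'_def)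
  qed
  have lin: "norm (\<mu> t) \<le> (2 * A' + 2 + 4 * B) * norm t ^ 1" if t: "1 \<le> norm t" for t
  proof -
    define r where "r = norm t"
    define M where "M = A' + B * (2 * r) + 1"
    have r: "r \<ge> 1" using t by (simp add: r_def)
    have M: "M > 0" using B r by (auto simp: M_def A'_def intro!: add_nonneg_pos add_nonneg_nonneg)
    have ReM: "Re (\<mu> z) < M" if "norm z < 2 * r" for z
    proof -
      have "B * norm z \<le> B * (2 * r)" using B that by (intro mult_left_mono) auto
      then show ?thesis using Re_le[of z] by (simp add: M_def)
    qed
    have lt: "norm (\<mu> z) < norm (2 * M - \<mu> z)" if "norm z < 2 * r" for z
    proof -
      have "(norm (2 * M - \<mu> z))\<^sup>2 - (norm (\<mu> z))\<^sup>2 = 4 * M * (M - Re (\<mu> z))"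
        unfolding cmod_power2 by (simp add: power2_eq_square algebra_simps)
      also have "\<dots> > 0" using M ReM[OF that] by simp
      finally show ?thesis by (simp add: power2_less_imp_less)
    qed
    define G where "G x = \<mu> (2 * complex_of_real r * x) / (2 * M - \<mu> (2 * complex_of_real r * x))" for x
    have in2r: "norm (2 * complex_of_real r * x) < 2 * r" if "norm x < 1" for x :: complex
      using that r by (simp add: norm_mult)
    have ne: "2 * M - \<mu> (2 * complex_of_real r * x) \<noteq> 0" if "norm x < 1" for x
      using lt[OF in2r[OF that]] by (metis norm_ge_zero norm_zero not_less)
    have hol\<mu>: "(\<lambda>x. \<mu> (2 * complex_of_real r * x)) holomorphic_on ball 0 1"
      by (rule holomorphic_on_compose_gen[OF _ \<mu>(1), unfolded o_def]) (auto intro!: holomorphic_intros)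
    have "norm (G (t / (2 * r))) \<le> norm (t / (2 * r))"
    proof (rule Schwarz_Lemma)
      show "G holomorphic_on ball 0 1"
        unfolding G_def[abs_def] by (intro holomorphic_intros hol\<mu>) (use ne in auto)
      show "norm (G z) < 1" if "norm z < 1" for z
        using lt[OF in2r[OF that]] ne[OF that] by (simp add: G_def norm_divide divide_simps)
      show "norm (t / (2 * r)) < 1" using r by (simp add: r_def norm_divide)
    qed (simp add: G_def \<mu>(2))
    also have "\<dots> = 1/2" using r t by (auto simp: norm_divide r_def)
    also have "G (t / (2 * r)) = \<mu> t / (2 * M - \<mu> t)" using r by (simp add: G_def)
    finally have "norm (\<mu> t) / norm (2 * M - \<mu> t) \<le> 1/2" by (simp add: norm_divide)
    moreover have "norm (2 * M - \<mu> t) > 0" using lt[of t] r by (smt (verit) norm_ge_zero r_def)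
    ultimately have "norm (\<mu> t) \<le> norm (2 * M - \<mu> t) / 2" by (simp add: field_simps)
    also have "\<dots> \<le> (2 * M + norm (\<mu> t)) / 2"
      using norm_triangle_ineq4[of "2 * M" "\<mu> t"] M by (simp add: norm_mult)
    finally have "norm (\<mu> t) \<le> 2 * M" by simp
    also have "\<dots> = 2 * A' + 2 + 4 * B * r" by (simp add: M_def)
    also have "\<dots> \<le> (2 * A' + 2 + 4 * B) * r"
      using mult_left_mono[OF r, of "2 * A' + 2"] by (simp add: A'_def algebra_simps)
    finally show ?thesis by (simp add: r_def)
  qed
  have "\<mu> t = (\<Sum>k\<le>1. (deriv ^^ k) \<mu> 0 / fact k * t ^ k)" for t
    by (rule Liouville_polynomial[OF \<mu>(1) lin])
  then have "\<mu> t = deriv \<mu> 0 * t" for t using \<mu>(2) by simp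
  then have "\<kappa> t = \<kappa> 0 + deriv \<mu> 0 * t" for t by (metis \<mu>_def add.commute diff_add_cancel)
  then have "f t = exp (\<kappa> 0 + deriv \<mu> 0 * t)" for t unfolding \<kappa>(2) by (rule arg_cong)
  then show thesis by (rule that)
qed

text \<open>The derivative is \<open>exp (\<alpha> + \<beta> t)\<close>. Boundedness on the imaginary axis makes \<open>\<beta>\<close> real, the
  upper bound gives \<open>\<beta> \<le> 2\<close>, and the lower bound excludes \<open>\<beta> < 2\<close>.\<close>

lemma entire_exponential_growth:
  fixes C :: "complex \<Rightarrow> complex"
  assumes hol: "C holomorphic_on UNIV" and nz: "\<And>t. deriv C t \<noteq> 0"
    and up: "\<And>t. norm (C t) \<le> K * exp (2 * max 0 (Re t))"
    and K: "K > 0" and k: "k > 0"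
    and low: "\<And>t. Re t \<ge> T \<Longrightarrow> k * exp (2 * Re t) \<le> norm (C t)"
  obtains a b where "a \<noteq> 0" "\<And>t. C t = b + a * exp (2 * t)"
proof -
  have dC: "(C has_field_derivative deriv C t) (at t)" for t
    using hol holomorphic_derivI[of C UNIV t] by simp
  have dbound: "norm (deriv C t) \<le> K * exp 2 * exp (2 * max 0 (Re t))" for t
  proof -
    have "norm ((deriv ^^ 1) C t) \<le> fact 1 * (K * exp 2 * exp (2 * max 0 (Re t))) / 1 ^ 1"
    proof (rule Cauchy_inequality)
      fix x assume "norm (t - x) = 1"
      then have "\<bar>Re t - Re x\<bar> \<le> 1" using abs_Re_le_cmod[of "t - x"] by simp
      then have "max 0 (Re x) \<le> 1 + max 0 (Re t)" by simp
      then have "exp (2 * max 0 (Re x)) \<le> exp (2 + 2 * max 0 (Re t))" by simp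
      then have "K * exp (2 * max 0 (Re x)) \<le> K * exp (2 + 2 * max 0 (Re t))" using K by (intro mult_left_mono) auto
      then show "norm (C x) \<le> K * exp 2 * exp (2 * max 0 (Re t))" using up[of x] by (simp add: exp_add)
    next
      show "C holomorphic_on ball t 1" using hol by (rule holomorphic_on_subset) simp
      show "continuous_on (cball t 1) C" using holomorphic_on_imp_continuous_on[OF hol] by (rule continuous_on_subset) simp
    qed simp
    then show ?thesis by simp
  qed
  obtain \<alpha> \<beta> where ab: "\<And>t. deriv C t = exp (\<alpha> + \<beta> * t)"
  proof (rule zero_free_exponential[of "deriv C" "ln K + 2" 2])
    fix t
    have "K * exp 2 * exp (2 * max 0 (Re t)) = exp (ln K + 2 + 2 * max 0 (Re t))" using K by (simp add: exp_add)
    also have "\<dots> \<le> exp (ln K + 2 + 2 * norm t)" using complex_Re_le_cmod[of t] by simp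
    finally show "norm (deriv C t) \<le> exp (ln K + 2 + 2 * norm t)" using dbound[of t] by linarith
  qed (use nz hol in \<open>auto intro!: holomorphic_deriv\<close>)
  have nb: "exp (Re \<alpha> + Re (\<beta> * t)) \<le> exp (ln K + 2 + 2 * max 0 (Re t))" for t
  proof -
    have "norm (deriv C t) = exp (Re \<alpha> + Re (\<beta> * t))" by (simp add: ab)
    moreover have "K * exp 2 * exp (2 * max 0 (Re t)) = exp (ln K + 2 + 2 * max 0 (Re t))" using K by (simp add: exp_add)
    ultimately show ?thesis using dbound[of t] by linarith
  qed
  then have lb: "Re (\<beta> * t) \<le> ln K + 2 - Re \<alpha> + 2 * max 0 (Re t)" for t
    by (metis add.commute exp_le_cancel_iff le_diff_eq add_diff_eq diff_add_eq)
  define L where "L = \<bar>ln K + 2 - Re \<alpha>\<bar> + 1"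
  have L: "L > 0" "ln K + 2 - Re \<alpha> < L" by (auto simp: L_def)
  have im: "Im \<beta> = 0"
  proof (rule ccontr)
    assume n: "Im \<beta> \<noteq> 0"
    have "Re (\<beta> * (\<i> * complex_of_real (- L / Im \<beta>))) = L" using n by simp
    then show False using lb[of "\<i> * complex_of_real (- L / Im \<beta>)"] L by simp
  qed
  have re2: "Re \<beta> \<le> 2"
  proof (rule ccontr)
    assume n: "\<not> Re \<beta> \<le> 2"
    have *: "Re \<beta> * x \<le> ln K + 2 - Re \<alpha> + 2 * x" if "x \<ge> 0" for x
      using lb[of "of_real x"] im that by simp
    have "Re \<beta> * (L / (Re \<beta> - 2)) - 2 * (L / (Re \<beta> - 2)) = (Re \<beta> - 2) * (L / (Re \<beta> - 2))"
      by (simp only: left_diff_distrib)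
    also have "\<dots> = L" using n by simp
    finally have "Re \<beta> * (L / (Re \<beta> - 2)) - 2 * (L / (Re \<beta> - 2)) = L" .
    then show False using *[of "L / (Re \<beta> - 2)"] L n by simp
  qed
  have re2': "\<not> Re \<beta> < 2"
  proof
    assume n: "Re \<beta> < 2"
    define b where "b = max 0 (Re \<beta>)"
    have b: "0 \<le> b" "b < 2" "Re \<beta> \<le> b" using n by (auto simp: b_def)
    have grow: "norm (C (of_real x)) \<le> norm (C 0) + exp (Re \<alpha>) * exp (b * x) * x" if x: "x \<ge> 0" for x
    proof -
      have "norm (C (of_real x) - C 0) \<le> exp (Re \<alpha>) * exp (b * x) * norm (of_real x - (0::complex))"
      proof (rule field_differentiable_bound[OF convex_closed_segment, where f' = "deriv C"])
        fix z assume "z \<in> closed_segment 0 (complex_of_real x)"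
        then obtain u where u: "0 \<le> u" "u \<le> 1" "z = u * x" by (auto simp: in_segment scaleR_conv_of_real)
        have "Re \<beta> * (u * x) \<le> b * (u * x)" using b u x by (intro mult_right_mono) auto
        also have "\<dots> \<le> b * x" using b u x by (intro mult_left_mono) (auto simp: mult_left_le_one_le)
        finally show "norm (deriv C z) \<le> exp (Re \<alpha>) * exp (b * x)" using u(3) im by (simp add: ab exp_add[symmetric])
      next
        fix z show "(C has_field_derivative deriv C z) (at z within closed_segment 0 (complex_of_real x))"
          by (rule DERIV_subset[OF dC]) simp
      qed auto
      then show ?thesis using norm_triangle_ineq2[of "C (of_real x)" "C 0"] x by simp
    qed
    have ev: "\<forall>\<^sub>F x in at_top. norm (C 0) + exp (Re \<alpha>) * exp (b * x) * x < k * exp (2 * x)"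
    proof -
      have "((\<lambda>x. norm (C 0) / exp (2 * x) + exp (Re \<alpha>) * (x / exp ((2 - b) * x))) \<longlongrightarrow> 0 + exp (Re \<alpha>) * 0) at_top"
      proof (intro tendsto_intros)
        show "((\<lambda>x. norm (C 0) / exp (2 * x)) \<longlongrightarrow> 0) at_top"
          by (rule real_tendsto_divide_at_top[OF tendsto_const]) real_asymp
        show "((\<lambda>x. x / exp ((2 - b) * x)) \<longlongrightarrow> 0) at_top" using b(2) by real_asymp
      qed
      then have "\<forall>\<^sub>F x in at_top. norm (C 0) / exp (2 * x) + exp (Re \<alpha>) * (x / exp ((2 - b) * x)) < k"
        using k by (auto dest: order_tendstoD)
      then show ?thesis
      proof eventually_elim
        case (elim x)
        define P Q where "P = exp ((2 - b) * x)" and "Q = exp (b * x)"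
        have PQ: "P > 0" "Q > 0" "exp (2 * x) = P * Q" by (simp_all add: P_def Q_def exp_add[symmetric] algebra_simps)
        have "(norm (C 0) / (P * Q) + exp (Re \<alpha>) * (x / P)) * (P * Q) < k * (P * Q)"
          using elim PQ unfolding P_def[symmetric] PQ(3) by (intro mult_strict_right_mono) auto
        also have "(norm (C 0) / (P * Q) + exp (Re \<alpha>) * (x / P)) * (P * Q) = norm (C 0) + exp (Re \<alpha>) * Q * x"
          using PQ(1,2) by (simp add: field_simps)
        finally show ?case unfolding PQ(3) Q_def .
      qed
    qed
    have "\<forall>\<^sub>F x in at_top. max 0 T \<le> x \<and> norm (C 0) + exp (Re \<alpha>) * exp (b * x) * x < k * exp (2 * x)"
      using ev eventually_ge_at_top[of "max 0 T"] by eventually_elim simp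
    then obtain x where x: "max 0 T \<le> x" "norm (C 0) + exp (Re \<alpha>) * exp (b * x) * x < k * exp (2 * x)"
      using eventually_happens'[of at_top] by (metis (mono_tags, lifting) trivial_limit_at_top_linorder)
    then show False using grow[of x] low[of "of_real x"] by simp
  qed
  have \<beta>: "\<beta> = 2" using im re2 re2' by (simp add: complex_eq_iff)
  define a where "a = exp \<alpha> / 2"
  have "((\<lambda>t. C t - a * exp (2 * t)) has_field_derivative 0) (at t)" for t
    by (auto intro!: derivative_eq_intros dC simp: ab \<beta> a_def exp_add)
  then have "\<exists>b. \<forall>t\<in>UNIV. C t - a * exp (2 * t) = b"
    by (intro has_field_derivative_zero_constant) auto
  then obtain b where "\<And>t. C t - a * exp (2 * t) = b" by blast
  then have "C t = b + a * exp (2 * t)" for t by (metis add.commute diff_add_cancel)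
  then show thesis using that[of a b] by (simp add: a_def)
qed

text \<open>For \<open>c = - u\<^sup>2\<close> the composition of real branches \<open>\<plusminus> sqrt (u\<^sup>2 + x)\<close> prescribed by the
  itinerary \<open>+ ... + -\<close> maps \<open>[-2u, 2u]\<close> into itself, so it has a fixed point by the intermediate value
  theorem. The period is exact because the sign \<open>-\<close> occurs only once in the itinerary.\<close>

lemma exists_real_cycle:
  fixes u :: real
  assumes n: "n \<ge> 2" and u: "u \<ge> 3"
  defines "c \<equiv> complex_of_real (- u\<^sup>2)"
  obtains z where "periodic_point c n z"
    "\<And>i. i < n - 1 \<Longrightarrow> \<exists>x>0. (quad c ^^ i) z = complex_of_real x"
    "\<exists>x<0. (quad c ^^ (n - 1)) z = complex_of_real x"
proof -
  define s where "s x = sqrt (u\<^sup>2 + x)" for x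
  define I where "I = {-2 * u..2 * u}"
  have s: "0 < s x" "s x \<le> 2 * u" "(s x)\<^sup>2 = u\<^sup>2 + x" if "x \<in> I" for x
  proof -
    have "3 * u \<le> u * u" using u by (intro mult_right_mono) auto
    moreover have "-2 * u \<le> x" "x \<le> 2 * u" using that by (auto simp: I_def)
    ultimately have pos: "u\<^sup>2 + x > 0" and le: "u\<^sup>2 + x \<le> (2 * u)\<^sup>2" using u unfolding power2_eq_square by linarith+
    show "0 < s x" "(s x)\<^sup>2 = u\<^sup>2 + x" using pos by (auto simp: s_def)
    show "s x \<le> 2 * u" unfolding s_def using le u by (intro real_le_lsqrt) auto
  qed
  have sI: "s x \<in> I" "- s x \<in> I" if "x \<in> I" for x using s[OF that] by (auto simp: I_def)
  have sk: "(s ^^ k) x \<in> I" if "x \<in> I" for k x by (induction k) (use that sI in auto)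
  have conts1: "continuous_on A s" for A unfolding s_def[abs_def] by (intro continuous_intros)
  have conts: "continuous_on UNIV (s ^^ k)" for k
  proof (induction k)
    case (Suc k)
    show ?case unfolding funpow.simps by (rule continuous_on_compose[OF Suc conts1])
  qed (simp add: id_def)
  define T where "T x = (s ^^ (n - 1)) (- s x)" for x
  have "continuous_on UNIV (\<lambda>x. (s ^^ (n - 1)) (- s x))"
    by (rule continuous_on_compose2[OF conts]) (auto intro!: continuous_intros conts1)
  then have contT: "continuous_on {-2*u..2*u} T" unfolding T_def[abs_def] by (rule continuous_on_subset) simp
  have TI: "T x \<in> I" if "x \<in> I" for x unfolding T_def by (intro sk sI that)
  have "\<exists>x\<ge>-2*u. x \<le> 2*u \<and> x - T x = 0"
  proof (rule IVT')
    show "-2*u - T (-2*u) \<le> 0" "0 \<le> 2*u - T (2*u)" "-2*u \<le> 2*u"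
      using TI[of "-2*u"] TI[of "2*u"] u by (auto simp: I_def)
    show "continuous_on {-2*u..2*u} (\<lambda>x. x - T x)" by (intro continuous_intros contT)
  qed
  then obtain x where x: "x \<in> I" "T x = x" by (auto simp: I_def)
  have step: "quad c (complex_of_real (s y)) = complex_of_real y" if "y \<in> I" for y
  proof -
    have "complex_of_real ((s y)\<^sup>2) = complex_of_real (u\<^sup>2 + y)" using s(3)[OF that] by simp
    then show ?thesis by (simp add: quad_def c_def)
  qed
  have orbit: "(quad c ^^ k) (complex_of_real x) = complex_of_real ((s ^^ (n - 1 - k)) (- s x))" if "k \<le> n - 1" for k
    using that
  proof (induction k)
    case 0
    then show ?case using x(2) by (simp add: T_def)
  next
    case (Suc k)
    have "n - 1 - k = Suc (n - 1 - Suc k)" using Suc.prems by simp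
    then have "(quad c ^^ k) (complex_of_real x) = complex_of_real (s ((s ^^ (n - 1 - Suc k)) (- s x)))"
      using Suc by simp
    then show ?case using step[OF sk[OF sI(2)[OF x(1)]]] by simp
  qed
  have last: "(quad c ^^ (n - 1)) (complex_of_real x) = complex_of_real (- s x)" using orbit[of "n - 1"] by simp
  have pos: "\<exists>y>0. (quad c ^^ i) (complex_of_real x) = complex_of_real y" if "i < n - 1" for i
  proof -
    have "n - 1 - i = Suc (n - 1 - Suc i)" using that by simp
    then have "(quad c ^^ i) (complex_of_real x) = complex_of_real (s ((s ^^ (n - 1 - Suc i)) (- s x)))"
      using orbit[of i] that by simp
    then show ?thesis using s(1)[OF sk[OF sI(2)[OF x(1)]]] by blast
  qed
  have "quad c (complex_of_real (- s x)) = quad c (complex_of_real (s x))" by (simp add: quad_def)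
  then have "(quad c ^^ Suc (n - 1)) (complex_of_real x) = complex_of_real x"
    using last step[OF x(1)] by simp
  then have fp: "(quad c ^^ n) (complex_of_real x) = complex_of_real x" using n by (simp del: funpow.simps)
  have "(quad c ^^ k) (complex_of_real x) \<noteq> complex_of_real x" if k: "0 < k" "k < n" for k
  proof
    assume eq: "(quad c ^^ k) (complex_of_real x) = complex_of_real x"
    have "(quad c ^^ (n - 1)) (complex_of_real x) = (quad c ^^ (k + (n - 1 - k))) (complex_of_real x)" using k by simp
    also have "\<dots> = (quad c ^^ (n - 1 - k)) (complex_of_real x)" unfolding quad_iter_add eq ..
    finally have "(quad c ^^ (n - 1 - k)) (complex_of_real x) = complex_of_real (- s x)" using last by simp
    moreover obtain y where "y > 0" "(quad c ^^ (n - 1 - k)) (complex_of_real x) = complex_of_real y"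
    proof -
      have "n - 1 - k < n - 1" using k by simp
      from pos[OF this] show ?thesis using that by blast
    qed
    ultimately have "y = - s x" "y > 0" by (simp_all only: of_real_eq_iff)
    then show False using s(1)[OF x(1)] by simp
  qed
  then have "periodic_point c n (complex_of_real x)" using fp n by (auto simp: periodic_point_def)
  moreover have "- s x < 0" using s(1)[OF x(1)] by simp
  ultimately show thesis using that[of "complex_of_real x"] pos last by blast
qed

text \<open>Points of multiplier 1 are removed: away from them \<open>c\<close> is a local coordinate, and the curve
  is closed under limits with multiplier different from 1.\<close>

definition period_curve :: "nat \<Rightarrow> (complex \<times> complex) set" where
  "period_curve n = {x. periodic_point (fst x) n (snd x) \<and> qderiv (fst x) n (snd x) \<noteq> 1}"

definition curve_mult :: "nat \<Rightarrow> complex \<times> complex \<Rightarrow> complex" where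
  "curve_mult n x = qderiv (fst x) n (snd x)"

lemma continuous_on_curve_mult: "continuous_on S (curve_mult n)"
  unfolding curve_mult_def[abs_def] by (intro continuous_intros continuous_on_fst continuous_on_snd continuous_on_id)

text \<open>If no multiplier of period \<open>n\<close> has a critical point, the multiplier itself is a local
  coordinate on the curve, and \<open>c\<close> is a holomorphic injective function \<open>j\<close> of it.\<close>

lemma period_curve_chart:
  assumes X: "X n = {}" and x0: "x0 \<in> period_curve n"
  shows "\<exists>N j q. x0 \<in> N \<and> openin (top_of_set (period_curve n)) N \<and> open (curve_mult n ` N) \<and>
    homeomorphism N (curve_mult n ` N) (curve_mult n) q \<and>
    j holomorphic_on (curve_mult n ` N) \<and> inj_on j (curve_mult n ` N) \<and>
    (\<forall>x\<in>N. fst x = j (curve_mult n x))"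
proof -
  obtain c0 z0 where x0eq: "x0 = (c0, z0)" by (cases x0)
  have per: "periodic_point c0 n z0" "qderiv c0 n z0 \<noteq> 1" using x0 by (auto simp: period_curve_def x0eq)
  obtain \<delta> r w where w: "0 < \<delta>" "0 < r" "w holomorphic_on ball c0 \<delta>" "w c0 = z0"
    "\<And>c. c \<in> ball c0 \<delta> \<Longrightarrow> w c \<in> ball z0 r"
    "\<And>c. c \<in> ball c0 \<delta> \<Longrightarrow> periodic_point c n (w c)"
    "\<And>c. c \<in> ball c0 \<delta> \<Longrightarrow> qderiv c n (w c) \<noteq> 1"
    "\<And>c z. c \<in> ball c0 \<delta> \<Longrightarrow> z \<in> ball z0 r \<Longrightarrow> (quad c ^^ n) z = z \<Longrightarrow> z = w c"
    by (rule periodic_branch[OF per], (rule that; blast))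
  define m where "m c = qderiv c n (w c)" for c
  have mhol: "m holomorphic_on ball c0 \<delta>" unfolding m_def[abs_def] by (intro holomorphic_intros w(3))
  have "deriv m c0 \<noteq> 0" using mem_X_I[OF w(1,3,6)] X unfolding m_def[abs_def] by blast
  then obtain \<epsilon> where \<epsilon>: "\<epsilon> > 0" "ball c0 \<epsilon> \<subseteq> ball c0 \<delta>" "inj_on m (ball c0 \<epsilon>)"
    using has_complex_derivative_locally_injective[OF mhol _ open_ball, of c0] w(1) by auto
  define B where "B = ball c0 \<epsilon>"
  have B: "open B" "c0 \<in> B" "B \<subseteq> ball c0 \<delta>" "inj_on m B" using \<epsilon> by (auto simp: B_def)
  have mB: "m holomorphic_on B" using holomorphic_on_subset[OF mhol B(3)] .
  have wB: "w holomorphic_on B" using holomorphic_on_subset[OF w(3) B(3)] .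
  obtain j where j: "j holomorphic_on (m ` B)" "\<And>c. c \<in> B \<Longrightarrow> j (m c) = c"
    by (rule holomorphic_has_inverse[OF mB B(1,4)]) auto
  define N where "N = (\<lambda>c. (c, w c)) ` B"
  have N_eq: "N = period_curve n \<inter> (B \<times> ball z0 r)"
  proof
    show "N \<subseteq> period_curve n \<inter> (B \<times> ball z0 r)"
      unfolding N_def period_curve_def using w(5-7) B(3) by auto
    show "period_curve n \<inter> (B \<times> ball z0 r) \<subseteq> N"
    proof
      fix x assume x: "x \<in> period_curve n \<inter> (B \<times> ball z0 r)"
      have "snd x = w (fst x)"
        by (rule w(8)) (use x B(3) in \<open>auto simp: period_curve_def periodic_point_def mem_Times_iff\<close>)
      then have "x = (\<lambda>c. (c, w c)) (fst x)" by (simp add: prod_eq_iff)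
      moreover have "fst x \<in> B" using x by auto
      ultimately show "x \<in> N" unfolding N_def by (rule image_eqI)
    qed
  qed
  have opN: "openin (top_of_set (period_curve n)) N" unfolding N_eq using B(1) by (intro openin_open_Int open_Times) auto
  have im: "curve_mult n ` N = m ` B" unfolding N_def curve_mult_def m_def by (simp add: image_image)
  have op: "open (m ` B)" by (rule open_mapping_thm3[OF mB B(1,4)])
  have x0N: "x0 \<in> N" unfolding N_def x0eq using B(2) w(4) by auto
  have fstj: "fst x = j (curve_mult n x)" if "x \<in> N" for x
    using that j(2) by (auto simp: N_def curve_mult_def m_def)
  have injj: "inj_on j (m ` B)" by (rule inj_on_inverseI[of _ m]) (use j(2) in auto)
  have homeo: "homeomorphism N (m ` B) (curve_mult n) (\<lambda>y. (j y, w (j y)))"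
  proof (rule homeomorphismI)
    have cj: "continuous_on (m ` B) j" by (rule holomorphic_on_imp_continuous_on[OF j(1)])
    have "continuous_on (m ` B) (\<lambda>y. w (j y))"
      by (rule continuous_on_compose2[OF holomorphic_on_imp_continuous_on[OF wB] cj]) (use j(2) in auto)
    then show "continuous_on (m ` B) (\<lambda>y. (j y, w (j y)))" using cj by (intro continuous_on_Pair)
    show "continuous_on N (curve_mult n)" by (rule continuous_on_curve_mult)
    show "curve_mult n ` N \<subseteq> m ` B" using im by simp
    show "(\<lambda>y. (j y, w (j y))) ` (m ` B) \<subseteq> N" unfolding N_def using j(2) by auto
    show "(j (curve_mult n x), w (j (curve_mult n x))) = x" if "x \<in> N" for x
      using fstj[OF that] that unfolding N_def by auto
    show "curve_mult n (j y, w (j y)) = y" if "y \<in> m ` B" for y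
      using that j(2) by (auto simp: curve_mult_def m_def[symmetric])
  qed
  show ?thesis using x0N opN op homeo j(1) injj fstj unfolding im[symmetric] by blast
qed

lemma period_curve_covering:
  assumes X: "X n = {}" and n: "n > 0" and ne: "period_curve n \<noteq> {}"
  shows "covering_space (period_curve n) (curve_mult n) (- {1})"
proof (rule proper_local_homeo_covering[OF continuous_on_curve_mult _ _ ne])
  show "curve_mult n ` period_curve n \<subseteq> - {1}" by (auto simp: curve_mult_def period_curve_def)
  show "connected (- {1 :: complex})" by (rule connected_punctured_universe) simp
next
  fix x assume "x \<in> period_curve n"
  then obtain N j q where N: "x \<in> N" "openin (top_of_set (period_curve n)) N" "open (curve_mult n ` N)"
    "homeomorphism N (curve_mult n ` N) (curve_mult n) q"
    using period_curve_chart[OF X] by blast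
  have "curve_mult n ` N \<subseteq> - {1}" using openin_imp_subset[OF N(2)] by (auto simp: curve_mult_def period_curve_def)
  then have "openin (top_of_set (- {1})) (curve_mult n ` N)" using N(3) by (meson open_subset)
  then show "\<exists>N q. x \<in> N \<and> openin (top_of_set (period_curve n)) N \<and> openin (top_of_set (- {1})) (curve_mult n ` N) \<and>
      homeomorphism N (curve_mult n ` N) (curve_mult n) q" using N by blast
next
  fix f y assume f: "\<And>k. f k \<in> period_curve n" and lim: "(\<lambda>k. curve_mult n (f k)) \<longlonglongrightarrow> y" and y: "y \<in> - {1}"
  have per: "periodic_point (fst (f k)) n (snd (f k))" for k using f[of k] by (simp add: period_curve_def)
  have fp: "(quad (fst (f k)) ^^ n) (snd (f k)) = snd (f k)" for k using per[of k] by (simp add: periodic_point_def)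
  obtain K where K: "\<And>k. norm (curve_mult n (f k)) \<le> K"
    using convergent_imp_bounded[OF lim] by (auto simp: bounded_iff)
  define L where "L = 16 + K\<^sup>2"
  have cL: "norm (fst (f k)) \<le> L" for k
  proof (cases "norm (fst (f k)) \<ge> 16")
    case True
    have "sqrt (norm (fst (f k))) \<le> sqrt (norm (fst (f k))) ^ n"
      using True n real_le_rsqrt[of 1 "norm (fst (f k))"] by (intro self_le_power) auto
    also have "\<dots> \<le> K" using periodic_qderiv_bounds(1)[OF fp n True] K[of k] by (simp add: curve_mult_def)
    finally have "(sqrt (norm (fst (f k))))\<^sup>2 \<le> K\<^sup>2" by (intro power_mono) auto
    then show ?thesis by (simp add: L_def)
  qed (simp add: L_def add_increasing2)
  have L0: "L \<ge> 0" by (simp add: L_def)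
  have zL: "norm (snd (f k)) \<le> 1 + L" for k
  proof (rule periodic_norm_le[OF fp n])
    have "L \<le> (1 + L) * L" using L0 by (simp add: algebra_simps)
    then show "norm (fst (f k)) \<le> (1 + L) * (1 + L - 1)" using cL[of k] by simp
  qed (use L0 in simp)
  have "norm (f k) \<le> L + (1 + L)" for k
    using norm_Pair_le[of "fst (f k)" "snd (f k)"] cL[of k] zL[of k] by simp
  then have "bounded (range f)" by (auto simp: bounded_iff)
  then obtain x r where r: "strict_mono (r :: nat \<Rightarrow> nat)" "(f \<circ> r) \<longlonglongrightarrow> x"
    using bounded_imp_convergent_subsequence by blast
  have "isCont (curve_mult n) x" using continuous_on_curve_mult[of UNIV n] unfolding continuous_on_eq_continuous_at[OF open_UNIV] by blast
  from isCont_tendsto_compose[OF this r(2)] have "(\<lambda>k. curve_mult n (f (r k))) \<longlonglongrightarrow> curve_mult n x" by simp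
  moreover have "(\<lambda>k. curve_mult n (f (r k))) \<longlonglongrightarrow> y" using LIMSEQ_subseq_LIMSEQ[OF lim r(1)] by (simp add: o_def)
  ultimately have "curve_mult n x = y" by (rule LIMSEQ_unique)
  then have nd: "qderiv (fst x) n (snd x) \<noteq> 1" using y by (simp add: curve_mult_def)
  have "periodic_point (fst x) n (snd x)"
    by (rule periodic_limit[OF _ tendsto_fst[OF r(2)] tendsto_snd[OF r(2)] nd]) (simp add: per)
  then have "x \<in> period_curve n" using nd by (simp add: period_curve_def)
  then show "\<exists>x\<in>period_curve n. \<exists>r::nat\<Rightarrow>nat. strict_mono r \<and> (f \<circ> r) \<longlonglongrightarrow> x" using r by blast
qed

text \<open>Since \<open>c\<close> is locally a univalent function of the multiplier, the lift has a holomorphic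
  first coordinate without critical points.\<close>

lemma period_curve_lift:
  assumes X: "X n = {}" and n: "n > 0" and per: "periodic_point c0 n z0"
    and t0: "qderiv c0 n z0 = 1 + exp (of_nat n * t0)"
  obtains C \<zeta> where "C holomorphic_on UNIV" "\<And>t. deriv C t \<noteq> 0" "continuous_on UNIV \<zeta>" "C t0 = c0" "\<zeta> t0 = z0"
    "\<And>t. periodic_point (C t) n (\<zeta> t)" "\<And>t. qderiv (C t) n (\<zeta> t) = 1 + exp (of_nat n * t)"
proof -
  have x0: "(c0, z0) \<in> period_curve n" using per t0 by (simp add: period_curve_def)
  have cov: "covering_space (period_curve n) (curve_mult n) (- {1})"
    by (rule period_curve_covering[OF X n]) (use x0 in blast)
  obtain g where g: "continuous_on UNIV g" "g \<in> UNIV \<rightarrow> period_curve n" "g t0 = (c0, z0)"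
    "\<And>t. t \<in> UNIV \<Longrightarrow> curve_mult n (g t) = 1 + exp (of_nat n * t)"
  proof (rule covering_space_lift_strong[OF cov x0, of t0 UNIV "\<lambda>t. 1 + exp (of_nat n * t)"])
    show "simply_connected (UNIV :: complex set)" by (simp add: convex_imp_simply_connected)
    show "locally path_connected (UNIV :: complex set)" by (simp add: convex_imp_locally_path_connected)
    show "continuous_on UNIV (\<lambda>t::complex. 1 + exp (of_nat n * t))" by (intro continuous_intros)
  qed (use t0 in \<open>auto simp: curve_mult_def\<close>)
  define C \<zeta> where "C t = fst (g t)" and "\<zeta> t = snd (g t)" for t
  have gt: "g t \<in> period_curve n" for t using g(2) by auto
  have loc: "\<exists>d. (C has_field_derivative d) (at t1) \<and> d \<noteq> 0" for t1
  proof -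
    obtain N j where N: "g t1 \<in> N" "openin (top_of_set (period_curve n)) N" "open (curve_mult n ` N)"
      "j holomorphic_on (curve_mult n ` N)" "inj_on j (curve_mult n ` N)" "\<And>x. x \<in> N \<Longrightarrow> fst x = j (curve_mult n x)"
      using period_curve_chart[OF X gt[of t1]] by blast
    obtain V where V: "open V" "N = period_curve n \<inter> V" using N(2)[unfolded openin_open] by (elim exE conjE)
    define W where "W = g -` V"
    have W: "open W" "t1 \<in> W" using open_vimage[OF V(1) g(1)] N(1) V(2)
      by (auto simp: W_def)
    have gN: "g t \<in> N" if "t \<in> W" for t using that gt[of t] V(2) by (auto simp: W_def)
    have Ceq: "j (1 + exp (of_nat n * t)) = C t" if "t \<in> W" for t
      using N(6)[OF gN[OF that]] g(4)[of t] by (simp add: C_def)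
    have y1: "1 + exp (of_nat n * t1) \<in> curve_mult n ` N" using gN[OF W(2)] g(4)[of t1] by (metis UNIV_I image_eqI)
    have dj: "(j has_field_derivative deriv j (1 + exp (of_nat n * t1))) (at (1 + exp (of_nat n * t1)))"
      by (rule holomorphic_derivI[OF N(4,3) y1])
    have nz: "deriv j (1 + exp (of_nat n * t1)) \<noteq> 0"
      by (rule holomorphic_injective_imp_regular[OF N(4,3,5) y1])
    have "((\<lambda>t. j (1 + exp (of_nat n * t))) has_field_derivative
        deriv j (1 + exp (of_nat n * t1)) * (of_nat n * exp (of_nat n * t1))) (at t1)"
      by (rule DERIV_chain2[where f = j, OF _ _], rule dj) (auto intro!: derivative_eq_intros)
    then have "(C has_field_derivative deriv j (1 + exp (of_nat n * t1)) * (of_nat n * exp (of_nat n * t1))) (at t1)"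
      by (rule has_field_derivative_transform_within_open[OF _ W]) (rule Ceq)
    then show ?thesis using nz n by auto
  qed
  show thesis
  proof (rule that[of C \<zeta>])
    show "C holomorphic_on UNIV" using loc by (auto simp: holomorphic_on_def field_differentiable_def)
    show "deriv C t \<noteq> 0" for t using loc[of t] DERIV_imp_deriv by blast
    show "continuous_on UNIV \<zeta>" unfolding \<zeta>_def[abs_def] by (intro continuous_on_snd g)
    show "C t0 = c0" "\<zeta> t0 = z0" using g(3) by (simp_all add: C_def \<zeta>_def)
    show "periodic_point (C t) n (\<zeta> t)" for t using gt[of t] by (simp add: period_curve_def C_def \<zeta>_def)
    show "qderiv (C t) n (\<zeta> t) = 1 + exp (of_nat n * t)" for t using g(4)[of t] by (simp add: curve_mult_def C_def \<zeta>_def)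
  qed
qed

section \<open>Critical points exist for every period from 3 on\<close>

lemma norm_prod_one_minus_le:
  fixes x :: "nat \<Rightarrow> complex"
  assumes "\<And>i. i < n \<Longrightarrow> norm (x i) \<le> m" "0 \<le> m" "m \<le> 1"
  shows "norm ((\<Prod>i<n. 1 - x i) - 1 + (\<Sum>i<n. x i)) \<le> 4 ^ n * m\<^sup>2"
  using assms(1)
proof (induction n)
  case (Suc n)
  define E where "E = (\<Prod>i<n. 1 - x i) - 1 + (\<Sum>i<n. x i)"
  have E: "norm E \<le> 4 ^ n * m\<^sup>2" unfolding E_def using Suc by simp
  have xn: "norm (x n) \<le> m" using Suc.prems by simp
  have "(\<Prod>i<Suc n. 1 - x i) - 1 + (\<Sum>i<Suc n. x i) = E * (1 - x n) + x n * (\<Sum>i<n. x i)"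
    by (simp add: E_def algebra_simps)
  also have "norm \<dots> \<le> norm E * norm (1 - x n) + norm (x n) * norm (\<Sum>i<n. x i)"
    by (metis norm_mult norm_triangle_ineq)
  also have "\<dots> \<le> 4 ^ n * m\<^sup>2 * 2 + m * (n * m)"
  proof (intro add_mono mult_mono)
    show "norm (1 - x n) \<le> 2" using norm_triangle_ineq4[of 1 "x n"] xn assms(3) by simp
    show "norm (\<Sum>i<n. x i) \<le> real n * m" using sum_norm_bound[of "{..<n}" x m] Suc.prems by simp
  qed (use E xn assms in auto)
  also have "\<dots> = (2 * 4 ^ n + real n) * m\<^sup>2" by (simp add: power2_eq_square algebra_simps)
  also have "\<dots> \<le> 4 ^ Suc n * m\<^sup>2"
  proof (intro mult_right_mono)
    have "n < 4 ^ n" by (induction n) auto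
    then have "real n < 4 ^ n" by (metis of_nat_less_iff of_nat_numeral of_nat_power)
    moreover have "(0::real) \<le> 4 ^ n" by simp
    ultimately show "2 * 4 ^ n + real n \<le> 4 ^ Suc n" unfolding power_Suc by linarith
  qed simp
  finally show ?case .
qed simp

lemma norm_one_plus_power_le:
  fixes v :: complex
  assumes "norm v \<le> 1"
  shows "norm ((1 + v) ^ n - 1) \<le> 3 ^ n * norm v"
proof (induction n)
  case (Suc n)
  have "(1 + v) ^ Suc n - 1 = ((1 + v) ^ n - 1) * (1 + v) + v" by (simp add: algebra_simps)
  also have "norm \<dots> \<le> norm ((1 + v) ^ n - 1) * norm (1 + v) + norm v"
    by (metis norm_mult norm_triangle_ineq)
  also have "\<dots> \<le> 3 ^ n * norm v * 2 + 3 ^ n * norm v"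
  proof (intro add_mono mult_mono Suc)
    show "norm (1 + v) \<le> 2" using norm_triangle_ineq[of 1 v] assms by simp
    show "norm v \<le> 3 ^ n * norm v" using mult_right_mono[of 1 "3 ^ n" "norm v"] by simp
  qed auto
  also have "\<dots> = 3 ^ Suc n * norm v" by simp
  finally show ?case .
qed simp

text \<open>Each factor satisfies \<open>z\<^sub>i\<^sup>2 = z\<^sub>i\<^sub>+\<^sub>1 - c\<close>, and the shift of the index permutes the cycle. This exact
  formula replaces an expansion of nested square roots.\<close>

lemma qderiv_square:
  assumes fp: "(quad c ^^ n) z = z" and c: "c \<noteq> 0"
  shows "(qderiv c n z)\<^sup>2 = 4 ^ n * (- c) ^ n * (\<Prod>i<n. 1 - (quad c ^^ i) z / c)"
proof -
  have "(2 * (quad c ^^ i) z)\<^sup>2 = 4 * (- c) * (1 - (quad c ^^ Suc i) z / c)" for i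
    using c by (simp add: quad_def field_simps power2_eq_square)
  then have "(qderiv c n z)\<^sup>2 = (\<Prod>i<n. 4 * (- c) * (1 - (quad c ^^ Suc i) z / c))"
    unfolding qderiv_def prod_power_distrib by (simp only:)
  also have "\<dots> = 4 ^ n * (- c) ^ n * (\<Prod>i<n. 1 - (quad c ^^ Suc i) z / c)"
    by (simp only: prod.distrib prod_constant card_lessThan power_mult_distrib)
  also have "(\<Prod>i<n. 1 - (quad c ^^ Suc i) z / c) = (\<Prod>i<n. 1 - (quad c ^^ i) z / c)"
  proof (cases n)
    case (Suc m)
    have "(\<Prod>i<n. 1 - (quad c ^^ Suc i) z / c) = (\<Prod>i<m. 1 - (quad c ^^ Suc i) z / c) * (1 - (quad c ^^ n) z / c)"
      unfolding Suc by simp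
    also have "\<dots> = (1 - (quad c ^^ 0) z / c) * (\<Prod>i<m. 1 - (quad c ^^ Suc i) z / c)"
      unfolding fp by simp
    also have "\<dots> = (\<Prod>i<n. 1 - (quad c ^^ i) z / c)"
      unfolding Suc by (rule prod.lessThan_Suc_shift[symmetric])
    finally show ?thesis .
  qed simp
  finally show ?thesis .
qed

lemma near_one_if_square_near_one:
  fixes q :: complex
  assumes "norm (q\<^sup>2 - 1) \<le> \<theta>" "Re q > 0"
  shows "norm (q - 1) \<le> \<theta>"
proof -
  have "1 \<le> Re (q + 1)" using assms(2) by simp
  also have "\<dots> \<le> norm (q + 1)" by (rule complex_Re_le_cmod)
  finally have "norm (q - 1) \<le> norm (q - 1) * norm (q + 1)" by (simp add: mult_le_cancel_left1)
  also have "\<dots> = norm (q\<^sup>2 - 1)" by (simp add: norm_mult[symmetric] power2_eq_square algebra_simps)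
  finally show ?thesis using assms(1) by simp
qed

text \<open>Every point of the cycle is close to one of the two square roots of \<open>- c\<close>, so the quotient
  of two of them is close to \<open>1\<close> or \<open>- 1\<close>.\<close>

lemma orbit_ratio_square:
  assumes fp: "(quad c ^^ n) z = z" and n: "n > 0" and c: "norm c \<ge> (64 * real n)\<^sup>2"
  shows "norm (((quad c ^^ i) z / z)\<^sup>2 - 1) \<le> 1 / (4 * real n)" "z \<noteq> 0"
proof -
  have s: "sqrt (norm c) \<ge> 64 * real n" using c real_le_rsqrt by blast
  have "(64 * 1)\<^sup>2 \<le> (64 * real n)\<^sup>2" using n by (intro power_mono) auto
  then have c16: "norm c \<ge> 16" using c by simp
  note b = periodic_norm_bounds[OF periodic_orbit_fixed[OF fp] n c16]
  have z: "norm z \<ge> sqrt (norm c) / 2" using b(1)[of 0] by simp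
  have sp: "sqrt (norm c) > 0" using c16 by (intro real_sqrt_gt_zero) linarith
  show z0: "z \<noteq> 0" using z sp by auto
  have "((quad c ^^ i) z / z)\<^sup>2 - 1 = ((quad c ^^ Suc i) z - (quad c ^^ 1) z) / z\<^sup>2"
    using z0 by (simp add: quad_def power_divide field_simps)
  then have "norm (((quad c ^^ i) z / z)\<^sup>2 - 1) = norm ((quad c ^^ Suc i) z - (quad c ^^ 1) z) / (norm z)\<^sup>2"
    by (simp add: norm_divide norm_power del: funpow.simps)
  also have "\<dots> \<le> (4 * sqrt (norm c)) / (sqrt (norm c) / 2)\<^sup>2"
  proof (intro frac_le power_mono)
    show "norm ((quad c ^^ Suc i) z - (quad c ^^ 1) z) \<le> 4 * sqrt (norm c)"
      using norm_triangle_ineq4[of "(quad c ^^ Suc i) z" "(quad c ^^ 1) z"] b(2)[of "Suc i"] b(2)[of 1] by linarith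
  qed (use sp z in auto)
  also have "\<dots> = 16 / sqrt (norm c)" using sp by (simp add: power2_eq_square field_simps)
  also have "\<dots> \<le> 16 / (64 * real n)" using s n sp by (intro divide_left_mono mult_pos_pos) auto
  finally show "norm (((quad c ^^ i) z / z)\<^sup>2 - 1) \<le> 1 / (4 * real n)" by simp
qed

lemma orbit_ratio_Re_nonzero:
  assumes fp: "(quad c ^^ n) z = z" and n: "n > 0" and c: "norm c \<ge> (64 * real n)\<^sup>2"
  shows "Re ((quad c ^^ i) z / z) \<noteq> 0"
proof
  define q where "q = (quad c ^^ i) z / z"
  assume "Re ((quad c ^^ i) z / z) = 0"
  then have "Re (q\<^sup>2 - 1) \<le> - 1" by (simp add: q_def[symmetric] power2_eq_square)
  then have "1 \<le> norm (q\<^sup>2 - 1)" using abs_Re_le_cmod[of "q\<^sup>2 - 1"] by linarith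
  moreover have "1 / (4 * real n) < 1" using n by simp
  ultimately show False using orbit_ratio_square(1)[OF assms, of i] by (simp add: q_def)
qed

text \<open>All points but one are close to \<open>z\<close> and the remaining one is close to \<open>- z\<close>, so the sum
  is close to \<open>(n - 2) z\<close>.\<close>

lemma orbit_sum_large:
  assumes fp: "(quad c ^^ n) z = z" and n: "n \<ge> 3" and c: "norm c \<ge> (64 * real n)\<^sup>2"
    and pos: "\<And>i. i < n - 1 \<Longrightarrow> Re ((quad c ^^ i) z / z) > 0"
    and neg: "Re ((quad c ^^ (n - 1)) z / z) < 0"
  shows "sqrt (norm c) / 4 \<le> norm (\<Sum>i<n. (quad c ^^ i) z)"
proof -
  have n0: "n > 0" using n by simp
  define q where "q i = (quad c ^^ i) z / z" for i
  have z0: "z \<noteq> 0" by (rule orbit_ratio_square(2)[OF fp n0 c])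
  have "norm (q i - 1) \<le> 1 / (4 * real n)" if "i < n - 1" for i
    unfolding q_def by (rule near_one_if_square_near_one[OF orbit_ratio_square(1)[OF fp n0 c] pos[OF that]])
  then have "norm (\<Sum>i<n - 1. q i - 1) \<le> real (n - 1) * (1 / (4 * real n))"
    using sum_norm_bound[of "{..<n - 1}" "\<lambda>i. q i - 1" "1 / (4 * real n)"] by simp
  then have 1: "norm ((\<Sum>i<n - 1. q i) - of_nat (n - 1)) \<le> real (n - 1) * (1 / (4 * real n))"
    by (simp add: sum_subtractf)
  have "norm (- q (n - 1) - 1) \<le> 1 / (4 * real n)"
    by (rule near_one_if_square_near_one)
       (use orbit_ratio_square(1)[OF fp n0 c, of "n - 1"] neg in \<open>auto simp: q_def\<close>)
  then have 2: "norm (q (n - 1) + 1) \<le> 1 / (4 * real n)" by (metis minus_add_distrib norm_minus_cancel uminus_add_conv_diff add.commute)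
  have "(\<Sum>i<n. q i) = (\<Sum>i<n - 1. q i) + q (n - 1)" using n0 by (metis Suc_pred' sum.lessThan_Suc)
  then have "(\<Sum>i<n. q i) - of_nat (n - 2) = ((\<Sum>i<n - 1. q i) - of_nat (n - 1)) + (q (n - 1) + 1)"
    using n by (simp add: of_nat_diff)
  then have "norm ((\<Sum>i<n. q i) - of_nat (n - 2)) \<le> real (n - 1) * (1 / (4 * real n)) + 1 / (4 * real n)"
    using 1 2 norm_triangle_mono by metis
  also have "\<dots> = 1/4" using n by (simp add: of_nat_diff field_simps)
  finally have "norm ((\<Sum>i<n. q i) - of_nat (n - 2)) \<le> 1/4" .
  moreover have "norm (of_nat (n - 2) :: complex) \<ge> 1" using n unfolding norm_of_nat by linarith
  moreover have "norm s \<ge> 1/2" if "norm (s - a) \<le> 1/4" "norm a \<ge> 1" for s a :: complex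
    using that norm_triangle_ineq2[of a "a - s"] by (simp add: norm_minus_commute)
  ultimately have "norm (\<Sum>i<n. q i) \<ge> 1/2" by blast
  moreover have "(\<Sum>i<n. (quad c ^^ i) z) = z * (\<Sum>i<n. q i)" using z0 by (simp add: q_def sum_distrib_left)
  moreover have "(64 * 1)\<^sup>2 \<le> (64 * real n)\<^sup>2" using n by (intro power_mono) auto
  then have "norm z \<ge> sqrt (norm c) / 2" using c by (intro periodic_norm_bounds(1)[OF fp n0]) simp
  ultimately have "sqrt (norm c) / 2 * (1/2) \<le> norm z * norm (\<Sum>i<n. q i)" by (intro mult_mono) auto
  then show ?thesis using \<open>(\<Sum>i<n. (quad c ^^ i) z) = z * (\<Sum>i<n. q i)\<close> by (simp add: norm_mult)
qed

text \<open>Along a ray on which \<open>C = b + a exp (2 t)\<close> tends to infinity, \<open>qderiv_square\<close> expresses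
  \<open>(1 + exp (n t))\<^sup>2\<close> through \<open>C\<close> and the product \<open>P\<close> of the \<open>1 - z\<^sub>i / C\<close>. Comparison gives
  \<open>P = 1 + O(1 / C)\<close>, so that the sum of the \<open>z\<^sub>i\<close> stays bounded. But the itinerary \<open>+ ... + -\<close> of the starting
  point persists along the ray, and then this sum has at least the order of
  \<open>sqrt (norm C)\<close>.\<close>

theorem X_nonempty:
  assumes n: "n \<ge> 3"
  shows "X n \<noteq> {}"
proof
  assume X: "X n = {}"
  have n0: "n > 0" using n by simp
  \<comment> \<open>Beyond modulus \<open>R0\<close> the signs of an itinerary are well separated; \<open>K1\<close> bounds the
    multipliers for smaller parameters, so that starting with a multiplier well above \<open>K1\<close> keeps the
    whole half-plane to the right of \<open>t0\<close> in the region \<open>norm (C t) \<ge> R0\<close>.\<close>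
  define R0 where "R0 = (64 * real n)\<^sup>2"
  define K1 where "K1 = (2 * (1 + R0)) ^ n"
  define u where "u = K1 + 5"
  have "(64 * 1)\<^sup>2 \<le> (64 * real n)\<^sup>2" using n by (intro power_mono) auto
  then have R0: "R0 \<ge> 16" by (simp add: R0_def)
  have K1: "K1 \<ge> 0" using R0 by (simp add: K1_def)
  have u: "u \<ge> 5" using K1 by (simp add: u_def)
  obtain z where z: "periodic_point (complex_of_real (- u\<^sup>2)) n z"
    "\<And>i. i < n - 1 \<Longrightarrow> \<exists>x>0. (quad (complex_of_real (- u\<^sup>2)) ^^ i) z = complex_of_real x"
    "\<exists>x<0. (quad (complex_of_real (- u\<^sup>2)) ^^ (n - 1)) z = complex_of_real x"
  proof (rule exists_real_cycle[of n u])
    show "2 \<le> n" "3 \<le> u" using n u by auto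
  qed (rule that; blast)
  define c0 where "c0 = complex_of_real (- u\<^sup>2)"
  define \<rho>0 where "\<rho>0 = qderiv c0 n z"
  have per0: "periodic_point c0 n z" using z(1) by (simp add: c0_def)
  have nc0: "norm c0 = u\<^sup>2" unfolding c0_def norm_of_real by simp
  have "norm \<rho>0 \<ge> sqrt (norm c0) ^ n" unfolding \<rho>0_def
  proof (rule periodic_qderiv_bounds(1)[OF _ n0])
    show "16 \<le> norm c0" using power_mono[of 5 u 2] u by (simp add: nc0)
  qed (use per0 in \<open>simp add: periodic_point_def\<close>)
  moreover have "u \<le> u ^ n" using u n by (intro self_le_power) auto
  ultimately have \<rho>0: "norm \<rho>0 \<ge> u" using u by (simp add: nc0)
  then have "\<rho>0 \<noteq> 1" using u by auto
  define t0 where "t0 = Ln (\<rho>0 - 1) / of_nat n"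
  have et0: "exp (of_nat n * t0) = \<rho>0 - 1" using \<open>\<rho>0 \<noteq> 1\<close> n0 by (simp add: t0_def)
  obtain C \<zeta> where C: "C holomorphic_on UNIV" "\<And>t. deriv C t \<noteq> 0" "continuous_on UNIV \<zeta>" "C t0 = c0" "\<zeta> t0 = z"
    "\<And>t. periodic_point (C t) n (\<zeta> t)" "\<And>t. qderiv (C t) n (\<zeta> t) = 1 + exp (of_nat n * t)"
  proof (rule period_curve_lift[OF X n0 per0, of t0])
    show "qderiv c0 n z = 1 + exp (of_nat n * t0)" using et0 by (simp add: \<rho>0_def)
  qed (rule that; blast)
  have fp: "(quad (C t) ^^ n) (\<zeta> t) = \<zeta> t" for t using C(6)[of t] by (simp add: periodic_point_def)
  have small: "norm (1 + exp (of_nat n * t)) \<le> K1" if "norm (C t) < R0" for t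
  proof -
    have "norm ((quad (C t) ^^ i) (\<zeta> t)) \<le> 1 + R0" for i
    proof (rule periodic_norm_le[OF periodic_orbit_fixed[OF fp] n0])
      have "R0 \<le> (1 + R0) * R0" using R0 by (simp add: algebra_simps)
      then show "norm (C t) \<le> (1 + R0) * (1 + R0 - 1)" using that by simp
    qed (use R0 in simp)
    from this have "norm (2 * (quad (C t) ^^ i) (\<zeta> t)) \<le> 2 * (1 + R0)" for i
      unfolding norm_mult norm_numeral by (intro mult_left_mono) auto
    then have "(\<Prod>i<n. norm (2 * (quad (C t) ^^ i) (\<zeta> t))) \<le> (\<Prod>i<n. 2 * (1 + R0))"
      by (intro prod_mono conjI norm_ge_zero)
    then show ?thesis unfolding C(7)[of t, symmetric] qderiv_def prod_norm[symmetric] K1_def by simp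
  qed
  have norm_exp: "norm (exp (of_nat n * t)) = exp (Re t) ^ n" for t :: complex
    by (simp add: exp_of_nat_mult[symmetric])
  have large: "norm (C t) \<ge> R0" if "Re t \<ge> Re t0" for t
  proof (rule ccontr)
    assume "\<not> norm (C t) \<ge> R0"
    then have "norm (1 + exp (of_nat n * t)) \<le> K1" using small[of t] by simp
    moreover have "norm (exp (of_nat n * t)) \<le> norm (1 + exp (of_nat n * t)) + 1"
      using norm_triangle_ineq4[of "1 + exp (of_nat n * t)" 1] by simp
    moreover have "norm (exp (of_nat n * t0)) \<le> norm (exp (of_nat n * t))"
      unfolding norm_exp using that by (intro power_mono) auto
    moreover have "u - 1 \<le> norm (exp (of_nat n * t0))"
      using \<rho>0 norm_triangle_ineq2[of \<rho>0 1] unfolding et0 by simp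
    ultimately show False unfolding u_def by linarith
  qed
  have up: "norm (C t) \<le> 20 * exp (2 * max 0 (Re t))" for t
  proof (cases "norm (C t) \<ge> 16")
    case True
    have "sqrt (norm (C t)) ^ n \<le> norm (1 + exp (of_nat n * t))"
      using periodic_qderiv_bounds(1)[OF fp n0 True] C(7)[of t] by simp
    also have "\<dots> \<le> 1 + exp (Re t) ^ n" using norm_triangle_ineq[of 1 "exp (of_nat n * t)"] unfolding norm_exp by simp
    also have "\<dots> \<le> 2 ^ n * exp (max 0 (Re t)) ^ n"
    proof -
      have "exp (Re t) ^ n \<le> exp (max 0 (Re t)) ^ n" by (intro power_mono) auto
      moreover have "1 \<le> exp (max 0 (Re t)) ^ n" by (intro one_le_power) auto
      moreover have "2 * exp (max 0 (Re t)) ^ n \<le> 2 ^ n * exp (max 0 (Re t)) ^ n"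
        using self_le_power[of "2::real" n] n0 by (intro mult_right_mono) auto
      ultimately show ?thesis by linarith
    qed
    also have "\<dots> = (2 * exp (max 0 (Re t))) ^ n" by (simp add: power_mult_distrib)
    finally have "sqrt (norm (C t)) \<le> 2 * exp (max 0 (Re t))" using n0 by (subst (asm) power_mono_iff) auto
    then have "(sqrt (norm (C t)))\<^sup>2 \<le> (2 * exp (max 0 (Re t)))\<^sup>2" by (intro power_mono) auto
    also have "\<dots> = 4 * exp (2 * max 0 (Re t))" by (simp add: power_mult_distrib exp_double)
    finally have "norm (C t) \<le> 4 * exp (2 * max 0 (Re t))" by simp
    then show ?thesis using exp_ge_zero[of "2 * max 0 (Re t)"] by linarith
  next
    case False
    moreover have "1 \<le> exp (2 * max 0 (Re t))" by simp
    ultimately show ?thesis by linarith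
  qed
  have low: "1/64 * exp (2 * Re t) \<le> norm (C t)" if t: "Re t \<ge> max (Re t0) 1" for t
  proof -
    have c16: "norm (C t) \<ge> 16" using large[of t] t R0 by simp
    have "2 \<le> exp (Re t)" using exp_ge_add_one_self[of "Re t"] t by linarith
    then have e2: "2 \<le> exp (Re t) ^ n" using self_le_power[of "exp (Re t)" n] n0 by linarith
    have "(exp (Re t) / 2) ^ n \<le> exp (Re t) ^ n / 2"
      unfolding power_divide using self_le_power[of "2::real" n] n0 by (intro divide_left_mono) auto
    also have "\<dots> \<le> exp (Re t) ^ n - 1" using e2 by simp
    also have "\<dots> \<le> norm (1 + exp (of_nat n * t))"
      using norm_triangle_ineq4[of "1 + exp (of_nat n * t)" 1] unfolding add_diff_cancel_left' norm_exp by simp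
    also have "\<dots> \<le> (4 * sqrt (norm (C t))) ^ n"
      using periodic_qderiv_bounds(2)[OF fp n0 c16] C(7)[of t] by simp
    finally have "exp (Re t) / 2 \<le> 4 * sqrt (norm (C t))" using n0 by (subst (asm) power_mono_iff) auto
    then have "(exp (Re t) / 8)\<^sup>2 \<le> (sqrt (norm (C t)))\<^sup>2" by (intro power_mono) auto
    then show ?thesis by (simp add: power_divide exp_double)
  qed
  obtain a b where ab: "a \<noteq> 0" "\<And>t. C t = b + a * exp (2 * t)"
    by (rule entire_exponential_growth[where T = "max (Re t0) 1", OF C(1,2) up _ _ low], simp, simp, assumption, (rule that; blast))
  define tt where "tt k = t0 + complex_of_real (real k)" for k
  define c where "c k = C (tt k)" for k
  define \<xi> where "\<xi> k = \<zeta> (tt k)" for k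
  have fpk: "(quad (c k) ^^ n) (\<xi> k) = \<xi> k" for k using fp by (simp add: c_def \<xi>_def)
  have cR: "norm (c k) \<ge> (64 * real n)\<^sup>2" for k
    using large[of "tt k"] by (simp add: c_def tt_def R0_def)
  have sumlarge: "sqrt (norm (c k)) / 4 \<le> norm (\<Sum>i<n. (quad (c k) ^^ i) (\<xi> k))" for k
  proof -
    \<comment> \<open>These real parts never vanish along the ray, hence keep their signs.\<close>
    define q where "q i x = Re ((quad (C (t0 + complex_of_real x)) ^^ i) (\<zeta> (t0 + complex_of_real x)) / \<zeta> (t0 + complex_of_real x))" for i and x :: real
    have R: "norm (C (t0 + complex_of_real x)) \<ge> (64 * real n)\<^sup>2" if "x \<ge> 0" for x
      using large[of "t0 + complex_of_real x"] that by (simp add: R0_def)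
    have nz: "q i x \<noteq> 0" if "x \<ge> 0" for i x unfolding q_def by (rule orbit_ratio_Re_nonzero[OF fp n0 R[OF that]])
    have nz': "\<zeta> (t0 + complex_of_real x) \<noteq> 0" if "x \<ge> 0" for x by (rule orbit_ratio_square(2)[OF fp n0 R[OF that]])
    have cont: "continuous_on {0..real k} (q i)" for i
    proof -
      have cl: "continuous_on {0..real k} (\<lambda>x. t0 + complex_of_real x)" by (intro continuous_intros)
      have c1: "continuous_on {0..real k} (\<lambda>x. C (t0 + complex_of_real x))"
        by (rule continuous_on_compose2[OF holomorphic_on_imp_continuous_on[OF C(1)] cl]) simp
      have c2: "continuous_on {0..real k} (\<lambda>x. \<zeta> (t0 + complex_of_real x))"
        by (rule continuous_on_compose2[OF C(3) cl]) simp
      show ?thesis unfolding q_def[abs_def]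
        by (intro continuous_intros c1 c2) (use nz' in auto)
    qed
    obtain x0 where x0: "x0 > 0" "z = complex_of_real x0" using z(2)[of 0] n by auto
    have pos0: "q i 0 > 0" if i: "i < n - 1" for i
    proof -
      obtain x where "x > 0" "(quad (complex_of_real (- u\<^sup>2)) ^^ i) z = complex_of_real x" using z(2)[OF i] by blast
      then show ?thesis using x0 by (simp add: q_def C(4,5) c0_def)
    qed
    have neg0: "q (n - 1) 0 < 0"
    proof -
      obtain x where "x < 0" "(quad (complex_of_real (- u\<^sup>2)) ^^ (n - 1)) z = complex_of_real x" using z(3) by blast
      then show ?thesis using x0 by (simp add: q_def C(4,5) c0_def divide_neg_pos)
    qed
    have posk: "q i (real k) > 0" if i: "i < n - 1" for i
    proof (rule ccontr)
      assume "\<not> q i (real k) > 0"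
      then have "\<exists>x\<ge>0. x \<le> real k \<and> q i x = 0" using pos0[OF i] by (intro IVT2' cont) auto
      then show False using nz by blast
    qed
    have negk: "q (n - 1) (real k) < 0"
    proof (rule ccontr)
      assume "\<not> q (n - 1) (real k) < 0"
      then have "\<exists>x\<ge>0. x \<le> real k \<and> q (n - 1) x = 0" using neg0 by (intro IVT' cont) auto
      then show False using nz by blast
    qed
    show ?thesis
      by (rule orbit_sum_large[OF fpk n cR]) (use posk negk in \<open>simp_all add: q_def c_def \<xi>_def tt_def\<close>)
  qed
  \<comment> \<open>In terms of \<open>y = exp (- t)\<close> both sides can be compared up to the order \<open>y\<^sup>2\<close>, which is the
    order of \<open>1 / C\<close>; here \<open>n \<ge> 2\<close> makes \<open>y ^ n\<close> negligible.\<close>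
  define y where "y k = exp (- tt k)" for k
  have yn: "norm (y k) = exp (- Re t0) * exp (- real k)" for k by (simp add: y_def tt_def exp_add[symmetric])
  have ynlim: "(\<lambda>k. norm (y k)) \<longlonglongrightarrow> 0" unfolding yn by real_asymp
  then have ylim: "y \<longlonglongrightarrow> 0" by (rule tendsto_norm_zero_cancel)
  have y0: "y k \<noteq> 0" for k by (simp add: y_def)
  have ey: "exp (tt k) * y k = 1" for k by (simp add: y_def exp_minus)
  have cy: "c k * (y k)\<^sup>2 = a * (1 + b / a * (y k)\<^sup>2)" for k
  proof -
    have "exp (2 * tt k) * (y k)\<^sup>2 = (exp (tt k) * y k)\<^sup>2" by (simp add: exp_double power_mult_distrib)
    then have "exp (2 * tt k) * (y k)\<^sup>2 = 1" unfolding ey by simp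
    then show ?thesis using ab(1) by (simp add: c_def ab(2) distrib_right mult.assoc) (simp add: distrib_left)
  qed
  define P where "P k = (\<Prod>i<n. 1 - (quad (c k) ^^ i) (\<xi> k) / c k)" for k
  have cnz: "c k \<noteq> 0" for k using cR[of k] R0 by (auto simp: R0_def)
  have rel: "(1 + y k ^ n)\<^sup>2 = 4 ^ n * (- a) ^ n * (1 + b / a * (y k)\<^sup>2) ^ n * P k" for k
  proof -
    have "exp (of_nat n * tt k) * y k ^ n = (exp (tt k) * y k) ^ n"
      by (simp add: exp_of_nat_mult power_mult_distrib)
    then have "exp (of_nat n * tt k) * y k ^ n = 1" unfolding ey by simp
    then have "(1 + y k ^ n)\<^sup>2 = ((1 + exp (of_nat n * tt k)) * y k ^ n)\<^sup>2" by (simp add: distrib_right add.commute)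
    also have "\<dots> = (qderiv (c k) n (\<xi> k))\<^sup>2 * ((y k)\<^sup>2) ^ n"
      using C(7)[of "tt k"] by (simp add: c_def \<xi>_def power_mult_distrib power_mult[symmetric] mult.commute)
    also have "\<dots> = 4 ^ n * (- c k * (y k)\<^sup>2) ^ n * P k"
      unfolding qderiv_square[OF fpk cnz] P_def by (simp only: power_mult_distrib mult_ac)
    also have "- c k * (y k)\<^sup>2 = - a * (1 + b / a * (y k)\<^sup>2)" using cy[of k] by simp
    finally show ?thesis by (simp only: power_mult_distrib mult_ac)
  qed
  have cinf: "filterlim (\<lambda>k. norm (c k)) at_top sequentially"
  proof (rule filterlim_at_top_mono)
    show "filterlim (\<lambda>k. 1/64 * exp (2 * (Re t0 + real k))) at_top sequentially" by real_asymp
    show "\<forall>\<^sub>F k in sequentially. 1/64 * exp (2 * (Re t0 + real k)) \<le> norm (c k)"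
    proof -
      have "\<forall>\<^sub>F k in sequentially. 1 \<le> Re t0 + real k" by real_asymp
      then show ?thesis by eventually_elim (use low[of "tt _"] in \<open>auto simp: c_def tt_def\<close>)
    qed
  qed
  define m where "m k = 2 / sqrt (norm (c k))" for k
  have mlim: "m \<longlonglongrightarrow> 0" unfolding m_def
    by (intro real_tendsto_divide_at_top[OF tendsto_const] filterlim_compose[OF sqrt_at_top cinf])
  have s64: "sqrt (norm (c k)) \<ge> 64 * real n" for k by (rule real_le_rsqrt[OF cR])
  have m01: "0 \<le> m k" "m k \<le> 1" for k
  proof -
    have "sqrt (norm (c k)) \<ge> 2" using s64[of k] n by linarith
    then have "2 / sqrt (norm (c k)) \<le> 1" by (intro divide_le_eq_1_pos[THEN iffD2]) linarith+
    then show "0 \<le> m k" "m k \<le> 1" by (auto simp: m_def)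
  qed
  have m2: "norm (c k) * (m k)\<^sup>2 = 4" for k using cnz[of k] by (simp add: m_def power_divide)
  have zm: "norm ((quad (c k) ^^ i) (\<xi> k) / c k) \<le> m k" for k i
  proof -
    have "norm (c k) \<ge> 16" using cR[of k] R0 by (simp add: R0_def)
    note periodic_norm_bounds(2)[OF periodic_orbit_fixed[OF fpk] n0 this, of i]
    then have "norm ((quad (c k) ^^ i) (\<xi> k)) / norm (c k) \<le> 2 * sqrt (norm (c k)) / norm (c k)" by (intro divide_right_mono) auto
    also have "\<dots> = m k" using cnz[of k] by (simp add: m_def field_simps)
    finally show ?thesis by (simp add: norm_divide)
  qed
  define \<sigma> where "\<sigma> k = (\<Sum>i<n. (quad (c k) ^^ i) (\<xi> k) / c k)" for k
  have expand: "norm (P k - 1 + \<sigma> k) \<le> 4 ^ n * (m k)\<^sup>2" for k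
    unfolding P_def \<sigma>_def by (rule norm_prod_one_minus_le[OF zm m01])
  have \<sigma>m: "norm (\<sigma> k) \<le> real n * m k" for k
    unfolding \<sigma>_def using sum_norm_bound[of "{..<n}" "\<lambda>i. (quad (c k) ^^ i) (\<xi> k) / c k" "m k"] zm by simp
  have Plim: "P \<longlonglongrightarrow> 1"
  proof -
    have "(\<lambda>k. 4 ^ n * (m k)\<^sup>2 + real n * m k) \<longlonglongrightarrow> 4 ^ n * 0\<^sup>2 + real n * 0" by (intro tendsto_intros mlim)
    then have l0: "(\<lambda>k. 4 ^ n * (m k)\<^sup>2 + real n * m k) \<longlonglongrightarrow> 0" by simp
    have "norm (P k - 1) \<le> 4 ^ n * (m k)\<^sup>2 + real n * m k" for k
      using expand[of k] \<sigma>m[of k] norm_triangle_ineq4[of "P k - 1 + \<sigma> k" "\<sigma> k"] by simp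
    then have "(\<lambda>k. P k - 1) \<longlonglongrightarrow> 0" by (intro Lim_null_comparison[OF _ l0]) simp
    then show ?thesis by (rule LIM_zero_cancel)
  qed
  \<comment> \<open>Both sides of \<open>rel\<close> converge; comparing limits determines the leading coefficient.\<close>
  have \<kappa>: "4 ^ n * (- a) ^ n = 1"
  proof -
    have "(\<lambda>k. (1 + y k ^ n)\<^sup>2) \<longlonglongrightarrow> (1 + 0 ^ n)\<^sup>2" by (intro tendsto_intros ylim)
    moreover have "(\<lambda>k. 4 ^ n * (- a) ^ n * (1 + b / a * (y k)\<^sup>2) ^ n * P k) \<longlonglongrightarrow> 4 ^ n * (- a) ^ n * (1 + b / a * 0\<^sup>2) ^ n * 1"
      by (intro tendsto_intros ylim Plim)
    ultimately have "(1 + 0 ^ n)\<^sup>2 = 4 ^ n * (- a) ^ n * (1 + b / a * 0\<^sup>2) ^ n * (1::complex)"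
      unfolding rel by (rule LIMSEQ_unique)
    then show ?thesis using n0 by (simp add: zero_power)
  qed
  define M where "M = (3 + 2 * (3 ^ n * norm (b / a))) * (norm a * 2) + 4 ^ n * 4"
  have "\<forall>\<^sub>F k in sequentially. norm (y k) < 1" using ynlim by (rule order_tendstoD) simp
  moreover have "\<forall>\<^sub>F k in sequentially. norm (b / a * (y k)\<^sup>2) < 1"
  proof -
    have "(\<lambda>k. norm (b / a * (y k)\<^sup>2)) \<longlonglongrightarrow> norm (b / a * 0\<^sup>2)" by (intro tendsto_intros ylim)
    then show ?thesis by (rule order_tendstoD) simp
  qed
  moreover have "\<forall>\<^sub>F k in sequentially. norm (P k) < 2" using tendsto_norm[OF Plim] by (rule order_tendstoD) simp
  moreover have "\<forall>\<^sub>F k in sequentially. norm (c k) > (4 * M)\<^sup>2" using cinf by (simp add: filterlim_at_top_dense)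
  ultimately have "\<forall>\<^sub>F k in sequentially. False"
  proof eventually_elim
    case (elim k)
    define v where "v = b / a * (y k)\<^sup>2"
    have rel': "(1 + y k ^ n)\<^sup>2 = (1 + v) ^ n * P k" using rel[of k] \<kappa> by (simp add: v_def)
    have "P k - 1 = (2 * y k ^ n + (y k ^ n)\<^sup>2) - P k * ((1 + v) ^ n - 1)"
      using rel' by (simp add: power2_eq_square algebra_simps)
    then have "norm (P k - 1) \<le> norm (2 * y k ^ n + (y k ^ n)\<^sup>2) + norm (P k) * norm ((1 + v) ^ n - 1)"
      by (metis norm_mult norm_triangle_ineq4)
    also have "\<dots> \<le> 3 * (norm (y k))\<^sup>2 + 2 * (3 ^ n * norm v)"
    proof (intro add_mono mult_mono)
      have yn2: "norm (y k) ^ n \<le> (norm (y k))\<^sup>2" using elim(1) n by (intro power_decreasing) auto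
      have yn1: "norm (y k) ^ n \<le> 1" using elim(1) by (intro power_le_one) auto
      have "norm (2 * y k ^ n + (y k ^ n)\<^sup>2) \<le> 2 * norm (y k) ^ n + norm (y k) ^ n * norm (y k) ^ n"
        using norm_triangle_ineq[of "2 * y k ^ n" "(y k ^ n)\<^sup>2"] by (simp add: norm_mult norm_power power2_eq_square)
      also have "\<dots> \<le> 2 * norm (y k) ^ n + norm (y k) ^ n * 1" using yn1 by (intro add_left_mono mult_left_mono) auto
      also have "\<dots> \<le> 3 * (norm (y k))\<^sup>2" using yn2 by simp
      finally show "norm (2 * y k ^ n + (y k ^ n)\<^sup>2) \<le> 3 * (norm (y k))\<^sup>2" .
      show "norm ((1 + v) ^ n - 1) \<le> 3 ^ n * norm v" by (rule norm_one_plus_power_le) (use elim(2) in \<open>simp add: v_def\<close>)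
    qed (use elim(3) in auto)
    also have "\<dots> = (3 + 2 * (3 ^ n * norm (b / a))) * (norm (y k))\<^sup>2"
      unfolding v_def norm_mult norm_power by (simp add: distrib_right)
    finally have Pk: "norm (P k - 1) \<le> (3 + 2 * (3 ^ n * norm (b / a))) * (norm (y k))\<^sup>2" .
    have "norm (c k) * (norm (y k))\<^sup>2 = norm a * norm (1 + v)" using cy[of k] by (simp add: v_def norm_mult[symmetric] norm_power[symmetric])
    also have "\<dots> \<le> norm a * 2" using elim(2) norm_triangle_ineq[of 1 v] by (intro mult_left_mono) (auto simp: v_def)
    finally have cyk: "norm (c k) * (norm (y k))\<^sup>2 \<le> norm a * 2" .
    have "norm (c k) * norm (P k - 1) \<le> norm (c k) * ((3 + 2 * (3 ^ n * norm (b / a))) * (norm (y k))\<^sup>2)"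
      by (intro mult_left_mono Pk) simp
    also have "\<dots> = (3 + 2 * (3 ^ n * norm (b / a))) * (norm (c k) * (norm (y k))\<^sup>2)" by (simp only: mult_ac)
    also have "\<dots> \<le> (3 + 2 * (3 ^ n * norm (b / a))) * (norm a * 2)" by (intro mult_left_mono cyk) (auto intro!: add_nonneg_nonneg)
    finally have 1: "norm (c k) * norm (P k - 1) \<le> (3 + 2 * (3 ^ n * norm (b / a))) * (norm a * 2)" .
    have 2: "norm (c k) * norm (P k - 1 + \<sigma> k) \<le> 4 ^ n * 4"
    proof -
      have "norm (c k) * norm (P k - 1 + \<sigma> k) \<le> norm (c k) * (4 ^ n * (m k)\<^sup>2)" by (intro mult_left_mono expand) simp
      also have "\<dots> = 4 ^ n * (norm (c k) * (m k)\<^sup>2)" by (simp only: mult_ac)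
      finally show ?thesis unfolding m2 .
    qed
    have "norm (\<sigma> k) \<le> norm (P k - 1 + \<sigma> k) + norm (P k - 1)" using norm_triangle_ineq4[of "P k - 1 + \<sigma> k" "P k - 1"] by simp
    then have "norm (c k) * norm (\<sigma> k) \<le> norm (c k) * (norm (P k - 1 + \<sigma> k) + norm (P k - 1))" by (intro mult_left_mono) auto
    then have 3: "norm (c k) * norm (\<sigma> k) \<le> M" using 1 2 by (simp add: M_def distrib_left)
    have "(\<Sum>i<n. (quad (c k) ^^ i) (\<xi> k)) = c k * \<sigma> k" using cnz[of k] by (simp add: \<sigma>_def sum_distrib_left)
    then have "sqrt (norm (c k)) / 4 \<le> M" using sumlarge[of k] 3 by (simp add: norm_mult)
    then have "(sqrt (norm (c k)))\<^sup>2 \<le> (4 * M)\<^sup>2" by (intro power_mono) auto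
    then show False using elim(4) by simp
  qed
  then show False by simp
qed

section \<open>The approximating sequence\<close>

text \<open>Choose in each set a point whose distance from \<open>c\<close> is minimal up to \<open>1 / (n + 1)\<close>.\<close>

lemma eventually_near_imp_convergent_choice:
  fixes A :: "nat \<Rightarrow> complex set"
  assumes ne: "\<And>n. n \<ge> m \<Longrightarrow> A n \<noteq> {}"
    and near: "\<And>\<epsilon>. \<epsilon> > 0 \<Longrightarrow> \<exists>N. \<forall>n\<ge>N. A n \<inter> ball c \<epsilon> \<noteq> {}"
  shows "\<exists>s. (\<forall>n\<ge>m. s n \<in> A n) \<and> s \<longlonglongrightarrow> c"
proof -
  have "\<exists>x. n \<ge> m \<longrightarrow> x \<in> A n \<and> dist c x < infdist c (A n) + inverse (real (Suc n))" for n
  proof (cases "n \<ge> m")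
    case True
    have "(INF a\<in>A n. dist c a) < infdist c (A n) + inverse (real (Suc n))"
      using ne[OF True] by (simp add: infdist_def)
    then obtain x where "x \<in> A n" "dist c x < infdist c (A n) + inverse (real (Suc n))"
      using ne[OF True] by (subst (asm) cINF_less_iff) auto
    then show ?thesis by blast
  qed simp
  then obtain s where s: "\<And>n. n \<ge> m \<Longrightarrow> s n \<in> A n"
    "\<And>n. n \<ge> m \<Longrightarrow> dist c (s n) < infdist c (A n) + inverse (real (Suc n))" by metis
  have "s \<longlonglongrightarrow> c"
  proof (rule tendstoI)
    fix \<epsilon> :: real assume "\<epsilon> > 0"
    then obtain N where N: "\<And>n. n \<ge> N \<Longrightarrow> A n \<inter> ball c (\<epsilon>/2) \<noteq> {}" using near[of "\<epsilon>/2"] by auto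
    have "\<forall>\<^sub>F n in sequentially. inverse (real (Suc n)) < \<epsilon>/2"
      using \<open>\<epsilon> > 0\<close> by (intro order_tendstoD(2)[OF LIMSEQ_inverse_real_of_nat]) simp
    then show "\<forall>\<^sub>F n in sequentially. dist (s n) c < \<epsilon>"
      using eventually_ge_at_top[of "max N m"]
    proof eventually_elim
      case (elim n)
      then obtain x where x: "x \<in> A n" "dist c x < \<epsilon>/2" using N[of n] by auto
      have "infdist c (A n) < \<epsilon>/2" using infdist_le[OF x(1), of c] x(2) by linarith
      then show ?case using s(2)[of n] elim by (simp add: dist_commute)
    qed
  qed
  with s(1) show ?thesis by blast
qed

theorem theorem2:
  fixes n\<^sub>0 :: nat and c :: complex
  assumes "c \<in> X n\<^sub>0 - Mandelbrot"
  shows "\<exists>s :: nat \<Rightarrow> complex. (\<forall>n\<ge>3. s n \<in> X n) \<and> s \<longlonglongrightarrow> c"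
proof (rule eventually_near_imp_convergent_choice)
  show "X n \<noteq> {}" if "n \<ge> 3" for n using that by (rule X_nonempty)
next
  fix \<epsilon> :: real assume \<epsilon>: "\<epsilon> > 0"
  have cX: "multiplier_critical_point n\<^sub>0 c" and cM: "c \<notin> Mandelbrot" using assms by (auto simp: X_def)
  obtain U w where U: "open U" "c \<in> U" "w holomorphic_on U" "\<And>c. c \<in> U \<Longrightarrow> periodic_point c n\<^sub>0 (w c)"
    "((\<lambda>c. qderiv c n\<^sub>0 (w c)) has_field_derivative 0) (at c)"
    using cX unfolding multiplier_critical_point_def multiplier_eq_qderiv by blast
  obtain \<delta> where \<delta>: "\<delta> > 0" "ball c \<delta> \<subseteq> U" using U(1,2) open_contains_ball by blast
  have per: "periodic_point c n\<^sub>0 (w c)" by (rule U(4)[OF U(2)])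
  then have n0: "n\<^sub>0 > 0" by (simp add: periodic_point_def)
  have "\<exists>N. \<forall>n\<ge>N. n mod n\<^sub>0 = s \<longrightarrow> X n \<inter> ball c \<epsilon> \<noteq> {}" if s: "s < n\<^sub>0" for s
  proof (rule critical_points_accumulate[OF n0 \<delta>(1)])
    show "w holomorphic_on ball c \<delta>" by (rule holomorphic_on_subset[OF U(3) \<delta>(2)])
    show "(quad c' ^^ n\<^sub>0) (w c') = w c'" if "c' \<in> ball c \<delta>" for c'
      using U(4)[of c'] \<delta>(2) that by (auto simp: periodic_point_def)
    show "deriv (\<lambda>c. qderiv c n\<^sub>0 (w c)) c = 0" by (rule DERIV_imp_deriv[OF U(5)])
    show "norm (qderiv c n\<^sub>0 (w c)) > 1" by (rule escaping_parameter_homoclinic(1)[OF cM per])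
  qed (rule escaping_parameter_homoclinic(2)[OF cM per s], assumption, rule \<epsilon>)
  then obtain N where N: "\<And>s n. s < n\<^sub>0 \<Longrightarrow> N s \<le> n \<Longrightarrow> n mod n\<^sub>0 = s \<Longrightarrow> X n \<inter> ball c \<epsilon> \<noteq> {}" by metis
  show "\<exists>M. \<forall>n\<ge>M. X n \<inter> ball c \<epsilon> \<noteq> {}"
  proof (intro exI allI impI)
    fix n assume n: "Max (N ` {..<n\<^sub>0}) \<le> n"
    have s: "n mod n\<^sub>0 < n\<^sub>0" using n0 by simp
    then have "N (n mod n\<^sub>0) \<le> Max (N ` {..<n\<^sub>0})" by (intro Max_ge) auto
    then show "X n \<inter> ball c \<epsilon> \<noteq> {}" using N[OF s _ refl] n by simp
  qed
qed

end
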